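(* Let $d\ge1$, $\lambda>0$, and let $V,\psi:\mathbb{R}^d\to\mathbb{R}$ satisfy assumptions (V1)–(V4) and ($\psi$1)–($\psi$3) listed in the context. Let $\rho_\infty$ be a measure on $\mathbb{R}^d\times\mathbb{R}^d$. If $\rho_\infty$ is an invariant probability for the Vlasov-Fokker-Planck equation $$\partial_t\rho=-\mathrm{div}_q(\rho p)+\mathrm{div}_p\big(\rho(\nabla_qV+\nabla_q\psi\ast\rho+p)\big)+\lambda\Delta_p\rho,$$ then its first marginal $q\mapsto\int_{\mathbb{R}^d}\rho_\infty(q,p)\,dp$ is an invariant probability of the McKean-Vlasov diffusion $$dX(t)=-\nabla V(X(t))\,dt-\nabla\psi\ast\mu_t(X(t))\,dt+\sqrt{2\lambda}\,dW(t),$$ where $\mu_t$ is the law of $X(t)$ and $W$ is a $d$-dimensional Wiener process.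
   Context: Coordinates on $\mathbb{R}^{2d}$ are $(q,p)\in\mathbb{R}^d\times\mathbb{R}^d$; subscripts on differential operators indicate the variables on which they act. For $\rho$ on $\mathbb{R}^{2d}$, $(\psi\ast\rho)(q)=\int_{\mathbb{R}^{2d}}\psi(q-q')\rho(q',p')\,dq'dp'$; for $\mu$ on $\mathbb{R}^d$, $\psi\ast\mu$ is the usual convolution. An invariant probability (stationary measure) for the Vlasov-Fokker-Planck equation is a probability density $\rho\in L^1(\mathbb{R}^{2d})\cap L^\infty(\mathbb{R}^{2d})$, with $\psi\ast\rho$ and $\nabla\psi\ast\rho$ well defined, satisfying $$-\mathrm{div}_q(\rho p)+\mathrm{div}_p\big(\rho(\nabla_qV+\nabla_q\psi\ast\rho+p)\big)+\lambda\Delta_p\rho=0.$$ The forward Kolmogorov equation of the McKean-Vlasov diffusion is $\partial_t\mu_t=\mathrm{div}[\mu_t(\nabla V+\nabla\psi\ast\mu_t)]+\lambda\Delta\mu_t$, and an invariant probability of the diffusion is a probability measure that is a time-independent solution of this equation. Assumptions on $V$: (V1) $V$ is smooth and there exist an integer $m\ge1$ and $C_{2m}>0$ with $\lim_{|x|\to\infty}V(x)/|x|^{2m}=C_{2m}$. (V2) $\nabla V(x)=0$ has finitely many solutions. (V3) There are $C_2,C_4>0$ with $V(x)\ge C_4|x|^4-C_2|x|^2$ for all $x\in\mathbb{R}^d$. (V4) $\mathrm{Hess}\,V(x)\to+\infty$ as $|x|\to\infty$ (i.e. its smallest eigenvalue tends to $+\infty$), and $\mathrm{Hess}\,V(x)>0$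 for all $x\notin K$, where $K\subset\mathbb{R}^d$ is a compact set containing all critical points of $V$. Assumptions on $\psi$: ($\psi$1) $\psi(x)=G(|x|)$ for an even polynomial $G$ on $\mathbb{R}$ with $\deg G=:2n\ge2$. ($\psi$2) $G$ and $G''$ are convex. ($\psi$3) $G(0)=0$. *)

theory Defs
  imports
    "HOL-Analysis.Analysis"
    "HOL-Probability.Probability_Measure"
    "HOL-Computational_Algebra.Polynomial"
begin

section \<open>Differential operators\<close>

text \<open>
  On finite-dimensional spaces this is the usual class \<open>C\<^sup>k\<close>: all iterated directional
  derivatives up to order \<open>k\<close> exist and are continuous.
\<close>

fun Ck :: "nat \<Rightarrow> ('a::real_normed_vector \<Rightarrow> real) \<Rightarrow> bool" where
  "Ck 0 f \<longleftrightarrow> continuous_on UNIV f"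
| "Ck (Suc k) f \<longleftrightarrow>
     (\<forall>x. f differentiable (at x)) \<and> (\<forall>v. Ck k (\<lambda>x. frechet_derivative f (at x) v))"

definition smooth :: "('a::real_normed_vector \<Rightarrow> real) \<Rightarrow> bool" where
  "smooth f \<longleftrightarrow> (\<forall>k. Ck k f)"

definition test_function :: "('a::real_normed_vector \<Rightarrow> real) \<Rightarrow> bool" where
  "test_function f \<longleftrightarrow> smooth f \<and> compact (closure {x. f x \<noteq> 0})"

definition grad :: "('a::real_inner \<Rightarrow> real) \<Rightarrow> 'a \<Rightarrow> 'a" where
  "grad f x = (THE D. GDERIV f x :> D)"

definition hessian :: "(real^'d \<Rightarrow> real) \<Rightarrow> real^'d \<Rightarrow> real^'d^'d" where
  "hessian f x = jacobian (grad f) (at x)"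

definition laplacian :: "(real^'d \<Rightarrow> real) \<Rightarrow> real^'d \<Rightarrow> real" where
  "laplacian f x = trace (hessian f x)"

text \<open>Operators acting on only one of the variables of a function of \<open>(q, p)\<close>.\<close>

definition grad_q :: "((real^'d) \<times> (real^'d) \<Rightarrow> real) \<Rightarrow> (real^'d) \<times> (real^'d) \<Rightarrow> real^'d" where
  "grad_q f = (\<lambda>(q, p). grad (\<lambda>q'. f (q', p)) q)"

definition grad_p :: "((real^'d) \<times> (real^'d) \<Rightarrow> real) \<Rightarrow> (real^'d) \<times> (real^'d) \<Rightarrow> real^'d" where
  "grad_p f = (\<lambda>(q, p). grad (\<lambda>p'. f (q, p')) p)"

definition laplacian_p :: "((real^'d) \<times> (real^'d) \<Rightarrow> real) \<Rightarrow> (real^'d) \<times> (real^'d) \<Rightarrow> real" where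
  "laplacian_p f = (\<lambda>(q, p). laplacian (\<lambda>p'. f (q, p')) p)"

section \<open>Assumptions on the confining and interaction potentials\<close>

definition eigenvalues :: "real^'d^'d \<Rightarrow> real set" where
  "eigenvalues A = {e. \<exists>v. v \<noteq> 0 \<and> A *v v = e *\<^sub>R v}"

text \<open>
  Only applied to Hessians of smooth functions, which are symmetric, so that the set of
  real eigenvalues is finite and nonempty.
\<close>

definition smallest_eigenvalue :: "real^'d^'d \<Rightarrow> real" where
  "smallest_eigenvalue A = Min (eigenvalues A)"

definition positive_definite :: "real^'d^'d \<Rightarrow> bool" where
  "positive_definite A \<longleftrightarrow> (\<forall>v. v \<noteq> 0 \<longrightarrow> v \<bullet> (A *v v) > 0)"

definition assm_V1 :: "(real^'d \<Rightarrow> real) \<Rightarrow> bool" where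
  "assm_V1 V \<longleftrightarrow> smooth V \<and>
     (\<exists>m::nat. \<exists>C>0. m \<ge> 1 \<and> ((\<lambda>x. V x / norm x ^ (2 * m)) \<longlongrightarrow> C) at_infinity)"

definition assm_V2 :: "(real^'d \<Rightarrow> real) \<Rightarrow> bool" where
  "assm_V2 V \<longleftrightarrow> finite {x. grad V x = 0}"

definition assm_V3 :: "(real^'d \<Rightarrow> real) \<Rightarrow> bool" where
  "assm_V3 V \<longleftrightarrow> (\<exists>C2>0. \<exists>C4>0. \<forall>x. V x \<ge> C4 * norm x ^ 4 - C2 * (norm x)\<^sup>2)"

definition assm_V4 :: "(real^'d \<Rightarrow> real) \<Rightarrow> bool" where
  "assm_V4 V \<longleftrightarrow>
     filterlim (\<lambda>x. smallest_eigenvalue (hessian V x)) at_top at_infinity \<and>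
     (\<exists>K. compact K \<and> {x. grad V x = 0} \<subseteq> K \<and> (\<forall>x. x \<notin> K \<longrightarrow> positive_definite (hessian V x)))"

definition confining_potential :: "(real^'d \<Rightarrow> real) \<Rightarrow> bool" where
  "confining_potential V \<longleftrightarrow> assm_V1 V \<and> assm_V2 V \<and> assm_V3 V \<and> assm_V4 V"

definition interaction_potential :: "(real^'d \<Rightarrow> real) \<Rightarrow> bool" where
  "interaction_potential \<psi> \<longleftrightarrow>
     (\<exists>(G::real poly) n::nat.
        (\<forall>x. \<psi> x = poly G (norm x)) \<and>
        (\<forall>r. poly G (- r) = poly G r) \<and> n \<ge> 1 \<and> degree G = 2 * n \<and>
        convex_on UNIV (poly G) \<and> convex_on UNIV (poly (pderiv (pderiv G))) \<and>
        poly G 0 = 0)"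

section \<open>Invariant probabilities of the Vlasov-Fokker-Planck equation\<close>

text \<open>
  Convolution of a scalar or vector field on position space with a density on phase space.
\<close>

definition conv_density ::
    "(real^'d \<Rightarrow> 'b::{banach, second_countable_topology}) \<Rightarrow> ((real^'d) \<times> (real^'d) \<Rightarrow> real) \<Rightarrow> real^'d \<Rightarrow> 'b" where
  "conv_density f \<rho> q = (\<integral>z. \<rho> z *\<^sub>R f (q - fst z) \<partial>lborel)"

definition conv_density_defined ::
    "(real^'d \<Rightarrow> 'b::{banach, second_countable_topology}) \<Rightarrow> ((real^'d) \<times> (real^'d) \<Rightarrow> real) \<Rightarrow> bool" where
  "conv_density_defined f \<rho> \<longleftrightarrow> (\<forall>q. integrable lborel (\<lambda>z. \<rho> z *\<^sub>R f (q - fst z)))"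

text \<open>
  As \<open>\<rho>\<close> is only in \<open>L\<^sup>1 \<inter> L\<^sup>\<infinity>\<close>, the stationary equation
  \<open>- div\<^sub>q (\<rho> p) + div\<^sub>p (\<rho> (\<nabla>V + \<nabla>\<psi> \<ast> \<rho> + p)) + lam \<Delta>\<^sub>p \<rho> = 0\<close>
  is understood in the sense of distributions: all derivatives are moved to the test function.
\<close>

definition vfp_stationary ::
    "real \<Rightarrow> (real^'d \<Rightarrow> real) \<Rightarrow> (real^'d \<Rightarrow> real) \<Rightarrow> ((real^'d) \<times> (real^'d) \<Rightarrow> real) \<Rightarrow> bool" where
  "vfp_stationary lam V \<psi> \<rho> \<longleftrightarrow>
     (\<forall>\<phi>. test_function \<phi> \<longrightarrow>
        has_bochner_integral lborel
          (\<lambda>(q, p). \<rho> (q, p) *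
             (p \<bullet> grad_q \<phi> (q, p)
              - (grad V q + conv_density (grad \<psi>) \<rho> q + p) \<bullet> grad_p \<phi> (q, p)
              + lam * laplacian_p \<phi> (q, p)))
          0)"

definition vfp_invariant_probability ::
    "real \<Rightarrow> (real^'d \<Rightarrow> real) \<Rightarrow> (real^'d \<Rightarrow> real) \<Rightarrow> ((real^'d) \<times> (real^'d) \<Rightarrow> real) \<Rightarrow> bool" where
  "vfp_invariant_probability lam V \<psi> \<rho> \<longleftrightarrow>
     integrable lborel \<rho> \<and>
     (\<exists>C. AE z in lborel. \<bar>\<rho> z\<bar> \<le> C) \<and>
     (AE z in lborel. 0 \<le> \<rho> z) \<and>
     (\<integral>z. \<rho> z \<partial>lborel) = 1 \<and>
     conv_density_defined \<psi> \<rho> \<and>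
     conv_density_defined (grad \<psi>) \<rho> \<and>
     vfp_stationary lam V \<psi> \<rho>"

section \<open>Invariant probabilities of the McKean-Vlasov diffusion\<close>

definition conv_measure ::
    "(real^'d \<Rightarrow> 'b::{banach, second_countable_topology}) \<Rightarrow> (real^'d) measure \<Rightarrow> real^'d \<Rightarrow> 'b" where
  "conv_measure f \<mu> x = (\<integral>y. f (x - y) \<partial>\<mu>)"

definition conv_measure_defined ::
    "(real^'d \<Rightarrow> 'b::{banach, second_countable_topology}) \<Rightarrow> (real^'d) measure \<Rightarrow> bool" where
  "conv_measure_defined f \<mu> \<longleftrightarrow> (\<forall>x. integrable \<mu> (\<lambda>y. f (x - y)))"

text \<open>
  Solutions of the forward Kolmogorov equation
  \<open>\<partial>\<^sub>t \<mu>\<^sub>t = div (\<mu>\<^sub>t (\<nabla>V + \<nabla>\<psi> \<ast> \<mu>\<^sub>t)) + lam \<Delta> \<mu>\<^sub>t\<close> are curves of measures,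
  and the equation is tested against smooth compactly supported functions of the space variable.
\<close>

definition forward_kolmogorov_solution ::
    "real \<Rightarrow> (real^'d \<Rightarrow> real) \<Rightarrow> (real^'d \<Rightarrow> real) \<Rightarrow> (real \<Rightarrow> (real^'d) measure) \<Rightarrow> bool" where
  "forward_kolmogorov_solution lam V \<psi> \<mu> \<longleftrightarrow>
     (\<forall>t>0. conv_measure_defined (grad \<psi>) (\<mu> t) \<and>
        (\<forall>\<phi>. test_function \<phi> \<longrightarrow>
           (let L\<phi> = (\<lambda>x. lam * laplacian \<phi> x - (grad V x + conv_measure (grad \<psi>) (\<mu> t) x) \<bullet> grad \<phi> x)
            in integrable (\<mu> t) L\<phi> \<and>
               ((\<lambda>s. \<integral>x. \<phi> x \<partial>\<mu> s) has_real_derivative (\<integral>x. L\<phi> x \<partial>\<mu> t)) (at t))))"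

definition diffusion_invariant_probability ::
    "real \<Rightarrow> (real^'d \<Rightarrow> real) \<Rightarrow> (real^'d \<Rightarrow> real) \<Rightarrow> (real^'d) measure \<Rightarrow> bool" where
  "diffusion_invariant_probability lam V \<psi> \<mu> \<longleftrightarrow>
     prob_space \<mu> \<and> sets \<mu> = sets borel \<and> forward_kolmogorov_solution lam V \<psi> (\<lambda>t. \<mu>)"

text \<open>The first marginal, as the measure with density \<open>q \<mapsto> \<integral> \<rho>(q, p) dp\<close>.\<close>

definition first_marginal :: "((real^'d) \<times> (real^'d) \<Rightarrow> real) \<Rightarrow> (real^'d) measure" where
  "first_marginal \<rho> = density lborel (\<lambda>q. ennreal (\<integral>p. \<rho> (q, p) \<partial>lborel))"

end

theory Submission
  imports Defs "HOL-Analysis.Ball_Volume"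
begin

text \<open>
  Write \<open>b = \<nabla>V + \<nabla>\<psi> \<ast> \<rho>\<close> for the self-consistent force, a continuous gradient \<open>b = \<nabla>W\<close>, and
  \<open>H = \<bar>p\<bar>\<^sup>2/2 + W\<close> for the energy. For this frozen force \<open>\<rho>\<close> solves a linear stationary
  equation, and the heart of the matter is that friction and noise must balance on their own:
  \<open>lam \<nabla>\<^sub>p \<rho> + p \<rho> = 0\<close>, that is, \<open>\<rho>\<close> is Maxwellian in the momentum (\<open>maxwell_identity\<close>).
  Then the Hamiltonian transport vanishes separately (\<open>transport_identity\<close>), and testing it with
  \<open>p \<cdot> \<nabla>\<phi>(q)\<close> produces exactly \<open>\<integral> \<rho> (lam \<Delta>\<phi> - b \<cdot> \<nabla>\<phi>) = 0\<close> (\<open>diffusion_identity\<close>), the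
  stationary equation of the diffusion for the first marginal. The mean force depends on \<open>\<rho>\<close>
  only through this marginal, so it is the right one.

  The balance of friction and noise is an entropy argument. With the Gibbs factor
  \<open>G = exp (- H / lam)\<close> one multiplies the equation by \<open>\<beta>'(\<rho>/G)\<close> for a convex \<open>\<beta>\<close>; the
  Hamiltonian part drops out and the dissipation \<open>\<integral> G \<beta>''(\<rho>/G) \<bar>\<nabla>\<^sub>p (\<rho>/G)\<bar>\<^sup>2\<close> must be zero.
  Two difficulties arise for a weak solution in \<open>L\<^sup>1 \<inter> L\<^sup>\<infinity>\<close>. Nothing is known about its decay
  relative to \<open>G\<close>: this is met by the bounded function \<open>\<beta>(s) = 1 / (1 + s)\<close> and a cutoff in the
  energy, whose cost is of order \<open>exp (- R / lam)\<close> times a power of \<open>R\<close>, uniformly in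
  \<open>\<rho>\<close>. And it is not differentiable: this is met by mollification with a kernel that is much
  narrower in \<open>p\<close> than in \<open>q\<close> (\<open>kinetic_mollifier_exists\<close>). The commutator with
  \<open>p \<cdot> \<nabla>\<^sub>q\<close> is then uniformly small, while the commutator with the force is small under a momentum
  divergence and is absorbed by the dissipation. Letting the mollification and then the cutoff go
  gives the claim (\<open>dissipation_bound\<close>, \<open>maxwell_defect_vanishes\<close>).

  The hypotheses on the potentials enter through \<open>mean_field_potential\<close>, which makes \<open>b\<close> a
  continuous gradient, and through the quartic lower bound on \<open>V\<close>, which gives
  \<open>W \<ge> \<bar>q\<bar>\<^sup>2 - M\<close>.
\<close>

section \<open>Smooth functions and test functions\<close>

text \<open>
  The directional derivative, in the shape in which it occurs in the definition of
  \<^const>\<open>Ck\<close>.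
\<close>

abbreviation ddir :: "'a::real_normed_vector \<Rightarrow> ('a \<Rightarrow> real) \<Rightarrow> 'a \<Rightarrow> real" where
  "ddir v f \<equiv> (\<lambda>x. frechet_derivative f (at x) v)"

lemma ddir_eqI:
  assumes "\<And>x. (f has_derivative f' x) (at x)"
  shows "ddir v f = (\<lambda>x. f' x v)"
  by (metis assms frechet_derivative_at)

lemma Ck_SucI:
  assumes "\<And>x. (f has_derivative f' x) (at x)" and "\<And>v. Ck k (\<lambda>x. f' x v)"
  shows "Ck (Suc k) f"
  using assms ddir_eqI[of f f'] by (auto simp: differentiable_def)

lemma Ck_Suc_has_derivative:
  "Ck (Suc k) f \<Longrightarrow> (f has_derivative frechet_derivative f (at x)) (at x)"
  by (simp add: frechet_derivative_works)

lemma Ck_SucD: "Ck (Suc k) f \<Longrightarrow> Ck k f"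
proof (induction k arbitrary: f)
  case 0
  then show ?case
    by (auto intro!: continuous_at_imp_continuous_on differentiable_imp_continuous_within)
next
  case (Suc k)
  then show ?case by (metis Ck.simps(2))
qed

lemma Ck_0: "Ck k f \<Longrightarrow> continuous_on UNIV f"
  by (induction k arbitrary: f) (simp, metis Ck_SucD)

lemma Ck_const: "Ck k (\<lambda>x. c)"
  by (induction k arbitrary: c) (auto intro: Ck_SucI[where f'="\<lambda>x v. 0"])

lemma Ck_add: "Ck k f \<Longrightarrow> Ck k g \<Longrightarrow> Ck k (\<lambda>x. f x + g x)"
proof (induction k arbitrary: f g)
  case 0 then show ?case by (auto intro: continuous_on_add)
next
  case (Suc k)
  show ?case
    by (rule Ck_SucI[where f'="\<lambda>x v. ddir v f x + ddir v g x"])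
       (use Suc in \<open>auto intro!: has_derivative_add Ck_Suc_has_derivative\<close>)
qed

lemma Ck_mult: "Ck k f \<Longrightarrow> Ck k g \<Longrightarrow> Ck k (\<lambda>x. f x * g x)"
proof (induction k arbitrary: f g)
  case 0 then show ?case by (auto intro: continuous_on_mult)
next
  case (Suc k)
  show ?case
  proof (rule Ck_SucI[where f'="\<lambda>x v. f x * ddir v g x + ddir v f x * g x"])
    fix x
    show "((\<lambda>x. f x * g x) has_derivative (\<lambda>v. f x * ddir v g x + ddir v f x * g x)) (at x)"
      using Suc.prems by (intro has_derivative_mult Ck_Suc_has_derivative)
  next
    fix v
    show "Ck k (\<lambda>x. f x * ddir v g x + ddir v f x * g x)"
      using Suc.prems Suc.IH Ck_SucD[OF Suc.prems(1)] Ck_SucD[OF Suc.prems(2)]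
      by (intro Ck_add Suc.IH) auto
  qed
qed

lemma Ck_compose_affine:
  assumes "bounded_linear A"
  shows "Ck k f \<Longrightarrow> Ck k (\<lambda>x. f (a + A x))"
proof (induction k arbitrary: f)
  case 0
  then show ?case
    by (auto intro!: continuous_on_compose2[of UNIV f] continuous_intros
        bounded_linear.continuous_on[OF assms])
next
  case (Suc k)
  show ?case
  proof (rule Ck_SucI[where f'="\<lambda>x v. ddir (A v) f (a + A x)"])
    fix x
    show "((\<lambda>x. f (a + A x)) has_derivative (\<lambda>v. ddir (A v) f (a + A x))) (at x)"
    proof (rule has_derivative_compose[OF _ Ck_Suc_has_derivative[OF Suc.prems]])
      show "((\<lambda>x. a + A x) has_derivative A) (at x)"
        using bounded_linear_imp_has_derivative[OF assms]
        by (auto intro!: derivative_eq_intros)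
    qed
  next
    fix v
    show "Ck k (\<lambda>x. ddir (A v) f (a + A x))"
      using Suc by auto
  qed
qed

lemma Ck_bounded_linear:
  assumes "bounded_linear A"
  shows "Ck k A"
proof (cases k)
  case 0
  then show ?thesis using linear_continuous_on[OF assms] by simp
next
  case (Suc j)
  have "Ck (Suc j) A"
    by (rule Ck_SucI[where f'="\<lambda>x. A"])
       (rule bounded_linear_imp_has_derivative[OF assms], rule Ck_const)
  then show ?thesis by (simp only: Suc)
qed

text \<open>
  The chain rule trades one derivative of \<open>g\<close> and one of \<open>f\<close> for a
  product of functions of class \<open>C\<^sup>k\<close>, so the induction has to run over all
  \<open>g\<close> at once.
\<close>

lemma Ck_compose_real:
  fixes g :: "real \<Rightarrow> real"
  shows "Ck k g \<Longrightarrow> Ck k f \<Longrightarrow> Ck k (\<lambda>x. g (f x))"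
proof (induction k arbitrary: f g)
  case 0
  then show ?case by (auto intro!: continuous_on_compose2[of UNIV g UNIV f])
next
  case (Suc k)
  have g: "(g has_derivative (\<lambda>t. t * ddir 1 g y)) (at y)" for y
  proof -
    have *: "(g has_derivative frechet_derivative g (at y)) (at y)"
      by (rule Ck_Suc_has_derivative[OF Suc.prems(1)])
    then have "linear (frechet_derivative g (at y))"
      using has_derivative_linear by blast
    then have "frechet_derivative g (at y) t = t * ddir 1 g y" for t
      using linear_cmul[of "frechet_derivative g (at y)" t 1] by simp
    then have "frechet_derivative g (at y) = (\<lambda>t. t * ddir 1 g y)" by (rule ext)
    with * show ?thesis by simp
  qed
  show ?case
  proof (rule Ck_SucI[where f'="\<lambda>x v. ddir v f x * ddir 1 g (f x)"])
    fix x
    show "((\<lambda>x. g (f x)) has_derivative (\<lambda>v. ddir v f x * ddir 1 g (f x))) (at x)"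
      using has_derivative_compose[OF Ck_Suc_has_derivative[OF Suc.prems(2)] g] by simp
  next
    fix v
    show "Ck k (\<lambda>x. ddir v f x * ddir 1 g (f x))"
    proof (rule Ck_mult)
      show "Ck k (ddir v f)" using Suc.prems(2) by simp
      have "Ck k (ddir 1 g)" using Suc.prems(1) by simp
      then show "Ck k (\<lambda>x. ddir 1 g (f x))"
        by (rule Suc.IH) (rule Ck_SucD[OF Suc.prems(2)])
    qed
  qed
qed

lemma Ck_sum: "(\<And>i. i \<in> I \<Longrightarrow> Ck k (f i)) \<Longrightarrow> Ck k (\<lambda>x. \<Sum>i\<in>I. f i x)"
  by (induction I rule: infinite_finite_induct) (auto intro: Ck_const Ck_add)

lemma Ck_compose_real_deriv:
  fixes g g' :: "real \<Rightarrow> real"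
  assumes "\<And>x. (g has_real_derivative g' x) (at x)" "Ck k g'"
  shows "Ck (Suc k) g"
  by (rule Ck_SucI[where f'="\<lambda>x v. g' x * v"])
     (use assms in \<open>auto simp: has_field_derivative_def intro: Ck_mult Ck_const\<close>)

lemma smooth_Ck: "smooth f \<Longrightarrow> Ck k f"
  by (simp add: smooth_def)

lemma smooth_has_derivative:
  "smooth f \<Longrightarrow> (f has_derivative frechet_derivative f (at x)) (at x)"
  using Ck_Suc_has_derivative smooth_Ck by blast

lemma smooth_differentiable: "smooth f \<Longrightarrow> f differentiable (at x)"
  using smooth_Ck[of f 1] by simp

lemma smooth_ddir: "smooth f \<Longrightarrow> smooth (ddir v f)"
  unfolding smooth_def by (metis Ck.simps(2))

lemma smooth_continuous: "smooth f \<Longrightarrow> continuous_on UNIV f"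
  using Ck_0 smooth_def by blast

lemma smooth_mult: "smooth f \<Longrightarrow> smooth g \<Longrightarrow> smooth (\<lambda>x. f x * g x)"
  by (simp add: smooth_def Ck_mult)

lemma smooth_add: "smooth f \<Longrightarrow> smooth g \<Longrightarrow> smooth (\<lambda>x. f x + g x)"
  by (simp add: smooth_def Ck_add)

lemma smooth_const: "smooth (\<lambda>x. c)"
  by (simp add: smooth_def Ck_const)

lemma smooth_sum: "(\<And>i. i \<in> I \<Longrightarrow> smooth (f i)) \<Longrightarrow> smooth (\<lambda>x. \<Sum>i\<in>I. f i x)"
  by (simp add: smooth_def Ck_sum)

lemma smooth_compose_affine: "bounded_linear A \<Longrightarrow> smooth f \<Longrightarrow> smooth (\<lambda>x. f (a + A x))"
  by (simp add: smooth_def Ck_compose_affine)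

lemma smooth_compose_linear: "bounded_linear A \<Longrightarrow> smooth f \<Longrightarrow> smooth (\<lambda>x. f (A x))"
  using smooth_compose_affine[of A f 0] by simp

lemma smooth_bounded_linear: "bounded_linear A \<Longrightarrow> smooth A"
  by (simp add: smooth_def Ck_bounded_linear)

lemma smooth_compose_real: "smooth g \<Longrightarrow> smooth f \<Longrightarrow> smooth (\<lambda>x. (g::real\<Rightarrow>real) (f x))"
  by (simp add: smooth_def Ck_compose_real)

lemma test_function_iff_bounded:
  fixes f :: "'a::euclidean_space \<Rightarrow> real"
  shows "test_function f \<longleftrightarrow> smooth f \<and> bounded {x. f x \<noteq> 0}"
  by (simp add: test_function_def)

lemma ddir_zero_outside:
  fixes f :: "'a::euclidean_space \<Rightarrow> real"
  assumes "\<And>x. f differentiable (at x)" "\<And>x. r < norm x \<Longrightarrow> f x = 0" "r < norm x"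
  shows "ddir v f x = 0"
proof -
  have op: "open {x::'a. r < norm x}"
    by (intro open_Collect_less continuous_intros)
  have "((\<lambda>x. 0) has_derivative frechet_derivative f (at x)) (at x)"
    by (rule has_derivative_transform_within_open[OF _ op, of f])
       (use assms in \<open>auto simp: frechet_derivative_works[symmetric]\<close>)
  then have "frechet_derivative f (at x) = (\<lambda>v. 0)"
    using has_derivative_unique has_derivative_const by blast
  then show ?thesis by simp
qed

lemma test_function_zero_outside:
  fixes f :: "'a::euclidean_space \<Rightarrow> real"
  assumes "test_function f"
  obtains r where "r > 0" "\<And>x. r < norm x \<Longrightarrow> f x = 0"
proof -
  from assms obtain r where r: "r > 0" "\<And>x. f x \<noteq> 0 \<Longrightarrow> norm x \<le> r"
    unfolding test_function_iff_bounded bounded_pos by auto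
  then show ?thesis using that[of r] by (meson not_le)
qed

lemma test_functionI:
  fixes f :: "'a::euclidean_space \<Rightarrow> real"
  assumes "smooth f" "\<And>x. r < norm x \<Longrightarrow> f x = 0"
  shows "test_function f"
  unfolding test_function_iff_bounded
  using assms by (auto intro!: boundedI[where B=r]) (meson not_le)

lemma test_function_ddir:
  fixes f :: "'a::euclidean_space \<Rightarrow> real"
  assumes "test_function f"
  shows "test_function (ddir v f)"
proof -
  obtain r where "r > 0" "\<And>x. r < norm x \<Longrightarrow> f x = 0"
    using test_function_zero_outside assms by blast
  moreover have "smooth f" using assms by (simp add: test_function_def)
  ultimately show ?thesis
    by (intro test_functionI[where r=r] ddir_zero_outside[where r=r] smooth_ddir smooth_differentiable)
qed

lemma test_function_smooth: "test_function f \<Longrightarrow> smooth f"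
  by (simp add: test_function_def)

section \<open>Bump functions\<close>

text \<open>
  These are the functions \<open>p (1/t) exp (- 1/t)\<close>, extended by zero to
  \<open>t \<le> 0\<close>. Differentiation maps the family to itself, which is why a polynomial
  factor is carried along: smoothness of \<open>exp (- 1/t)\<close> is then a one-line
  induction.
\<close>

definition flat :: "real poly \<Rightarrow> real \<Rightarrow> real" where
  "flat p t = (if t > 0 then poly p (1 / t) * exp (- (1 / t)) else 0)"

lemma poly_exp_neg_tendsto_0: "((\<lambda>x. poly p x * exp (- x)) \<longlongrightarrow> (0::real)) at_top"
proof -
  have "((\<lambda>x. \<Sum>i\<le>degree p. coeff p i * (x ^ i / exp x)) \<longlongrightarrow> (\<Sum>i\<le>degree p. coeff p i * 0)) at_top"
    by (intro tendsto_intros tendsto_power_div_exp_0)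
  then show ?thesis
    by (simp add: poly_altdef sum_distrib_right exp_minus divide_inverse mult.assoc)
qed

lemma flat_tendsto_0: "(flat p \<longlongrightarrow> 0) (at 0)"
proof -
  have "((\<lambda>t. poly p (1 / t) * exp (- (1 / t))) \<longlongrightarrow> 0) (at_right 0)"
    using filterlim_compose[OF poly_exp_neg_tendsto_0 filterlim_inverse_at_top_right, of p]
    by (simp add: inverse_eq_divide)
  then have r: "(flat p \<longlongrightarrow> 0) (at_right 0)"
    by (rule filterlim_cong[OF refl refl, THEN iffD1, rotated])
       (auto simp: flat_def eventually_at_right_field intro: exI[of _ 1])
  have l: "(flat p \<longlongrightarrow> 0) (at_left 0)"
    by (rule tendsto_eventually) (auto simp: flat_def eventually_at_left_field intro: exI[of _ "-1"])
  show ?thesis using r l filterlim_split_at by blast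
qed

lemma flat_has_derivative:
  "(flat p has_real_derivative flat (monom 1 2 * (p - pderiv p)) t) (at t)"
proof (cases t "0::real" rule: linorder_cases)
  case less
  have "((\<lambda>t. 0) has_real_derivative 0) (at t)" by simp
  then have "(flat p has_real_derivative 0) (at t)"
    by (rule has_field_derivative_transform_within_open[of _ _ _ "{..<0}"])
       (use less in \<open>auto simp: flat_def\<close>)
  then show ?thesis using less by (simp add: flat_def)
next
  case greater
  have "((\<lambda>t. poly p (1 / t) * exp (- (1 / t))) has_real_derivative
     poly (monom 1 2 * (p - pderiv p)) (1 / t) * exp (- (1 / t))) (at t)"
  proof -
    have "((\<lambda>t. 1 / t) has_real_derivative - (1 / t\<^sup>2)) (at t)"
      using greater by (auto intro!: derivative_eq_intros simp: power2_eq_square)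
    note d = DERIV_mult[OF DERIV_chain2[OF poly_DERIV this, of p]
        DERIV_chain2[OF DERIV_exp DERIV_minus[OF this]]]
    show ?thesis
      by (rule DERIV_cong[OF d]) (simp add: poly_monom algebra_simps power2_eq_square)
  qed
  then have "(flat p has_real_derivative
     poly (monom 1 2 * (p - pderiv p)) (1 / t) * exp (- (1 / t))) (at t)"
    by (rule has_field_derivative_transform_within_open[of _ _ _ "{0<..}"])
       (use greater in \<open>auto simp: flat_def\<close>)
  then show ?thesis using greater by (simp add: flat_def)
next
  case equal
  have "((\<lambda>h. (flat p h - flat p 0) / h) \<longlongrightarrow> 0) (at 0)"
  proof (rule Lim_transform_eventually[OF flat_tendsto_0[of "monom 1 1 * p"]])
    show "\<forall>\<^sub>F h in at 0. flat (monom 1 1 * p) h = (flat p h - flat p 0) / h"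
      by (auto simp: flat_def poly_monom)
  qed
  then show ?thesis
    using equal by (simp add: DERIV_def flat_def)
qed

lemma smooth_flat: "smooth (flat p)"
proof -
  have "Ck k (flat p)" for k
  proof (induction k arbitrary: p)
    case 0
    then show ?case
      using DERIV_isCont[OF flat_has_derivative]
      by (simp add: continuous_at_imp_continuous_on)
  next
    case (Suc k)
    show ?case by (rule Ck_compose_real_deriv[OF flat_has_derivative Suc.IH])
  qed
  then show ?thesis by (simp add: smooth_def)
qed

text \<open>
  Evaluate the flat function at \<open>r\<^sup>2 - \<bar>x\<bar>\<^sup>2\<close>, which is a
  polynomial in the coordinates.
\<close>

lemma bump_function_exists:
  assumes "r > 0"
  obtains k :: "'a::euclidean_space \<Rightarrow> real" where
    "test_function k" "\<And>x. k x \<ge> 0" "k 0 > 0" "\<And>x. r < norm x \<Longrightarrow> k x = 0"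
proof
  let ?k = "\<lambda>x::'a. flat 1 (r\<^sup>2 + (-1) * (\<Sum>i\<in>Basis. (x \<bullet> i) * (x \<bullet> i)))"
  have eq: "r\<^sup>2 + (-1) * (\<Sum>i\<in>Basis. (x \<bullet> i) * (x \<bullet> i)) = r\<^sup>2 - (norm x)\<^sup>2" for x :: 'a
    by (metis (no_types) add_uminus_conv_diff euclidean_inner mult_minus1 power2_norm_eq_inner)
  have sm: "smooth ?k"
    by (rule smooth_compose_real[OF smooth_flat])
       (intro smooth_add smooth_const smooth_mult smooth_sum
        smooth_bounded_linear bounded_linear_inner_left)
  show z: "?k x = 0" if "r < norm x" for x
    using that assms power_strict_mono[of r "norm x" 2] unfolding eq by (simp add: flat_def)
  show "test_function ?k"
    by (rule test_functionI[OF sm z])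
  show "?k x \<ge> 0" for x by (simp add: flat_def)
  show "?k 0 > 0" using assms by (simp add: flat_def)
qed

section \<open>Integration by parts and parameter integrals\<close>

lemma lborel_integral_shift:
  fixes f :: "'a::euclidean_space \<Rightarrow> 'b::{banach, second_countable_topology}"
  assumes "f \<in> borel_measurable borel"
  shows "(\<integral>x. f (x + a) \<partial>lborel) = (\<integral>x. f x \<partial>lborel)"
    and "integrable lborel (\<lambda>x. f (x + a)) = integrable lborel f"
proof -
  show "(\<integral>x. f (x + a) \<partial>lborel) = (\<integral>x. f x \<partial>lborel)"
    using assms by (subst (2) lborel_distr_plus[of a, symmetric])
      (simp add: integral_distr add.commute)
  show "integrable lborel (\<lambda>x. f (x + a)) = integrable lborel f"
    using assms by (subst (2) lborel_distr_plus[of a, symmetric])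
      (simp add: integrable_distr_eq add.commute)
qed

lemma lborel_distr_reflect:
  fixes a :: "'a::euclidean_space"
  shows "distr lborel borel (\<lambda>x. a - x) = lborel"
  by (subst lborel_affine[of "-1" a]) (auto simp: density_1)

lemma lborel_integral_reflect:
  fixes f :: "'a::euclidean_space \<Rightarrow> 'b::{banach, second_countable_topology}"
  assumes "f \<in> borel_measurable borel"
  shows "(\<integral>x. f (a - x) \<partial>lborel) = (\<integral>x. f x \<partial>lborel)"
    and "integrable lborel (\<lambda>x. f (a - x)) = integrable lborel f"
proof -
  show "(\<integral>x. f (a - x) \<partial>lborel) = (\<integral>x. f x \<partial>lborel)"
    using assms by (subst (2) lborel_distr_reflect[of a, symmetric]) (simp add: integral_distr)
  show "integrable lborel (\<lambda>x. f (a - x)) = integrable lborel f"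
    using assms by (subst (2) lborel_distr_reflect[of a, symmetric]) (simp add: integrable_distr_eq)
qed

lemma compact_support_bounded:
  fixes f :: "'a::euclidean_space \<Rightarrow> real"
  assumes "continuous_on UNIV f" "\<And>x. r < norm x \<Longrightarrow> f x = 0"
  obtains B where "B > 0" "\<And>x. \<bar>f x\<bar> \<le> B"
proof -
  have "bounded (f ` cball 0 r)"
    by (intro compact_imp_bounded compact_continuous_image continuous_on_subset[OF assms(1)]) auto
  then obtain B where B: "B > 0" "\<And>x. x \<in> cball 0 r \<Longrightarrow> norm (f x) \<le> B"
    unfolding bounded_pos by blast
  have "\<bar>f x\<bar> \<le> B" for x
    using B(2)[of x] assms(2)[of x] B(1) by (cases "norm x \<le> r") auto
  with B(1) show ?thesis using that by blast
qed

lemma compact_support_integrable: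
  fixes f :: "'a::euclidean_space \<Rightarrow> real"
  assumes "continuous_on UNIV f" "\<And>x. r < norm x \<Longrightarrow> f x = 0"
  shows "integrable lborel f"
proof -
  have "integrable lborel (\<lambda>x. indicator (cball 0 r) x *\<^sub>R f x)"
    by (intro borel_integrable_compact continuous_on_subset[OF assms(1)]) auto
  moreover have "(\<lambda>x. indicator (cball 0 r) x *\<^sub>R f x) = f"
    using assms(2) by (auto simp: indicator_def fun_eq_iff)
  ultimately show ?thesis by (simp only:)
qed

lemma has_derivative_along_line:
  fixes f :: "'a::real_normed_vector \<Rightarrow> real"
  assumes "f differentiable (at (x + t *\<^sub>R v))"
  shows "((\<lambda>t. f (x + t *\<^sub>R v)) has_real_derivative ddir v f (x + t *\<^sub>R v)) (at t)"
proof -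
  have d: "(f has_derivative frechet_derivative f (at (x + t *\<^sub>R v))) (at (x + t *\<^sub>R v))"
    using assms by (simp add: frechet_derivative_works)
  have "((\<lambda>t. f (x + t *\<^sub>R v)) has_derivative (\<lambda>s. ddir (s *\<^sub>R v) f (x + t *\<^sub>R v))) (at t)"
    by (rule has_derivative_compose[of "\<lambda>t. x + t *\<^sub>R v" "\<lambda>s. s *\<^sub>R v" t UNIV f, OF _ d])
       (auto intro!: derivative_eq_intros)
  moreover have "ddir (s *\<^sub>R v) f (x + t *\<^sub>R v) = ddir v f (x + t *\<^sub>R v) * s" for s
    using has_derivative_linear[OF d] by (simp add: linear_cmul)
  ultimately show ?thesis
    by (simp add: has_field_derivative_def)
qed

text \<open>
  The difference quotients of \<open>f\<close> along \<open>v\<close> have integral zero by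
  translation invariance, and they converge dominatedly to \<open>f'\<close>. Differentiability
  is asked for along the single direction \<open>v\<close> because the drift of the kinetic
  equation is merely continuous in position.
\<close>

lemma integral_line_derivative:
  fixes f :: "'a::euclidean_space \<Rightarrow> real"
  assumes der0: "\<And>x. ((\<lambda>t. f (x + t *\<^sub>R v)) has_real_derivative f' x) (at 0)"
    and cf: "continuous_on UNIV f" and cont: "continuous_on UNIV f'"
    and zero: "\<And>x. r < norm x \<Longrightarrow> f x = 0"
  shows "integrable lborel f'" and "(\<integral>x. f' x \<partial>lborel) = 0"
proof -
  have der: "((\<lambda>s. f (x + s *\<^sub>R v)) has_real_derivative f' (x + t *\<^sub>R v)) (at t)" for x t
  proof -
    have "((\<lambda>s. f (x + (s + t) *\<^sub>R v)) has_real_derivative f' (x + t *\<^sub>R v)) (at 0)"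
      using der0[of "x + t *\<^sub>R v"] by (simp add: scaleR_add_left add_ac)
    then show ?thesis using DERIV_shift[of "\<lambda>s. f (x + s *\<^sub>R v)" _ 0 t] by simp
  qed
  have zero': "f' x = 0" if "r < norm x" for x
  proof -
    have "open {t::real. r < norm (x + t *\<^sub>R v)}"
      by (intro open_Collect_less continuous_intros)
    then have "((\<lambda>t::real. 0) has_real_derivative f' x) (at 0)"
      by (rule has_field_derivative_transform_within_open[OF der0]) (use that zero in auto)
    then show ?thesis using DERIV_unique[OF _ DERIV_const[of 0 "at 0"]] by fastforce
  qed
  show "integrable lborel f'"
    by (rule compact_support_integrable[OF cont zero'])
  obtain B where B: "B > 0" "\<And>x. \<bar>f' x\<bar> \<le> B"
    using compact_support_bounded[OF cont zero'] by blast
  define h where "h n = 1 / real (Suc n)" for n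
  have h: "0 < h n" "h n \<le> 1" for n by (auto simp: h_def)
  define g where "g n x = (f (x + h n *\<^sub>R v) - f x) / h n" for n x
  have fb[measurable]: "f \<in> borel_measurable borel"
    by (rule borel_measurable_continuous_onI[OF cf])
  have fv[measurable]: "f' \<in> borel_measurable borel"
    by (rule borel_measurable_continuous_onI[OF cont])
  have fint: "integrable lborel f"
    by (rule compact_support_integrable[OF cf zero])
  have "(\<integral>x. g n x \<partial>lborel) = 0" for n
    using fint by (simp add: g_def lborel_integral_shift)
  moreover have "(\<lambda>n. \<integral>x. g n x \<partial>lborel) \<longlonglongrightarrow> (\<integral>x. f' x \<partial>lborel)"
  proof (rule integral_dominated_convergence[where w="\<lambda>x. B * indicator (cball 0 (r + norm v)) x"])
    show "integrable lborel (\<lambda>x::'a. B * indicator (cball 0 (r + norm v)) x)"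
      by (auto intro!: integrable_mult_right emeasure_bounded_finite)
    show "AE x in lborel. (\<lambda>n. g n x) \<longlonglongrightarrow> f' x"
    proof (rule AE_I2)
      fix x
      from der0[of x] have *: "((\<lambda>t. (f (x + t *\<^sub>R v) - f x) / t) \<longlongrightarrow> f' x) (at 0)"
        by (simp add: DERIV_def)
      have "h \<longlonglongrightarrow> 0"
        unfolding h_def using LIMSEQ_inverse_real_of_nat by (simp add: inverse_eq_divide)
      then have "filterlim h (at 0) sequentially"
        unfolding filterlim_at using h by (auto simp: less_imp_neq[symmetric])
      from filterlim_compose[OF * this] show "(\<lambda>n. g n x) \<longlonglongrightarrow> f' x"
        by (simp add: g_def)
    qed
    show "AE x in lborel. norm (g n x) \<le> B * indicator (cball 0 (r + norm v)) x" for n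
    proof (rule AE_I2)
      fix x
      have "\<exists>t\<in>{0<..<h n}. f (x + h n *\<^sub>R v) - f (x + 0 *\<^sub>R v) = f' (x + t *\<^sub>R v) * (h n - 0)"
        using der[of x] h(1)[of n]
        by (intro mvt_simple) (auto simp: has_field_derivative_def intro: has_derivative_at_withinI)
      then obtain t where "f (x + h n *\<^sub>R v) - f x = f' (x + t *\<^sub>R v) * h n" by auto
      then have "g n x = f' (x + t *\<^sub>R v)" using h(1)[of n] by (simp add: g_def)
      then have 1: "\<bar>g n x\<bar> \<le> B" using B(2) by simp
      have 2: "g n x = 0" if "r + norm v < norm x"
      proof -
        have "norm x - norm (h n *\<^sub>R v) \<le> norm (x + h n *\<^sub>R v)"
          by (metis add_diff_cancel norm_diff_ineq norm_triangle_ineq2 diff_add_cancel)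
        moreover have "norm (h n *\<^sub>R v) \<le> norm v"
          using h[of n] by (simp add: mult_left_le_one_le less_imp_le)
        ultimately have "r < norm (x + h n *\<^sub>R v)" "r < norm x"
          using that norm_ge_zero[of v] by linarith+
        then show ?thesis by (simp add: g_def zero)
      qed
      show "norm (g n x) \<le> B * indicator (cball 0 (r + norm v)) x"
        using 1 2 by (auto simp: indicator_def)
    qed
  qed (auto simp: g_def)
  ultimately show "(\<integral>x. f' x \<partial>lborel) = 0"
    using LIMSEQ_unique[OF _ tendsto_const] by fastforce
qed

corollary integral_ddir_compact_support:
  fixes f :: "'a::euclidean_space \<Rightarrow> real"
  assumes f: "Ck 1 f" and zero: "\<And>x. r < norm x \<Longrightarrow> f x = 0"
  shows "(\<integral>x. ddir v f x \<partial>lborel) = 0"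
proof (rule integral_line_derivative(2)[where v=v and f=f and r=r])
  show "((\<lambda>t. f (x + t *\<^sub>R v)) has_real_derivative ddir v f x) (at 0)" for x
    using has_derivative_along_line[of f x 0 v] f by simp
qed (use f Ck_0[OF f] zero in auto)

lemma isCont_integral_dominated:
  fixes f :: "'a::metric_space \<Rightarrow> 'b \<Rightarrow> 'c::{banach, second_countable_topology}"
  assumes cont: "\<And>z. isCont (\<lambda>x. f x z) x0"
    and meas: "\<And>x. x \<in> ball x0 1 \<Longrightarrow> f x \<in> borel_measurable M"
    and bound: "\<And>x z. x \<in> ball x0 1 \<Longrightarrow> norm (f x z) \<le> w z"
    and w: "integrable M w"
  shows "isCont (\<lambda>x. \<integral>z. f x z \<partial>M) x0"
  unfolding continuous_at_sequentially o_def
proof (intro allI impI)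
  fix X :: "nat \<Rightarrow> 'a" assume X: "X \<longlonglongrightarrow> x0"
  then have "\<forall>\<^sub>F n in sequentially. X n \<in> ball x0 1"
    by (metis centre_in_ball open_ball topological_tendstoD zero_less_one)
  then obtain N where N: "\<And>n. n \<ge> N \<Longrightarrow> X n \<in> ball x0 1"
    unfolding eventually_sequentially by blast
  have "(\<lambda>n. \<integral>z. f (X (n + N)) z \<partial>M) \<longlonglongrightarrow> (\<integral>z. f x0 z \<partial>M)"
  proof (rule integral_dominated_convergence[OF _ _ w])
    show "AE z in M. (\<lambda>n. f (X (n + N)) z) \<longlonglongrightarrow> f x0 z"
      by (intro AE_I2 isCont_tendsto_compose[OF cont] LIMSEQ_ignore_initial_segment X)
  qed (use meas bound N in auto)
  then show "(\<lambda>n. \<integral>z. f (X n) z \<partial>M) \<longlonglongrightarrow> (\<integral>z. f x0 z \<partial>M)"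
    by (simp add: LIMSEQ_offset)
qed

text \<open>
  The mean value theorem bounds the difference quotient by the bound on the derivative, so
  dominated convergence applies to the remainder divided by \<open>norm k\<close>.
\<close>

lemma has_derivative_integral_dominated:
  fixes f :: "'a::real_normed_vector \<Rightarrow> 'b \<Rightarrow> real"
  assumes der: "\<And>x z. x \<in> ball x0 1 \<Longrightarrow> ((\<lambda>x. f x z) has_derivative f' x z) (at x)"
    and int: "\<And>x. x \<in> ball x0 1 \<Longrightarrow> integrable M (f x)"
    and meas: "\<And>k. (\<lambda>z. f' x0 z k) \<in> borel_measurable M"
    and bound: "\<And>x z k. x \<in> ball x0 1 \<Longrightarrow> \<bar>f' x z k\<bar> \<le> w z * norm k"
    and w: "integrable M w"
  shows "((\<lambda>x. \<integral>z. f x z \<partial>M) has_derivative (\<lambda>k. \<integral>z. f' x0 z k \<partial>M)) (at x0)"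
proof -
  have x0: "x0 \<in> ball x0 1" by simp
  have lin: "linear (f' x0 z)" for z
    using has_derivative_linear[OF der[OF x0]] .
  have int': "integrable M (\<lambda>z. f' x0 z k)" for k
  proof (rule Bochner_Integration.integrable_bound[of _ "\<lambda>z. w z * norm k"])
    show "AE z in M. norm (f' x0 z k) \<le> norm (w z * norm k)"
      using bound[OF x0, of _ k] by (intro AE_I2) (simp, metis abs_ge_self order_trans)
  qed (use w meas in auto)
  have "bounded_linear (\<lambda>k. \<integral>z. f' x0 z k \<partial>M)"
  proof (rule bounded_linear_intro[where K="\<integral>z. w z \<partial>M"])
    show "norm (\<integral>z. f' x0 z k \<partial>M) \<le> norm k * (\<integral>z. w z \<partial>M)" for k
    proof -
      have "norm (\<integral>z. f' x0 z k \<partial>M) \<le> (\<integral>z. norm (f' x0 z k) \<partial>M)" by simp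
      also have "\<dots> \<le> (\<integral>z. w z * norm k \<partial>M)"
        by (rule integral_mono) (use int' w bound[OF x0] in auto)
      finally show ?thesis using w by (simp add: mult.commute)
    qed
  qed (use lin int' in \<open>auto simp: linear_add linear_cmul\<close>)
  moreover have "((\<lambda>k. \<integral>z. (f (x0 + k) z - f x0 z - f' x0 z k) / norm k \<partial>M) \<longlongrightarrow> 0) (at 0)"
  proof (subst tendsto_at_iff_sequentially, intro allI impI, unfold o_def)
    fix X :: "nat \<Rightarrow> 'a" assume X0: "\<forall>i. X i \<in> UNIV - {0}" and X: "X \<longlonglongrightarrow> 0"
    then have "\<forall>\<^sub>F n in sequentially. X n \<in> ball 0 1"
      by (metis centre_in_ball open_ball topological_tendstoD zero_less_one)
    then obtain N where N: "\<And>n. n \<ge> N \<Longrightarrow> X n \<in> ball 0 1"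
      unfolding eventually_sequentially by blast
    define Y where "Y n = X (n + N)" for n
    have Y0: "Y n \<noteq> 0" and Y1: "norm (Y n) < 1" for n using X0 N[of "n + N"] by (auto simp: Y_def)
    have YL: "Y \<longlonglongrightarrow> 0" unfolding Y_def by (intro LIMSEQ_ignore_initial_segment X)
    have Yat: "filterlim Y (at 0) sequentially"
      unfolding filterlim_at using YL Y0 by auto
    have "(\<lambda>n. \<integral>z. (f (x0 + Y n) z - f x0 z - f' x0 z (Y n)) / norm (Y n) \<partial>M) \<longlonglongrightarrow> (\<integral>z. 0 \<partial>M)"
    proof (rule integral_dominated_convergence[where w="\<lambda>z. 2 * w z"])
      show "AE z in M. (\<lambda>n. (f (x0 + Y n) z - f x0 z - f' x0 z (Y n)) / norm (Y n)) \<longlonglongrightarrow> 0"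
      proof (rule AE_I2)
        fix z
        have "((\<lambda>h. norm (f (x0 + h) z - f x0 z - f' x0 z h) / norm h) \<longlongrightarrow> 0) (at 0)"
          using der[OF x0, of z] by (simp add: has_derivative_at)
        from filterlim_compose[OF this Yat]
        have "(\<lambda>n. norm ((f (x0 + Y n) z - f x0 z - f' x0 z (Y n)) / norm (Y n))) \<longlonglongrightarrow> 0"
          by simp
        then show "(\<lambda>n. (f (x0 + Y n) z - f x0 z - f' x0 z (Y n)) / norm (Y n)) \<longlonglongrightarrow> 0"
          by (rule tendsto_norm_zero_cancel)
      qed
      show "AE z in M. norm ((f (x0 + Y n) z - f x0 z - f' x0 z (Y n)) / norm (Y n)) \<le> 2 * w z" for n
      proof (rule AE_I2)
        fix z
        have line: "x0 + t *\<^sub>R Y n \<in> ball x0 1" if "0 \<le> t" "t \<le> 1" for t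
          using that Y1[of n] mult_left_le_one_le[of "norm (Y n)" t] by (auto simp: dist_norm)
        have "\<exists>t\<in>{0<..<1}. f (x0 + 1 *\<^sub>R Y n) z - f (x0 + 0 *\<^sub>R Y n) z
            = f' (x0 + t *\<^sub>R Y n) z ((1 - 0) *\<^sub>R Y n)"
        proof (rule mvt_simple)
          fix t :: real assume "0 \<le> t" "t \<le> 1"
          then show "((\<lambda>t. f (x0 + t *\<^sub>R Y n) z) has_derivative
             (\<lambda>s. f' (x0 + t *\<^sub>R Y n) z (s *\<^sub>R Y n))) (at t within {0..1})"
            by (intro has_derivative_compose[where f="\<lambda>t. x0 + t *\<^sub>R Y n" and f'="\<lambda>s. s *\<^sub>R Y n"
                  and g="\<lambda>x. f x z" and g'="f' (x0 + t *\<^sub>R Y n) z"] der line)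
              (auto intro!: derivative_eq_intros)
        qed simp
        then obtain t where t: "t \<in> {0<..<1}" "f (x0 + Y n) z - f x0 z = f' (x0 + t *\<^sub>R Y n) z (Y n)"
          by auto
        have "\<bar>f (x0 + Y n) z - f x0 z\<bar> \<le> w z * norm (Y n)"
          unfolding t(2) using t(1) by (intro bound line) auto
        then have "\<bar>f (x0 + Y n) z - f x0 z - f' x0 z (Y n)\<bar> \<le> (2 * w z) * norm (Y n)"
          using bound[OF x0, of z "Y n"] by linarith
        then show "norm ((f (x0 + Y n) z - f x0 z - f' x0 z (Y n)) / norm (Y n)) \<le> 2 * w z"
          using Y0[of n] by (simp add: abs_divide divide_le_eq)
      qed
      show "(\<lambda>z. (f (x0 + Y n) z - f x0 z - f' x0 z (Y n)) / norm (Y n)) \<in> borel_measurable M" for n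
        using int[of "x0 + Y n"] int[OF x0] meas Y1[of n] by (auto simp: dist_norm)
    qed (use w in auto)
    then show "(\<lambda>n. \<integral>z. (f (x0 + X n) z - f x0 z - f' x0 z (X n)) / norm (X n) \<partial>M) \<longlonglongrightarrow> 0"
      unfolding Y_def by (simp add: LIMSEQ_offset)
  qed
  then have "((\<lambda>k. norm ((\<integral>z. f (x0 + k) z \<partial>M) - (\<integral>z. f x0 z \<partial>M) - (\<integral>z. f' x0 z k \<partial>M)) / norm k) \<longlongrightarrow> 0) (at 0)"
  proof (rule Lim_transform_eventually[OF tendsto_rabs_zero])
    have "\<forall>\<^sub>F k in at (0::'a). norm k < 1"
      unfolding eventually_at by (intro exI[of _ 1]) auto
    then show "\<forall>\<^sub>F k in at 0. \<bar>\<integral>z. (f (x0 + k) z - f x0 z - f' x0 z k) / norm k \<partial>M\<bar> =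
       norm ((\<integral>z. f (x0 + k) z \<partial>M) - (\<integral>z. f x0 z \<partial>M) - (\<integral>z. f' x0 z k \<partial>M)) / norm k"
    proof eventually_elim
      case (elim k)
      then have "x0 + k \<in> ball x0 1" by (simp add: dist_norm)
      then show ?case using int[of "x0 + k"] int[OF x0] int' by simp
    qed
  qed
  ultimately show ?thesis by (simp add: has_derivative_at)
qed

section \<open>Convolution\<close>

text \<open>
  Measurability is part of the notion, so that products with continuous functions stay in the
  class.
\<close>

definition locally_integrable :: "('a::euclidean_space \<Rightarrow> real) \<Rightarrow> bool" where
  "locally_integrable w \<longleftrightarrow> w \<in> borel_measurable borel \<and>
     (\<forall>r. integrable lborel (\<lambda>x. indicator (cball 0 r) x * w x))"

definition convolution :: "('a::euclidean_space \<Rightarrow> real) \<Rightarrow> ('a \<Rightarrow> real) \<Rightarrow> 'a \<Rightarrow> real" where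
  "convolution w k z = (\<integral>z'. w z' * k (z - z') \<partial>lborel)"

lemma locally_integrable_measurable: "locally_integrable w \<Longrightarrow> w \<in> borel_measurable borel"
  by (simp add: locally_integrable_def)

lemma integrable_imp_locally_integrable: "integrable lborel w \<Longrightarrow> locally_integrable w"
  unfolding locally_integrable_def
  by (auto intro!: integrable_real_mult_indicator simp: mult.commute[of "indicator _ _"])

lemma locally_integrable_mult_continuous:
  assumes "locally_integrable w" "continuous_on UNIV c"
  shows "locally_integrable (\<lambda>x. w x * c x)"
  unfolding locally_integrable_def
proof (intro conjI allI)
  have [measurable]: "w \<in> borel_measurable borel" "c \<in> borel_measurable borel"
    using assms by (auto intro: borel_measurable_continuous_onI simp: locally_integrable_def)
  show "(\<lambda>x. w x * c x) \<in> borel_measurable borel" by measurable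
  fix r
  have "bounded (c ` cball 0 r)"
    by (intro compact_imp_bounded compact_continuous_image continuous_on_subset[OF assms(2)]) auto
  then obtain B where B: "B > 0" "\<And>x. x \<in> cball 0 r \<Longrightarrow> norm (c x) \<le> B"
    unfolding bounded_pos by blast
  show "integrable lborel (\<lambda>x. indicator (cball 0 r) x * (w x * c x))"
  proof (rule Bochner_Integration.integrable_bound[of _ "\<lambda>x. B * (indicator (cball 0 r) x * w x)"])
    show "integrable lborel (\<lambda>x. B * (indicator (cball 0 r) x * w x))"
      using assms(1) by (simp add: locally_integrable_def)
    show "AE x in lborel. norm (indicator (cball 0 r) x * (w x * c x)) \<le> norm (B * (indicator (cball 0 r) x * w x))"
    proof (rule AE_I2)
      fix x show "norm (indicator (cball 0 r) x * (w x * c x)) \<le> norm (B * (indicator (cball 0 r) x * w x))"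
        using B(1) mult_right_mono[OF B(2)[of x], of "\<bar>w x\<bar>"]
        by (auto simp: indicator_def abs_mult mult.commute)
    qed
    show "(\<lambda>x. indicator (cball 0 r) x * (w x * c x)) \<in> borel_measurable lborel"
      by (intro borel_measurable_times borel_measurable_indicator) auto
  qed
qed

lemma integrable_locally_integrable_mult:
  assumes w: "locally_integrable w" and k: "k \<in> borel_measurable borel"
    and B: "\<And>x. \<bar>k x\<bar> \<le> B" and R: "\<And>x. R < norm x \<Longrightarrow> k x = 0"
  shows "integrable lborel (\<lambda>x. w x * k x)"
proof (rule Bochner_Integration.integrable_bound[of _ "\<lambda>x. B * (indicator (cball 0 R) x * w x)"])
  have [measurable]: "w \<in> borel_measurable borel" using w by (simp add: locally_integrable_def)
  note k[measurable]
  show "integrable lborel (\<lambda>x. B * (indicator (cball 0 R) x * w x))"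
    using w by (simp add: locally_integrable_def)
  show "(\<lambda>x. w x * k x) \<in> borel_measurable lborel" by measurable
  show "AE x in lborel. norm (w x * k x) \<le> norm (B * (indicator (cball 0 R) x * w x))"
  proof (rule AE_I2)
    fix x show "norm (w x * k x) \<le> norm (B * (indicator (cball 0 R) x * w x))"
      using R[of x] mult_right_mono[OF order_trans[OF B[of x] abs_ge_self], of "\<bar>w x\<bar>"]
      by (auto simp: indicator_def abs_mult mult.commute)
  qed
qed

lemma convolution_integrable:
  fixes w k :: "'a::euclidean_space \<Rightarrow> real"
  assumes w: "locally_integrable w" and k: "continuous_on UNIV k" "\<And>x. R < norm x \<Longrightarrow> k x = 0"
  shows "integrable lborel (\<lambda>z'. w z' * k (z - z'))"
proof -
  obtain B where B: "\<And>x. \<bar>k x\<bar> \<le> B" using compact_support_bounded[OF k] by blast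
  have [measurable]: "k \<in> borel_measurable borel" by (rule borel_measurable_continuous_onI[OF k(1)])
  show ?thesis
  proof (rule integrable_locally_integrable_mult[OF w, where R="norm z + R"])
    fix x :: 'a assume "norm z + R < norm x"
    then have "R < norm (z - x)" using norm_triangle_ineq2[of x z] by (simp add: norm_minus_commute)
    then show "k (z - x) = 0" by (rule k(2))
  qed (use B in auto)
qed

lemma convolution_integrable_test:
  "locally_integrable w \<Longrightarrow> test_function k \<Longrightarrow> integrable lborel (\<lambda>z'. w z' * k (z - z'))"
  by (metis convolution_integrable smooth_continuous test_function_smooth test_function_zero_outside)

lemma linear_ddir: "smooth f \<Longrightarrow> linear (\<lambda>v. ddir v f x)"
  using has_derivative_linear[OF smooth_has_derivative[of f x]] by simp

lemma ddir_basis_sum: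
  fixes f :: "'a::euclidean_space \<Rightarrow> real"
  assumes "f differentiable (at x)"
  shows "ddir v f x = (\<Sum>b\<in>Basis. (v \<bullet> b) * ddir b f x)"
proof -
  have lin: "linear (\<lambda>v. ddir v f x)"
    using has_derivative_linear assms by (simp add: frechet_derivative_works)
  have "ddir v f x = ddir (\<Sum>b\<in>Basis. (v \<bullet> b) *\<^sub>R b) f x"
    by (simp add: euclidean_representation)
  also have "\<dots> = (\<Sum>b\<in>Basis. (v \<bullet> b) * ddir b f x)"
    using lin by (simp add: linear_sum linear_cmul)
  finally show ?thesis .
qed

lemma test_function_ddir_bound:
  fixes k :: "'a::euclidean_space \<Rightarrow> real"
  assumes "test_function k"
  obtains B where "B > 0" "\<And>x v. \<bar>ddir v k x\<bar> \<le> B * norm v"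
proof -
  have "\<exists>B>0. \<forall>x. \<bar>ddir b k x\<bar> \<le> B" for b
  proof -
    note t = test_function_ddir[OF assms, of b]
    obtain r where "\<And>x. r < norm x \<Longrightarrow> ddir b k x = 0"
      using test_function_zero_outside[OF t] by blast
    from compact_support_bounded[OF smooth_continuous[OF test_function_smooth[OF t]] this]
    show ?thesis by blast
  qed
  then have "\<exists>C. \<forall>b. C b > 0 \<and> (\<forall>x. \<bar>ddir b k x\<bar> \<le> C b)" by (intro choice allI)
  then obtain C where C: "\<And>b. C b > 0" "\<And>b x. \<bar>ddir b k x\<bar> \<le> C b" by blast
  have "\<bar>ddir v k x\<bar> \<le> (\<Sum>b\<in>Basis. C b) * norm v" for x v
  proof -
    have "\<bar>ddir v k x\<bar> \<le> (\<Sum>b\<in>Basis. \<bar>(v \<bullet> b) * ddir b k x\<bar>)"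
      using ddir_basis_sum[OF smooth_differentiable[OF test_function_smooth[OF assms]], of x v]
      by (simp add: sum_abs)
    also have "\<dots> \<le> (\<Sum>b\<in>Basis. norm v * C b)"
      unfolding abs_mult by (intro sum_mono mult_mono C(2) Basis_le_norm) auto
    finally show ?thesis by (simp add: sum_distrib_left mult.commute)
  qed
  moreover have "(\<Sum>b\<in>(Basis::'a set). C b) > 0"
    using C(1) by (intro sum_pos) auto
  ultimately show ?thesis using that by blast
qed

text \<open>
  All derivatives fall on the smooth compactly supported kernel; near a fixed \<open>z\<close>
  only the values of \<open>w\<close> on one fixed ball enter, and there \<open>w\<close> is
  integrable.
\<close>

lemma convolution_has_derivative:
  assumes w: "locally_integrable w" and k: "test_function k"
  shows "(convolution w k has_derivative (\<lambda>v. convolution w (ddir v k) z)) (at z)"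
proof -
  have wm[measurable]: "w \<in> borel_measurable borel" by (rule locally_integrable_measurable[OF w])
  have km[measurable]: "ddir v k \<in> borel_measurable borel" for v
    by (intro borel_measurable_continuous_onI smooth_continuous smooth_ddir test_function_smooth k)
  obtain B where B: "B > 0" "\<And>x v. \<bar>ddir v k x\<bar> \<le> B * norm v"
    using test_function_ddir_bound[OF k] by blast
  obtain R where R: "R > 0" "\<And>x. R < norm x \<Longrightarrow> k x = 0"
    using test_function_zero_outside[OF k] by blast
  have R': "ddir v k x = 0" if "R < norm x" for x v
    by (rule ddir_zero_outside[OF smooth_differentiable[OF test_function_smooth[OF k]] R(2) that])
  have "((\<lambda>z. \<integral>z'. w z' * k (z - z') \<partial>lborel) has_derivative (\<lambda>v. \<integral>z'. w z' * ddir v k (z - z') \<partial>lborel)) (at z)"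
  proof (rule has_derivative_integral_dominated[where
        f'="\<lambda>x z' v. w z' * ddir v k (x - z')" and w="\<lambda>z'. B * \<bar>indicator (cball 0 (norm z + 1 + R)) z' * w z'\<bar>"])
    fix x z'
    have "((\<lambda>x. k (x - z')) has_derivative (\<lambda>v. ddir v k (x - z'))) (at x)"
      by (rule has_derivative_compose[where f="\<lambda>x. x - z'" and f'="\<lambda>v. v" and g=k
            and g'="frechet_derivative k (at (x - z'))"])
        (auto intro!: derivative_eq_intros smooth_has_derivative test_function_smooth k)
    then show "((\<lambda>x. w z' * k (x - z')) has_derivative (\<lambda>v. w z' * ddir v k (x - z'))) (at x)"
      by (rule has_derivative_mult_right)
  next
    fix x z' v assume x: "x \<in> ball z 1"
    show "\<bar>w z' * ddir v k (x - z')\<bar> \<le> B * \<bar>indicator (cball 0 (norm z + 1 + R)) z' * w z'\<bar> * norm v"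
    proof (cases "norm z' \<le> norm z + 1 + R")
      case True
      then show ?thesis
        using mult_left_mono[OF B(2)[of "x - z'" v], of "\<bar>w z'\<bar>"]
        by (simp add: abs_mult mult_ac)
    next
      case False
      have "norm x \<le> norm z + 1"
        using x norm_triangle_ineq2[of x z] by (auto simp: dist_norm norm_minus_commute)
      then have "R < norm (x - z')"
        using False norm_triangle_ineq2[of z' x] by (simp add: norm_minus_commute)
      then show ?thesis using False by (simp add: R')
    qed
  next
    show "integrable lborel (\<lambda>z'. B * \<bar>indicator (cball 0 (norm z + 1 + R)) z' * w z'\<bar>)"
      using w by (auto simp: locally_integrable_def)
  qed (use convolution_integrable_test[OF w k] in auto)
  then show ?thesis by (simp add: convolution_def[abs_def])
qed

lemma ddir_convolution:
  "locally_integrable w \<Longrightarrow> test_function k \<Longrightarrow> ddir v (convolution w k) = convolution w (ddir v k)"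
  by (rule ddir_eqI[OF convolution_has_derivative])

lemma Ck_convolution:
  "locally_integrable w \<Longrightarrow> test_function k \<Longrightarrow> Ck n (convolution w k)"
proof (induction n arbitrary: k)
  case 0
  then show ?case
    using has_derivative_continuous[OF convolution_has_derivative]
    by (auto intro!: continuous_at_imp_continuous_on)
next
  case (Suc n)
  show ?case
    by (rule Ck_SucI[OF convolution_has_derivative[OF Suc.prems]])
       (rule Suc.IH[OF Suc.prems(1) test_function_ddir[OF Suc.prems(2)]])
qed

section \<open>Mollifiers\<close>

definition unit_bump :: "real \<Rightarrow> ('a::euclidean_space \<Rightarrow> real) \<Rightarrow> bool" where
  "unit_bump r k \<longleftrightarrow> test_function k \<and> (\<forall>x. 0 \<le> k x) \<and> (\<integral>x. k x \<partial>lborel) = 1 \<and>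
     (\<forall>x. r < norm x \<longrightarrow> k x = 0)"

text \<open>
  A nonnegative continuous function that is positive at the origin has positive integral, so a
  bump function can be normalised.
\<close>

lemma unit_bump_exists:
  assumes "r > 0"
  shows "\<exists>k :: 'a::euclidean_space \<Rightarrow> real. unit_bump r k"
proof -
  obtain k :: "'a \<Rightarrow> real" where k: "test_function k" "\<And>x. k x \<ge> 0" "k 0 > 0"
    and zero: "\<And>x. r < norm x \<Longrightarrow> k x = 0"
    using bump_function_exists[OF assms] by blast
  have cont: "continuous_on UNIV k" using k(1) smooth_continuous test_function_smooth by blast
  have int: "integrable lborel k" by (rule compact_support_integrable[OF cont zero])
  have "(\<integral>x. k x \<partial>lborel) \<noteq> 0"
  proof
    assume "(\<integral>x. k x \<partial>lborel) = 0"
    then have ae: "AE x in lborel. k x = 0"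
      using integral_nonneg_eq_0_iff_AE[OF int] k(2) by auto
    have "open {x. 0 < k x}"
      by (intro open_Collect_less cont continuous_intros)
    then obtain e where e: "e > 0" "ball 0 e \<subseteq> {x. 0 < k x}"
      using k(3) by (metis mem_Collect_eq openE)
    have "AE x in lborel. x \<notin> ball (0::'a) e"
      using ae by eventually_elim (use e in force)
    then have "emeasure lborel (ball (0::'a) e) = 0"
      by (subst (asm) AE_iff_measurable[where N="ball 0 e"]) auto
    moreover have "unit_ball_vol (real DIM('a)) * e ^ DIM('a) > 0"
      using e(1) by (intro mult_pos_pos zero_less_power unit_ball_vol_pos) auto
    ultimately show False using e(1) by (simp add: emeasure_ball ennreal_eq_0_iff)
  qed
  moreover have "(\<integral>x. k x \<partial>lborel) \<ge> 0" using k(2) by simp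
  ultimately have pos: "(\<integral>x. k x \<partial>lborel) > 0" by simp
  have "unit_bump r (\<lambda>x. inverse (\<integral>x. k x \<partial>lborel) * k x)"
    unfolding unit_bump_def
  proof (intro conjI allI impI)
    show "test_function (\<lambda>x. inverse (\<integral>x. k x \<partial>lborel) * k x)"
      by (rule test_functionI[where r=r, OF smooth_mult[OF smooth_const test_function_smooth[OF k(1)]]])
        (simp add: zero)
  qed (use pos k(2) zero in auto)
  then show ?thesis by blast
qed

lemma unit_bumpD:
  assumes "unit_bump r k"
  shows "test_function k" "0 \<le> k x" "(\<integral>x. k x \<partial>lborel) = 1" "r < norm x \<Longrightarrow> k x = 0"
    "smooth k" "continuous_on UNIV k" "integrable lborel k" "k \<in> borel_measurable borel"
proof -
  show 1: "test_function k" and "0 \<le> k x" and "(\<integral>x. k x \<partial>lborel) = 1" and "r < norm x \<Longrightarrow> k x = 0" for x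
    using assms by (auto simp: unit_bump_def)
  show "smooth k" by (rule test_function_smooth[OF 1])
  then show c: "continuous_on UNIV k" by (rule smooth_continuous)
  show "integrable lborel k"
    by (rule compact_support_integrable[OF c, of r]) (use assms in \<open>auto simp: unit_bump_def\<close>)
  show "k \<in> borel_measurable borel" by (rule borel_measurable_continuous_onI[OF c])
qed

text \<open>
  The second condition is an anisotropy: the kernel is much narrower in momentum than in
  position. It makes the commutator of mollification with the transport term
  \<open>p \<cdot> \<nabla>\<^sub>q\<close> small uniformly in the mollified density, as soon as
  that is bounded.
\<close>

definition kinetic_mollifier :: "real \<Rightarrow> ('a::euclidean_space \<times> 'a \<Rightarrow> real) \<Rightarrow> bool" where
  "kinetic_mollifier \<tau> \<eta> \<longleftrightarrow> unit_bump \<tau> \<eta> \<and>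
     (\<forall>b\<in>Basis. (\<integral>z. \<bar>(snd z \<bullet> b) * ddir (b, 0) \<eta> z\<bar> \<partial>lborel) \<le> \<tau>)"

lemma lborel_integral_prod:
  fixes f :: "'a::euclidean_space \<Rightarrow> real" and g :: "'b::euclidean_space \<Rightarrow> real"
  assumes "integrable lborel (\<lambda>z. f (fst z) * g (snd z))"
  shows "(\<integral>z. f (fst z) * g (snd z) \<partial>lborel) = (\<integral>x. f x \<partial>lborel) * (\<integral>y. g y \<partial>lborel)"
proof -
  have "(\<integral>z. f (fst z) * g (snd z) \<partial>(lborel \<Otimes>\<^sub>M lborel)) = (\<integral>x. (\<integral>y. f x * g y \<partial>lborel) \<partial>lborel)"
    using lborel_pair.integral_fst'[of "\<lambda>z. f (fst z) * g (snd z)"] assms by (simp add: lborel_prod)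
  then show ?thesis by (simp add: lborel_prod)
qed

text \<open>
  A product of two bumps. First fix the one in position; its gradient has a finite
  \<open>L\<^sup>1\<close> norm, and then the momentum bump is taken so narrow that the product
  with this norm is at most \<open>\<tau>\<close>.
\<close>

lemma kinetic_mollifier_exists:
  assumes "\<tau> > 0"
  shows "\<exists>\<eta> :: 'a::euclidean_space \<times> 'a \<Rightarrow> real. kinetic_mollifier \<tau> \<eta>"
proof -
  obtain k :: "'a \<Rightarrow> real" where k: "unit_bump (\<tau> / 2) k"
    using unit_bump_exists[of "\<tau> / 2"] assms by auto
  define A where "A = 1 + (\<Sum>b\<in>Basis. \<integral>x. \<bar>ddir b k x\<bar> \<partial>lborel)"
  have A: "A \<ge> 1" unfolding A_def by (simp add: sum_nonneg)
  have Ab: "(\<integral>x. \<bar>ddir b k x\<bar> \<partial>lborel) \<le> A" if "b \<in> Basis" for b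
    using member_le_sum[OF that, of "\<lambda>b. \<integral>x. \<bar>ddir b k x\<bar> \<partial>lborel"] by (simp add: A_def)
  \<comment> \<open>The factor \<open>2\<close> keeps the support in the ball of radius \<open>\<tau>\<close>, as \<open>A \<ge> 1\<close>.\<close>
  define \<epsilon> where "\<epsilon> = \<tau> / (2 * A)"
  have \<epsilon>: "\<epsilon> > 0" "\<epsilon> \<le> \<tau> / 2" "A * \<epsilon> \<le> \<tau>" using A assms by (auto simp: \<epsilon>_def field_simps)
  obtain l :: "'a \<Rightarrow> real" where l: "unit_bump \<epsilon> l"
    using unit_bump_exists[OF \<epsilon>(1)] by auto
  define \<eta> where "\<eta> z = k (fst z) * l (snd z)" for z
  have sm: "smooth \<eta>"
    unfolding \<eta>_def
    by (rule smooth_mult[OF smooth_compose_linear[OF bounded_linear_fst unit_bumpD(5)[OF k]]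
          smooth_compose_linear[OF bounded_linear_snd unit_bumpD(5)[OF l]]])
  have zero: "\<eta> z = 0" if "\<tau> < norm z" for z
  proof -
    have "\<tau> < norm (fst z) + norm (snd z)" using that norm_Pair_le[of "fst z" "snd z"] by simp
    then have "\<tau> / 2 < norm (fst z) \<or> \<epsilon> < norm (snd z)" using \<epsilon>(2) by linarith
    then show ?thesis using unit_bumpD(4)[OF k] unit_bumpD(4)[OF l] by (auto simp: \<eta>_def)
  qed
  have test: "test_function \<eta>" by (rule test_functionI[OF sm zero])
  have int: "integrable lborel \<eta>"
    by (rule compact_support_integrable[OF smooth_continuous[OF sm] zero])
  have bump: "unit_bump \<tau> \<eta>"
    unfolding unit_bump_def
  proof (intro conjI allI impI)
    show "0 \<le> \<eta> z" for z using unit_bumpD(2)[OF k] unit_bumpD(2)[OF l] by (simp add: \<eta>_def)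
    show "(\<integral>z. \<eta> z \<partial>lborel) = 1"
      using lborel_integral_prod[of k l] int unit_bumpD(3)[OF k] unit_bumpD(3)[OF l]
      by (simp add: \<eta>_def[abs_def])
  qed (use test zero in auto)
  have "(\<integral>z. \<bar>(snd z \<bullet> b) * ddir (b, 0) \<eta> z\<bar> \<partial>lborel) \<le> \<tau>" if b: "b \<in> Basis" for b
  proof -
    have "(\<eta> has_derivative (\<lambda>v. k (fst z) * ddir (snd v) l (snd z) + ddir (fst v) k (fst z) * l (snd z))) (at z)" for z
      unfolding \<eta>_def
      by (intro has_derivative_mult
          has_derivative_compose[OF has_derivative_fst[OF has_derivative_ident], of k, simplified]
          has_derivative_compose[OF has_derivative_snd[OF has_derivative_ident], of l, simplified]
          smooth_has_derivative unit_bumpD(5)[OF k] unit_bumpD(5)[OF l])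
    from fun_cong[OF ddir_eqI[OF this]]
    have d: "ddir (b, 0) \<eta> z = ddir b k (fst z) * l (snd z)" for z
      by (simp only: fst_conv snd_conv linear_0[OF linear_ddir[OF unit_bumpD(5)[OF l]]] mult_zero_right add_0)
    have eq: "\<bar>(snd z \<bullet> b) * ddir (b, 0) \<eta> z\<bar> = \<bar>ddir b k (fst z)\<bar> * (\<bar>snd z \<bullet> b\<bar> * l (snd z))" for z
      unfolding d using unit_bumpD(2)[OF l] by (simp add: abs_mult)
    have "integrable lborel (\<lambda>z. \<bar>(snd z \<bullet> b) * ddir (b, 0) \<eta> z\<bar>)"
    proof (rule compact_support_integrable[where r=\<tau>])
      show "continuous_on UNIV (\<lambda>z. \<bar>(snd z \<bullet> b) * ddir (b, 0) \<eta> z\<bar>)"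
        by (intro continuous_intros smooth_continuous smooth_ddir sm)
      show "\<bar>(snd z \<bullet> b) * ddir (b, 0) \<eta> z\<bar> = 0" if "\<tau> < norm z" for z
        using ddir_zero_outside[OF smooth_differentiable[OF sm] zero that] by simp
    qed
    then have "(\<integral>z. \<bar>(snd z \<bullet> b) * ddir (b, 0) \<eta> z\<bar> \<partial>lborel)
        = (\<integral>x. \<bar>ddir b k x\<bar> \<partial>lborel) * (\<integral>y. \<bar>y \<bullet> b\<bar> * l y \<partial>lborel)"
      unfolding eq by (rule lborel_integral_prod)
    also have "(\<integral>y. \<bar>y \<bullet> b\<bar> * l y \<partial>lborel) \<le> (\<integral>y. \<epsilon> * l y \<partial>lborel)"
    proof (rule integral_mono)
      have le: "\<bar>y \<bullet> b\<bar> * l y \<le> \<epsilon> * l y" for y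
        using unit_bumpD(4)[OF l, of y] unit_bumpD(2)[OF l, of y] Basis_le_norm[OF b, of y]
        by (cases "norm y \<le> \<epsilon>") (auto intro: mult_right_mono)
      then show "\<bar>y \<bullet> b\<bar> * l y \<le> \<epsilon> * l y" for y .
      show "integrable lborel (\<lambda>y. \<bar>y \<bullet> b\<bar> * l y)"
        by (rule compact_support_integrable[where r=\<epsilon>])
          (auto intro!: continuous_intros unit_bumpD(6)[OF l] simp: unit_bumpD(4)[OF l])
    qed (use unit_bumpD(7)[OF l] in auto)
    also have "(\<integral>y. \<epsilon> * l y \<partial>lborel) = \<epsilon>" using unit_bumpD(3)[OF l] by simp
    also have "(\<integral>x. \<bar>ddir b k x\<bar> \<partial>lborel) * \<epsilon> \<le> A * \<epsilon>"
      using Ab[OF b] \<epsilon> by (intro mult_right_mono) auto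
    finally show ?thesis using \<epsilon>(3) by (simp add: mult_left_mono)
  qed
  then show ?thesis using bump unfolding kinetic_mollifier_def by blast
qed

lemma convolution_integral_swap:
  fixes f :: "'a::euclidean_space \<Rightarrow> real"
  assumes w: "integrable lborel w" and k: "unit_bump r k"
    and f: "integrable lborel f"
  shows "(\<integral>z. convolution w k z * f z \<partial>lborel) = (\<integral>z'. w z' * (\<integral>z. k (z - z') * f z \<partial>lborel) \<partial>lborel)"
proof -
  obtain B where B: "\<And>x. \<bar>k x\<bar> \<le> B"
    using compact_support_bounded[OF unit_bumpD(6)[OF k] unit_bumpD(4)[OF k]] by blast
  have [measurable]: "w \<in> borel_measurable borel" "f \<in> borel_measurable borel" "k \<in> borel_measurable borel"
    using w f unit_bumpD(8)[OF k] by auto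
  have "integrable (lborel \<Otimes>\<^sub>M lborel) (\<lambda>x. \<bar>w (snd x)\<bar> * \<bar>f (fst x)\<bar>)"
    by (rule lborel_pair.Fubini_integrable) (use w f in auto)
  then have int: "integrable (lborel \<Otimes>\<^sub>M lborel) (\<lambda>(z, z'). w z' * k (z - z') * f z)"
  proof (rule Bochner_Integration.integrable_bound[OF integrable_mult_right[of B]])
    show "AE x in lborel \<Otimes>\<^sub>M lborel. norm (case x of (z, z') \<Rightarrow> w z' * k (z - z') * f z)
        \<le> norm (B * (\<bar>w (snd x)\<bar> * \<bar>f (fst x)\<bar>))"
    proof (rule AE_I2, clarify)
      fix z z'
      show "norm (w z' * k (z - z') * f z) \<le> norm (B * (\<bar>w (snd (z, z'))\<bar> * \<bar>f (fst (z, z'))\<bar>))"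
        using mult_right_mono[OF order_trans[OF B[of "z - z'"] abs_ge_self], of "\<bar>w z'\<bar> * \<bar>f z\<bar>"]
        by (simp add: abs_mult mult_ac)
    qed
  qed measurable
  have "(\<integral>z. convolution w k z * f z \<partial>lborel) = (\<integral>z. (\<integral>z'. w z' * k (z - z') * f z \<partial>lborel) \<partial>lborel)"
    by (simp add: convolution_def)
  also have "\<dots> = (\<integral>z'. (\<integral>z. w z' * k (z - z') * f z \<partial>lborel) \<partial>lborel)"
    by (rule lborel_pair.Fubini_integral[symmetric, OF int])
  finally show ?thesis by (simp add: mult.assoc)
qed

text \<open>
  Fubini moves the mollification to \<open>f\<close>, which is uniformly continuous.
\<close>

lemma convolution_tendsto_weakly:
  fixes f :: "'a::euclidean_space \<Rightarrow> real"
  assumes w: "integrable lborel w"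
    and f: "continuous_on UNIV f" "\<And>x. r < norm x \<Longrightarrow> f x = 0" and e: "e > 0"
  shows "\<exists>\<tau>>0. \<forall>k s. unit_bump s k \<longrightarrow> s \<le> \<tau> \<longrightarrow>
     \<bar>(\<integral>z. convolution w k z * f z \<partial>lborel) - (\<integral>z. w z * f z \<partial>lborel)\<bar> \<le> e"
proof -
  have intf: "integrable lborel f" by (rule compact_support_integrable[OF f])
  obtain B where B: "\<And>x. \<bar>f x\<bar> \<le> B" using compact_support_bounded[OF f] by blast
  have [measurable]: "w \<in> borel_measurable borel" "f \<in> borel_measurable borel"
    using w intf by auto
  define I where "I = 1 + (\<integral>z. \<bar>w z\<bar> \<partial>lborel)"
  have I: "I > 0" unfolding I_def by (simp add: add_pos_nonneg)
  have "uniformly_continuous_on (cball 0 (r + 1)) f"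
    by (intro compact_uniformly_continuous continuous_on_subset[OF f(1)]) auto
  then obtain d where d: "d > 0" "\<And>x y. x \<in> cball 0 (r+1) \<Longrightarrow> y \<in> cball 0 (r+1) \<Longrightarrow> dist y x < d \<Longrightarrow> dist (f y) (f x) < e / I"
    unfolding uniformly_continuous_on_def using e I by (metis divide_pos_pos)
  define \<tau> where "\<tau> = min (d / 2) 1"
  have close: "\<bar>f y - f x\<bar> \<le> e / I" if "norm (y - x) \<le> \<tau>" for x y
  proof (cases "norm x \<le> r \<or> norm y \<le> r")
    case True
    then have "x \<in> cball 0 (r+1)" "y \<in> cball 0 (r+1)"
      using that norm_triangle_ineq2[of x y] norm_triangle_ineq2[of y x]
      by (auto simp: \<tau>_def norm_minus_commute)
    then show ?thesis using d(2)[of x y] that d(1) by (auto simp: \<tau>_def dist_norm)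
  next
    case False
    then show ?thesis using f(2)[of x] f(2)[of y] e I by auto
  qed
  have "\<bar>(\<integral>z. convolution w k z * f z \<partial>lborel) - (\<integral>z. w z * f z \<partial>lborel)\<bar> \<le> e"
    if k: "unit_bump s k" and s: "s \<le> \<tau>" for k s
  proof -
    note [measurable] = unit_bumpD(8)[OF k]
    have intk: "integrable lborel (\<lambda>z. k (z - x))" for x
      using lborel_integral_shift(2)[of k "-x"] unit_bumpD(7)[OF k] by simp
    have intkf: "integrable lborel (\<lambda>z. k (z - x) * f z)" for x
    proof (rule Bochner_Integration.integrable_bound[of _ "\<lambda>z. B * k (z - x)"])
      show "AE z in lborel. norm (k (z - x) * f z) \<le> norm (B * k (z - x))"
      proof (rule AE_I2)
        fix z show "norm (k (z - x) * f z) \<le> norm (B * k (z - x))"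
          using mult_right_mono[OF order_trans[OF B[of z] abs_ge_self], of "\<bar>k (z - x)\<bar>"]
          by (simp add: abs_mult mult_ac)
      qed
    qed (use intk in auto)
    have bd: "\<bar>(\<integral>z. k (z - x) * f z \<partial>lborel) - f x\<bar> \<le> e / I" for x
    proof -
      have one: "(\<integral>z. k (z - x) \<partial>lborel) = 1"
        using lborel_integral_shift(1)[of k "-x"] unit_bumpD(3)[OF k] by simp
      have "(\<integral>z. k (z - x) * f z \<partial>lborel) - f x
          = (\<integral>z. k (z - x) * f z \<partial>lborel) - (\<integral>z. k (z - x) * f x \<partial>lborel)"
        using one by simp
      also have "\<dots> = (\<integral>z. k (z - x) * f z - k (z - x) * f x \<partial>lborel)"
        using intkf intk by simp
      also have "\<bar>\<dots>\<bar> \<le> (\<integral>z. \<bar>k (z - x) * f z - k (z - x) * f x\<bar> \<partial>lborel)"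
        by (rule integral_abs_bound)
      also have "\<dots> \<le> (\<integral>z. k (z - x) * (e / I) \<partial>lborel)"
      proof (rule integral_mono)
        show "\<bar>k (z - x) * f z - k (z - x) * f x\<bar> \<le> k (z - x) * (e / I)" for z
        proof (cases "norm (z - x) \<le> \<tau>")
          case True
          have "\<bar>k (z - x) * f z - k (z - x) * f x\<bar> = k (z - x) * \<bar>f z - f x\<bar>"
            using unit_bumpD(2)[OF k, of "z - x"] by (simp flip: right_diff_distrib add: abs_mult)
          then show ?thesis
            using mult_left_mono[OF close[OF True] unit_bumpD(2)[OF k, of "z - x"]] by simp
        next
          case False
          then show ?thesis using unit_bumpD(4)[OF k, of "z - x"] s by simp
        qed
      qed (use intk intkf in auto)
      finally show ?thesis using one by simp
    qed
    have meas: "(\<lambda>x. \<integral>z. k (z - x) * f z \<partial>lborel) \<in> borel_measurable borel"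
      by (rule lborel.borel_measurable_lebesgue_integral) measurable
    have int1: "integrable lborel (\<lambda>x. w x * (\<integral>z. k (z - x) * f z \<partial>lborel))"
    proof (rule Bochner_Integration.integrable_bound[of _ "\<lambda>x. (B + e / I) * w x"])
      show "AE x in lborel. norm (w x * (\<integral>z. k (z - x) * f z \<partial>lborel)) \<le> norm ((B + e / I) * w x)"
      proof (rule AE_I2)
        fix x
        have "\<bar>\<integral>z. k (z - x) * f z \<partial>lborel\<bar> \<le> \<bar>B + e / I\<bar>" using bd[of x] B[of x] by linarith
        from mult_right_mono[OF this, of "\<bar>w x\<bar>"]
        show "norm (w x * (\<integral>z. k (z - x) * f z \<partial>lborel)) \<le> norm ((B + e / I) * w x)"
          by (simp add: abs_mult mult_ac)
      qed
    qed (use w meas in auto)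
    have int2: "integrable lborel (\<lambda>x. w x * f x)"
      by (rule integrable_locally_integrable_mult[OF integrable_imp_locally_integrable[OF w] _ B f(2)]) auto
    have "(\<integral>z. convolution w k z * f z \<partial>lborel) - (\<integral>z. w z * f z \<partial>lborel)
        = (\<integral>x. w x * (\<integral>z. k (z - x) * f z \<partial>lborel) - w x * f x \<partial>lborel)"
      unfolding convolution_integral_swap[OF w k intf] using int1 int2 by simp
    also have "\<bar>\<dots>\<bar> \<le> (\<integral>x. \<bar>w x * (\<integral>z. k (z - x) * f z \<partial>lborel) - w x * f x\<bar> \<partial>lborel)"
      by (rule integral_abs_bound)
    also have "\<dots> \<le> (\<integral>x. \<bar>w x\<bar> * (e / I) \<partial>lborel)"
    proof (rule integral_mono)
      fix x show "\<bar>w x * (\<integral>z. k (z - x) * f z \<partial>lborel) - w x * f x\<bar> \<le> \<bar>w x\<bar> * (e / I)"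
        using mult_left_mono[OF bd[of x], of "\<bar>w x\<bar>"]
        by (simp flip: right_diff_distrib add: abs_mult)
    qed (use w int1 int2 in auto)
    also have "\<dots> = (\<integral>x. \<bar>w x\<bar> \<partial>lborel) * (e / I)" by simp
    also have "\<dots> \<le> I * (e / I)"
      using e I by (intro mult_right_mono) (auto simp: I_def)
    also have "\<dots> = e" using I by simp
    finally show ?thesis .
  qed
  moreover have "\<tau> > 0" using d(1) by (simp add: \<tau>_def)
  ultimately show ?thesis by blast
qed

section \<open>A localised relative entropy\<close>

definition pos_sq :: "real \<Rightarrow> real" where "pos_sq t = (max 0 t)\<^sup>2"

lemma pos_sq_has_derivative: "(pos_sq has_real_derivative 2 * max 0 t) (at t)"
proof (cases t "0::real" rule: linorder_cases)
  case less
  have "((\<lambda>t. 0) has_real_derivative 0) (at t)" by simp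
  then have "(pos_sq has_real_derivative 0) (at t)"
    by (rule has_field_derivative_transform_within_open[of _ _ _ "{..<0}"])
       (use less in \<open>auto simp: pos_sq_def\<close>)
  then show ?thesis using less by simp
next
  case greater
  have "((\<lambda>t. t\<^sup>2) has_real_derivative 2 * t) (at t)"
    by (auto intro!: derivative_eq_intros)
  then have "(pos_sq has_real_derivative 2 * t) (at t)"
    by (rule has_field_derivative_transform_within_open[of _ _ _ "{0<..}"])
       (use greater in \<open>auto simp: pos_sq_def\<close>)
  then show ?thesis using greater by simp
next
  case equal
  have "((\<lambda>h. max 0 h * (max 0 h / h)) \<longlongrightarrow> 0) (at (0::real))"
  proof (rule Lim_null_comparison[where g="\<lambda>h. \<bar>h\<bar>"])
    show "\<forall>\<^sub>F h in at 0. norm (max 0 h * (max 0 h / h)) \<le> \<bar>h::real\<bar>"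
      by (auto simp: max_def intro!: always_eventually)
    show "((\<lambda>h. \<bar>h\<bar>) \<longlongrightarrow> 0) (at (0::real))"
      by (auto intro!: tendsto_eq_intros)
  qed
  then show ?thesis using equal by (simp add: DERIV_def pos_sq_def power2_eq_square)
qed

text \<open>
  As a function of the energy \<open>h\<close> this vanishes above the level \<open>R\<close>.
  The exponential form is chosen so that the derivative of the cutoff, weighted by the Gibbs
  factor \<open>exp (- h / lam)\<close>, is of order \<open>exp (- R / lam)\<close> everywhere
  and not only near the level \<open>R\<close>.
\<close>

definition cutoff :: "real \<Rightarrow> real \<Rightarrow> real \<Rightarrow> real" where
  "cutoff lam R h = max 0 (1 - exp ((h - R) / lam))"

text \<open>
  With the Gibbs density \<open>G = exp (- h / lam)\<close> and the relative density
  \<open>u / G\<close>, this is \<open>1 / (1 + u / G)\<close>: a bounded, strictly convex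
  function of the relative density.
\<close>

definition gibbs_ratio :: "real \<Rightarrow> real \<Rightarrow> real \<Rightarrow> real" where
  "gibbs_ratio lam h u = exp (- h / lam) / (exp (- h / lam) + u)"

text \<open>
  A localised relative entropy \<open>P\<^sup>2 G \<beta>(u/G)\<close> with the bounded convex
  function \<open>\<beta>(s) = 1 / (1 + s)\<close>; as \<open>\<beta>\<close> is bounded, the
  cost of the localisation is bounded by an integral of the Gibbs factor alone.
\<close>

definition entropy_density :: "real \<Rightarrow> real \<Rightarrow> real \<Rightarrow> real \<Rightarrow> real" where
  "entropy_density lam R h u = pos_sq (1 - exp ((h - R) / lam)) * exp (- h / lam) * gibbs_ratio lam h u"

text \<open>
  The derivative of the entropy density with respect to \<open>u\<close>.
\<close>

definition entropy_multiplier :: "real \<Rightarrow> real \<Rightarrow> real \<Rightarrow> real \<Rightarrow> real" where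
  "entropy_multiplier lam R h u = - pos_sq (1 - exp ((h - R) / lam)) * (gibbs_ratio lam h u)\<^sup>2"

lemma gibbs_ratio_has_derivative:
  assumes lam: "lam > (0::real)" and h: "(h has_real_derivative h') (at t)" and u: "(u has_real_derivative u') (at t)"
    and pos: "u t \<ge> 0"
  shows "((\<lambda>t. gibbs_ratio lam (h t) (u t)) has_real_derivative
     - (exp (- h t / lam) / (exp (- h t / lam) + u t)\<^sup>2 * (u t * h' / lam + u'))) (at t)"
proof -
  have ne: "exp (- h t / lam) + u t \<noteq> 0" using pos exp_gt_zero[of "- h t / lam"] by linarith
  have "((\<lambda>t. exp (- h t / lam)) has_real_derivative (- exp (- h t / lam) * h' / lam)) (at t)"
    by (use lam in \<open>auto intro!: derivative_eq_intros h\<close>)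
  note d = DERIV_divide[OF this DERIV_add[OF this u] ne]
  show ?thesis
    unfolding gibbs_ratio_def
    by (rule DERIV_cong[OF d]) (use ne lam in \<open>simp add: add_divide_distrib diff_divide_distrib algebra_simps power2_eq_square\<close>)
qed

lemma cutoff_has_derivative:
  assumes lam: "lam > (0::real)" and h: "(h has_real_derivative h') (at t)"
  shows "((\<lambda>t. pos_sq (1 - exp ((h t - R) / lam))) has_real_derivative
     - (2 * cutoff lam R (h t) * (exp ((h t - R) / lam) / lam) * h')) (at t)"
proof -
  have "((\<lambda>t. 1 - exp ((h t - R) / lam)) has_real_derivative - (exp ((h t - R) / lam) * h' / lam)) (at t)"
    by (use lam in \<open>auto intro!: derivative_eq_intros h\<close>)
  from DERIV_chain2[OF pos_sq_has_derivative this]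
  show ?thesis by (rule DERIV_cong) (simp add: cutoff_def)
qed

lemma entropy_multiplier_has_derivative:
  assumes lam: "lam > (0::real)" and h: "(h has_real_derivative h') (at t)" and u: "(u has_real_derivative u') (at t)"
    and pos: "u t \<ge> 0"
  shows "((\<lambda>t. entropy_multiplier lam R (h t) (u t)) has_real_derivative
     2 * cutoff lam R (h t) * (exp ((h t - R) / lam) / lam) * (gibbs_ratio lam (h t) (u t))\<^sup>2 * h'
     + 2 * (cutoff lam R (h t))\<^sup>2 * gibbs_ratio lam (h t) (u t)
       * (exp (- h t / lam) / (exp (- h t / lam) + u t)\<^sup>2) * (u t * h' / lam + u')) (at t)"
proof -
  note d = DERIV_minus[OF DERIV_mult[OF cutoff_has_derivative[OF lam h, of R]
      DERIV_power[OF gibbs_ratio_has_derivative[OF lam h u pos], of 2]]]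
  show ?thesis
    unfolding entropy_multiplier_def minus_mult_left[symmetric]
    by (rule DERIV_cong[OF d]) (simp add: cutoff_def pos_sq_def algebra_simps power2_eq_square)
qed

lemma entropy_density_has_derivative:
  assumes lam: "lam > (0::real)" and h: "(h has_real_derivative h') (at t)" and u: "(u has_real_derivative u') (at t)"
    and pos: "u t \<ge> 0"
  shows "((\<lambda>t. entropy_density lam R (h t) (u t)) has_real_derivative
     (- (2 * cutoff lam R (h t) * (exp ((h t - R) / lam) / lam) * exp (- h t / lam) * gibbs_ratio lam (h t) (u t))
      - (cutoff lam R (h t))\<^sup>2 * exp (- h t / lam) * gibbs_ratio lam (h t) (u t) / lam
      + entropy_multiplier lam R (h t) (u t) * u t / lam) * h'
     + entropy_multiplier lam R (h t) (u t) * u') (at t)"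
proof -
  have "((\<lambda>t. exp (- h t / lam)) has_real_derivative (- exp (- h t / lam) * h' / lam)) (at t)"
    by (use lam in \<open>auto intro!: derivative_eq_intros h\<close>)
  note d = DERIV_mult[OF DERIV_mult[OF cutoff_has_derivative[OF lam h, of R] this]
      gibbs_ratio_has_derivative[OF lam h u pos]]
  show ?thesis
    unfolding entropy_density_def
    by (rule DERIV_cong[OF d])
       (simp add: entropy_multiplier_def gibbs_ratio_def cutoff_def pos_sq_def algebra_simps power2_eq_square
         add_divide_distrib)
qed

text \<open>
  The factor on the right is the gradient of the multiplier, and \<open>K - F\<close> is the
  momentum flux. Expanding gives the dissipation
  \<open>2 P\<^sup>2 m\<^sup>3 K\<^sup>2 / (lam G)\<close>, and Young's inequality absorbs the
  two mixed terms that contain \<open>K\<close> into half of it; the powers of \<open>P\<close>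
  and \<open>m\<close> match because the cutoff is a square and \<open>m\<close> comes from
  \<open>1 / (1 + s)\<close>.
\<close>

lemma dissipation_inequality:
  fixes P y m G lam p K F :: real
  assumes P: "0 \<le> P" "P \<le> 1" and m: "0 \<le> m" "m \<le> 1" and G: "G > 0" and lam: "lam > 0"
    and y: "0 \<le> y" "y \<le> 1"
  shows "P\<^sup>2 * m ^ 3 * K\<^sup>2 / (lam * G) - 2 * y\<^sup>2 * p\<^sup>2 * G / lam - 2 * F\<^sup>2 / (lam * G) - 2 * \<bar>p\<bar> * \<bar>F\<bar> / lam
    \<le> (2 * P * m\<^sup>2 * (y / lam) * p + 2 * P\<^sup>2 * m ^ 3 * K / (lam * G)) * (K - F)"
proof -
  define c where "c = 1 / (lam * G)"
  have c: "c > 0" using lam G by (simp add: c_def)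
  have Gc: "G / lam = 1 / (lam\<^sup>2 * c)" using lam G by (simp add: c_def field_simps power2_eq_square)
  have Pm: "0 \<le> P\<^sup>2 * m ^ 3 * c" "P\<^sup>2 * m ^ 3 \<le> 1"
    using P m c by (auto intro!: mult_nonneg_nonneg mult_le_one power_le_one)
  \<comment> \<open>Young: complete the square for the mixed term of cutoff gradient and defect.\<close>
  have "0 \<le> m * (c / 2 * (P * m * K + 2 * y * p / (lam * c))\<^sup>2)"
    using m c by simp
  also have "\<dots> = c / 2 * P\<^sup>2 * m ^ 3 * K\<^sup>2 + 2 * P * m\<^sup>2 * (y / lam) * p * K + m * (2 * y\<^sup>2 * p\<^sup>2 * (1 / (lam\<^sup>2 * c)))"
    using lam c by (simp add: field_simps power2_eq_square power3_eq_cube)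
  finally have 1: "0 \<le> c / 2 * P\<^sup>2 * m ^ 3 * K\<^sup>2 + 2 * P * m\<^sup>2 * (y / lam) * p * K + m * (2 * y\<^sup>2 * p\<^sup>2 * (G / lam))"
    by (simp add: Gc)
  have "m * (2 * y\<^sup>2 * p\<^sup>2 * (G / lam)) \<le> 1 * (2 * y\<^sup>2 * p\<^sup>2 * (G / lam))"
    using m G lam by (intro mult_right_mono) auto
  with 1 have A: "- (c / 2 * P\<^sup>2 * m ^ 3 * K\<^sup>2) - 2 * y\<^sup>2 * p\<^sup>2 * (G / lam) \<le> 2 * P * m\<^sup>2 * (y / lam) * p * K"
    by linarith
  \<comment> \<open>Likewise for the mixed term of defect and commutator.\<close>
  have "0 \<le> (P\<^sup>2 * m ^ 3 * c) * (K - 2 * F)\<^sup>2 / 2" using Pm by simp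
  then have "2 * (P\<^sup>2 * m ^ 3 * c) * (K * F) \<le> c / 2 * P\<^sup>2 * m ^ 3 * K\<^sup>2 + 2 * (P\<^sup>2 * m ^ 3) * (c * F\<^sup>2)"
    by (simp add: algebra_simps power2_eq_square)
  moreover have "2 * (P\<^sup>2 * m ^ 3) * (c * F\<^sup>2) \<le> 2 * 1 * (c * F\<^sup>2)"
    using Pm c by (intro mult_right_mono mult_left_mono) auto
  ultimately have B: "2 * (P\<^sup>2 * m ^ 3 * c) * (K * F) \<le> c / 2 * P\<^sup>2 * m ^ 3 * K\<^sup>2 + 2 * (c * F\<^sup>2)"
    by linarith
  have "P * m\<^sup>2 * y \<le> 1" using P m y by (intro mult_le_one power_le_one) (auto intro: mult_nonneg_nonneg)
  moreover have "0 \<le> P * m\<^sup>2 * y" using P m y by simp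
  ultimately have "\<bar>(P * m\<^sup>2 * y) * (p * F)\<bar> \<le> \<bar>p\<bar> * \<bar>F\<bar>"
    using mult_right_mono[of "P * m\<^sup>2 * y" 1 "\<bar>p\<bar> * \<bar>F\<bar>"] P y by (simp add: abs_mult)
  then have "2 / lam * ((P * m\<^sup>2 * y) * (p * F)) \<le> 2 / lam * (\<bar>p\<bar> * \<bar>F\<bar>)"
    using lam by (intro mult_left_mono) auto
  then have C: "2 * P * m\<^sup>2 * (y / lam) * p * F \<le> 2 * \<bar>p\<bar> * \<bar>F\<bar> / lam"
    by (simp add: mult_ac)
  have "(2 * P * m\<^sup>2 * (y / lam) * p + 2 * P\<^sup>2 * m ^ 3 * K * c) * (K - F)
     = 2 * P * m\<^sup>2 * (y / lam) * p * K + 2 * (c * P\<^sup>2 * m ^ 3 * K\<^sup>2) - 2 * (P\<^sup>2 * m ^ 3 * c) * (K * F)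
       - 2 * P * m\<^sup>2 * (y / lam) * p * F"
    by (simp add: algebra_simps power2_eq_square add_divide_distrib diff_divide_distrib)
  also have "\<dots> \<ge> c * P\<^sup>2 * m ^ 3 * K\<^sup>2 - 2 * y\<^sup>2 * p\<^sup>2 * (G / lam) - 2 * (c * F\<^sup>2) - 2 * \<bar>p\<bar> * \<bar>F\<bar> / lam"
    using A B C by linarith
  finally show ?thesis by (simp add: c_def)
qed

section \<open>Stationary kinetic Fokker-Planck equations\<close>

lemma ddir_product_basis_sum:
  fixes f :: "'a::euclidean_space \<times> 'a \<Rightarrow> real"
  assumes "smooth f"
  shows "ddir (x, 0) f z = (\<Sum>e\<in>Basis. (x \<bullet> e) * ddir (e, 0) f z)"
    and "ddir (0, x) f z = (\<Sum>e\<in>Basis. (x \<bullet> e) * ddir (0, e) f z)"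
proof -
  note lin = linear_ddir[OF assms, of z]
  have "(x, 0) = (\<Sum>e\<in>Basis. (x \<bullet> e) *\<^sub>R (e, 0::'a))"
    by (simp add: prod_eq_iff fst_sum snd_sum euclidean_representation)
  then show "ddir (x, 0) f z = (\<Sum>e\<in>Basis. (x \<bullet> e) * ddir (e, 0) f z)"
    using lin by (simp only: linear_sum linear_cmul real_scaleR_def)
  have "(0, x) = (\<Sum>e\<in>Basis. (x \<bullet> e) *\<^sub>R (0::'a, e))"
    by (simp add: prod_eq_iff fst_sum snd_sum euclidean_representation)
  then show "ddir (0, x) f z = (\<Sum>e\<in>Basis. (x \<bullet> e) * ddir (0, e) f z)"
    using lin by (simp only: linear_sum linear_cmul real_scaleR_def)
qed

lemma convolution_line_derivative:
  assumes "locally_integrable w" "test_function k"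
  shows "((\<lambda>t. convolution w k (z + t *\<^sub>R v)) has_real_derivative convolution w (ddir v k) z) (at 0)"
  using has_derivative_along_line[of "convolution w k" z 0 v]
    Ck_convolution[OF assms, of 1] fun_cong[OF ddir_convolution[OF assms, of v], of z] by simp

lemma convolution_continuous:
  "locally_integrable w \<Longrightarrow> test_function k \<Longrightarrow> continuous_on A (convolution w k)"
  by (meson Ck_0 Ck_convolution continuous_on_subset subset_UNIV)

text \<open>
  The Gaussian weight beats the polynomial volume of the balls in which the energy sublevels
  lie.
\<close>

lemma power_times_gaussian_tendsto_0:
  fixes a :: real
  assumes "a > 0"
  shows "((\<lambda>s. s ^ n * exp (- (s\<^sup>2 / a))) \<longlongrightarrow> 0) at_top"
proof -
  have sq: "filterlim (\<lambda>s::real. s\<^sup>2 / a) at_top at_top"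
    using assms filterlim_tendsto_pos_mult_at_top[OF tendsto_const, of "1/a" "\<lambda>s::real. s\<^sup>2" at_top]
      filterlim_pow_at_top[of 2 "\<lambda>s::real. s" at_top] by (simp add: filterlim_ident)
  have "((\<lambda>s::real. a ^ n * ((s\<^sup>2 / a) ^ n / exp (s\<^sup>2 / a))) \<longlongrightarrow> a ^ n * 0) at_top"
    by (intro tendsto_intros filterlim_compose[OF tendsto_power_div_exp_0 sq])
  then have lim: "((\<lambda>s::real. s ^ (2 * n) * exp (- (s\<^sup>2 / a))) \<longlongrightarrow> 0) at_top"
  proof -
    have "a ^ n * ((s\<^sup>2 / a) ^ n / exp (s\<^sup>2 / a)) = s ^ (2 * n) * exp (- (s\<^sup>2 / a))" for s
      using assms unfolding power_mult power_divide exp_minus by (simp add: divide_inverse)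
    then show ?thesis using \<open>((\<lambda>s::real. a ^ n * ((s\<^sup>2 / a) ^ n / exp (s\<^sup>2 / a))) \<longlongrightarrow> a ^ n * 0) at_top\<close> by simp
  qed
  show ?thesis
  proof (rule Lim_null_comparison[OF _ lim])
    show "\<forall>\<^sub>F s::real in at_top. norm (s ^ n * exp (- (s\<^sup>2 / a))) \<le> s ^ (2 * n) * exp (- (s\<^sup>2 / a))"
      using eventually_ge_at_top[of 1]
    proof eventually_elim
      case (elim s)
      then have "s ^ n \<le> s ^ (2 * n)" by (intro power_increasing) auto
      then show ?case using elim by (simp add: abs_mult)
    qed
  qed
qed

text \<open>
  This is \<open>p \<cdot> \<nabla>h(q)\<close>, truncated in the momentum at scale
  \<open>1/c\<close>: the test function through which the second moments in \<open>p\<close> are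
  reached.
\<close>

lemma momentum_truncation:
  fixes h \<theta> :: "'a::euclidean_space \<Rightarrow> real" and c :: real
  assumes h: "test_function h" and \<theta>: "test_function \<theta>" and c: "c > 0"
  defines "F \<equiv> \<lambda>z. \<Sum>i\<in>Basis. (snd z \<bullet> i) * (ddir i h (fst z) * \<theta> (c *\<^sub>R snd z))"
  shows "test_function F"
    and "ddir v F z = (\<Sum>i\<in>Basis. (snd v \<bullet> i) * (ddir i h (fst z) * \<theta> (c *\<^sub>R snd z))
       + (snd z \<bullet> i) * (ddir (fst v) (ddir i h) (fst z) * \<theta> (c *\<^sub>R snd z)
           + ddir i h (fst z) * (c * ddir (snd v) \<theta> (c *\<^sub>R snd z))))"
proof -
  note sh = test_function_smooth[OF h] and s\<theta> = test_function_smooth[OF \<theta>]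
  have lin: "bounded_linear (\<lambda>z::'a\<times>'a. snd z \<bullet> i)" "bounded_linear (\<lambda>z::'a\<times>'a. c *\<^sub>R snd z)" for i
    by (auto intro!: bounded_linear_intros)
  have sF: "smooth F"
    unfolding F_def
    by (rule smooth_sum, rule smooth_mult[OF smooth_bounded_linear[OF lin(1)]],
        rule smooth_mult[OF smooth_compose_linear[OF bounded_linear_fst smooth_ddir[OF sh]]
          smooth_compose_linear[OF lin(2) s\<theta>]])
  obtain r where r: "r > 0" "\<And>x. r < norm x \<Longrightarrow> h x = 0" using test_function_zero_outside[OF h] by blast
  obtain s where s: "s > 0" "\<And>x. s < norm x \<Longrightarrow> \<theta> x = 0" using test_function_zero_outside[OF \<theta>] by blast
  show "test_function F"
  proof (rule test_functionI[OF sF, of "r + s / c"])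
    fix z :: "'a \<times> 'a" assume "r + s / c < norm z"
    then have "r < norm (fst z) \<or> s / c < norm (snd z)"
      using norm_Pair_le[of "fst z" "snd z"] by auto
    then have "r < norm (fst z) \<or> s < norm (c *\<^sub>R snd z)"
      using c by (simp add: divide_less_eq mult.commute)
    then show "F z = 0"
      using ddir_zero_outside[OF smooth_differentiable[OF sh] r(2)] s(2) by (auto simp: F_def)
  qed
  have d1: "((\<lambda>z. ddir i h (fst z)) has_derivative (\<lambda>v. ddir (fst v) (ddir i h) (fst z))) (at z)" for i and z :: "'a \<times> 'a"
    by (rule has_derivative_compose[where f=fst and f'=fst and g="ddir i h" and g'="frechet_derivative (ddir i h) (at (fst z))"])
       (auto intro!: derivative_eq_intros smooth_has_derivative smooth_ddir sh)
  have d2: "((\<lambda>z. \<theta> (c *\<^sub>R snd z)) has_derivative (\<lambda>v. c * ddir (snd v) \<theta> (c *\<^sub>R snd z))) (at z)" for z :: "'a \<times> 'a"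
  proof -
    have "((\<lambda>z. \<theta> (c *\<^sub>R snd z)) has_derivative (\<lambda>v. ddir (c *\<^sub>R snd v) \<theta> (c *\<^sub>R snd z))) (at z)"
      by (rule has_derivative_compose[where f="\<lambda>z. c *\<^sub>R snd z" and f'="\<lambda>z. c *\<^sub>R snd z" and g=\<theta>
            and g'="frechet_derivative \<theta> (at (c *\<^sub>R snd z))"])
         (auto intro!: derivative_eq_intros smooth_has_derivative s\<theta>)
    then show ?thesis by (simp only: linear_cmul[OF linear_ddir[OF s\<theta>]] real_scaleR_def)
  qed
  have d3: "((\<lambda>z. snd z \<bullet> i) has_derivative (\<lambda>v. snd v \<bullet> i)) (at z)" for i and z :: "'a \<times> 'a"
    by (auto intro!: derivative_eq_intros)
  have "(F has_derivative (\<lambda>v. \<Sum>i\<in>Basis. (snd z \<bullet> i) * (ddir i h (fst z) * (c * ddir (snd v) \<theta> (c *\<^sub>R snd z))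
        + ddir (fst v) (ddir i h) (fst z) * \<theta> (c *\<^sub>R snd z)) + (snd v \<bullet> i) * (ddir i h (fst z) * \<theta> (c *\<^sub>R snd z)))) (at z)" for z
    unfolding F_def by (intro has_derivative_sum has_derivative_mult d1 d2 d3)
  from fun_cong[OF ddir_eqI[OF this, of v], of z]
  show "ddir v F z = (\<Sum>i\<in>Basis. (snd v \<bullet> i) * (ddir i h (fst z) * \<theta> (c *\<^sub>R snd z))
       + (snd z \<bullet> i) * (ddir (fst v) (ddir i h) (fst z) * \<theta> (c *\<^sub>R snd z)
           + ddir i h (fst z) * (c * ddir (snd v) \<theta> (c *\<^sub>R snd z))))"
    by (simp add: add.commute)
qed

text \<open>
  The linear stationary kinetic Fokker-Planck equation with drift \<open>b = \<nabla>W\<close>: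
  the self-consistent field of a stationary density is frozen, and it is a continuous gradient
  of a potential that grows at least quadratically.
\<close>

locale kinetic_equilibrium =
  fixes lam :: real and W :: "'a::euclidean_space \<Rightarrow> real" and b :: "'a \<Rightarrow> 'a"
    and \<rho> :: "'a \<times> 'a \<Rightarrow> real" and M C :: real
  assumes lam_pos: "lam > 0"
    and W_deriv: "\<And>q. (W has_derivative (\<lambda>v. b q \<bullet> v)) (at q)"
    and b_cont: "continuous_on UNIV b"
    and W_lower: "\<And>q. (norm q)\<^sup>2 - M \<le> W q"
    and rho_integrable: "integrable lborel \<rho>"
    and C_pos: "C > 0"
    and rho_bounds: "AE z in lborel. 0 \<le> \<rho> z \<and> \<rho> z \<le> C"
    and stationary: "\<And>\<phi>. test_function \<phi> \<Longrightarrow>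
      (\<integral>z. \<rho> z * (ddir (snd z, 0) \<phi> z - ddir (0, b (fst z) + snd z) \<phi> z
         + lam * (\<Sum>e\<in>Basis. ddir (0, e) (ddir (0, e) \<phi>) z)) \<partial>lborel) = 0"
begin

definition energy :: "'a \<times> 'a \<Rightarrow> real" where
  "energy z = (norm (snd z))\<^sup>2 / 2 + W (fst z)"

definition drift :: "'a \<Rightarrow> 'a \<times> 'a \<Rightarrow> real" where
  "drift e z = (b (fst z) + snd z) \<bullet> e"

lemma energy_line_derivative:
  "((\<lambda>t. energy (z + t *\<^sub>R v)) has_real_derivative b (fst z) \<bullet> fst v + snd z \<bullet> snd v) (at 0)"
proof -
  have W: "((\<lambda>t. W (fst z + t *\<^sub>R fst v)) has_derivative (\<lambda>s. b (fst z) \<bullet> (s *\<^sub>R fst v))) (at 0)"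
    by (rule has_derivative_compose[where f="\<lambda>t. fst z + t *\<^sub>R fst v" and f'="\<lambda>s. s *\<^sub>R fst v"
          and g=W and g'="\<lambda>v. b (fst z) \<bullet> v"])
       (use W_deriv[of "fst z"] in \<open>auto intro!: derivative_eq_intros\<close>)
  have "((\<lambda>t. (snd z + t *\<^sub>R snd v) \<bullet> (snd z + t *\<^sub>R snd v) / 2) has_derivative (\<lambda>s. s * (snd z \<bullet> snd v))) (at 0)"
    by (auto intro!: derivative_eq_intros simp: inner_commute)
  note has_derivative_add[OF this W]
  moreover have "(\<lambda>s. s * (snd z \<bullet> snd v) + b (fst z) \<bullet> (s *\<^sub>R fst v)) = (*) (b (fst z) \<bullet> fst v + snd z \<bullet> snd v)"
    by (simp add: fun_eq_iff algebra_simps)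
  ultimately show ?thesis
    unfolding has_field_derivative_def by (simp add: energy_def power2_norm_eq_inner)
qed

lemma W_cont: "continuous_on A W"
  using has_derivative_continuous[OF W_deriv]
  by (meson continuous_at_imp_continuous_on)

lemma energy_cont: "continuous_on A energy"
  unfolding energy_def
  by (intro continuous_intros continuous_on_compose2[OF W_cont[of UNIV]]) auto

lemma b_compose_cont: "continuous_on A f \<Longrightarrow> continuous_on A (\<lambda>z. b (f z))"
  by (rule continuous_on_compose2[OF b_cont]) auto

lemma drift_cont: "continuous_on A (drift e)"
  unfolding drift_def by (intro continuous_intros b_compose_cont)

text \<open>
  Hence sublevel sets of the energy are bounded, with a radius that grows only like the square
  root of the level.
\<close>

lemma energy_lower: "(norm z)\<^sup>2 / 2 - M \<le> energy z"
proof -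
  have "(norm z)\<^sup>2 = (norm (fst z))\<^sup>2 + (norm (snd z))\<^sup>2"
    by (cases z) (simp add: norm_Pair)
  then show ?thesis using W_lower[of "fst z"] zero_le_power2[of "norm (fst z)"]
    unfolding energy_def by linarith
qed

lemma energy_sublevel_compact: "compact {z. energy z \<le> c}"
proof -
  have "bounded {z. energy z \<le> c}"
  proof (rule boundedI)
    fix z assume "z \<in> {z. energy z \<le> c}"
    then have "(norm z)\<^sup>2 \<le> 2 * (c + M)" using energy_lower[of z] by simp
    then show "norm z \<le> sqrt (2 * (c + M))" by (rule real_le_rsqrt)
  qed
  moreover have "closed {z. energy z \<le> c}" by (intro closed_Collect_le energy_cont continuous_intros)
  ultimately show ?thesis by (simp add: compact_eq_bounded_closed)
qed

lemma rho_locally_integrable: "locally_integrable \<rho>"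
  by (rule integrable_imp_locally_integrable[OF rho_integrable])

lemma rho_drift_locally_integrable: "locally_integrable (\<lambda>z. \<rho> z * drift e z)"
  by (rule locally_integrable_mult_continuous[OF rho_locally_integrable drift_cont])

lemma rho_momentum_locally_integrable: "locally_integrable (\<lambda>z. \<rho> z * (snd z \<bullet> e))"
  by (rule locally_integrable_mult_continuous[OF rho_locally_integrable]) (intro continuous_intros)

text \<open>
  Use the reflected and translated kernel as a test function. The result is the stationary
  equation for the mollified density, before the coefficients are moved out of the convolutions.
\<close>

lemma stationary_convolution:
  assumes \<eta>: "test_function \<eta>"
  shows "(\<Sum>e\<in>Basis. convolution (\<lambda>z. \<rho> z * drift e z) (ddir (0, e) \<eta>) z
      + lam * convolution \<rho> (ddir (0, e) (ddir (0, e) \<eta>)) z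
      - convolution (\<lambda>z. \<rho> z * (snd z \<bullet> e)) (ddir (e, 0) \<eta>) z) = 0"
proof -
  define \<phi> where "\<phi> z' = \<eta> (z + - z')" for z'
  have sm: "smooth \<eta>" using \<eta> by (rule test_function_smooth)
  have d: "ddir v \<phi> = (\<lambda>z'. - ddir v \<eta> (z + - z'))" for v
    unfolding \<phi>_def
  proof (rule ddir_eqI)
    fix z'
    have "((\<lambda>x. \<eta> (z + - x)) has_derivative (\<lambda>v. ddir (- v) \<eta> (z + - z'))) (at z')"
      by (rule has_derivative_compose[where f="\<lambda>x. z + - x" and f'="\<lambda>v. - v" and g=\<eta>
            and g'="frechet_derivative \<eta> (at (z + - z'))"])
         (auto intro!: derivative_eq_intros smooth_has_derivative sm)
    then show "((\<lambda>x. \<eta> (z + - x)) has_derivative (\<lambda>v. - ddir v \<eta> (z + - z'))) (at z')"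
      by (simp add: linear_neg[OF linear_ddir[OF sm]])
  qed
  have d2: "ddir v (ddir v \<phi>) z' = ddir v (ddir v \<eta>) (z + - z')" for v z'
  proof -
    have "((\<lambda>x. - ddir v \<eta> (z + - x)) has_derivative (\<lambda>w. - ddir (- w) (ddir v \<eta>) (z + - x))) (at x)" for x
      by (intro has_derivative_minus has_derivative_compose[where f="\<lambda>x. z + - x" and f'="\<lambda>v. - v" and g="ddir v \<eta>"
            and g'="frechet_derivative (ddir v \<eta>) (at (z + - x))"])
         (auto intro!: derivative_eq_intros smooth_has_derivative smooth_ddir sm)
    from fun_cong[OF ddir_eqI[OF this]] show ?thesis
      unfolding d by (simp add: linear_neg[OF linear_ddir[OF smooth_ddir[OF sm]]])
  qed
  have sm\<phi>: "smooth \<phi>"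
    unfolding \<phi>_def by (rule smooth_compose_affine[OF _ sm]) (rule bounded_linear_minus[OF bounded_linear_ident])
  obtain r where r: "\<And>x. r < norm x \<Longrightarrow> \<eta> x = 0" using test_function_zero_outside[OF \<eta>] by blast
  have test: "test_function \<phi>"
  proof (rule test_functionI[OF sm\<phi>, of "r + norm z"])
    fix x :: "'a \<times> 'a" assume "r + norm z < norm x"
    then have "r < norm (z - x)" using norm_triangle_ineq2[of x z] by (simp add: norm_minus_commute)
    then show "\<phi> x = 0" by (simp add: \<phi>_def r)
  qed
  define A where "A e z' = \<rho> z' * drift e z' * ddir (0, e) \<eta> (z - z')" for e z'
  define B where "B e z' = \<rho> z' * ddir (0, e) (ddir (0, e) \<eta>) (z - z')" for e z'
  define D where "D e z' = \<rho> z' * (snd z' \<bullet> e) * ddir (e, 0) \<eta> (z - z')" for e z'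
  have int: "integrable lborel (A e)" "integrable lborel (B e)" "integrable lborel (D e)" for e
    unfolding A_def B_def D_def
    by (intro convolution_integrable_test rho_locally_integrable rho_drift_locally_integrable rho_momentum_locally_integrable test_function_ddir \<eta>)+
  have "\<rho> z' * (ddir (snd z', 0) \<phi> z' - ddir (0, b (fst z') + snd z') \<phi> z'
         + lam * (\<Sum>e\<in>Basis. ddir (0, e) (ddir (0, e) \<phi>) z'))
      = (\<Sum>e\<in>Basis. A e z' + lam * B e z' - D e z')" for z'
    unfolding d2 unfolding fun_cong[OF d] ddir_product_basis_sum(1)[OF sm, where x="snd z'"]
      ddir_product_basis_sum(2)[OF sm, where x="b (fst z') + snd z'"]
    by (simp add: A_def B_def D_def drift_def sum.distrib sum_subtractf sum_distrib_left algebra_simps)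
  then have "0 = (\<integral>z'. (\<Sum>e\<in>Basis. A e z' + lam * B e z' - D e z') \<partial>lborel)"
    using stationary[OF test] by simp
  also have "\<dots> = (\<Sum>e\<in>Basis. (\<integral>z'. A e z' \<partial>lborel) + lam * (\<integral>z'. B e z' \<partial>lborel) - (\<integral>z'. D e z' \<partial>lborel))"
    using int by (simp add: Bochner_Integration.integral_sum)
  finally show ?thesis
    by (simp add: convolution_def A_def B_def D_def)
qed

text \<open>
  The vector field \<open>lam \<nabla>\<^sub>p u + p u\<close> of the mollified density; it
  vanishes precisely for a Maxwellian in \<open>p\<close>.
\<close>

definition maxwell_defect :: "('a \<times> 'a \<Rightarrow> real) \<Rightarrow> 'a \<Rightarrow> 'a \<times> 'a \<Rightarrow> real" where
  "maxwell_defect \<eta> e z = lam * convolution \<rho> (ddir (0, e) \<eta>) z + (snd z \<bullet> e) * convolution \<rho> \<eta> z"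

text \<open>
  The error made by moving the friction and force coefficient out of the convolution. It appears
  under a momentum divergence, so it is absorbed by the dissipation once it is small uniformly
  on compact sets.
\<close>

definition force_commutator :: "('a \<times> 'a \<Rightarrow> real) \<Rightarrow> 'a \<Rightarrow> 'a \<times> 'a \<Rightarrow> real" where
  "force_commutator \<eta> e z = drift e z * convolution \<rho> \<eta> z - convolution (\<lambda>z. \<rho> z * drift e z) \<eta> z"

text \<open>
  The error made by moving the velocity out of the convolution in the transport term. There is
  no dissipation in position, so this one has to be small by itself.
\<close>

definition transport_commutator :: "('a \<times> 'a \<Rightarrow> real) \<Rightarrow> 'a \<times> 'a \<Rightarrow> real" where
  "transport_commutator \<eta> z = (\<Sum>e\<in>Basis. (snd z \<bullet> e) * convolution \<rho> (ddir (e, 0) \<eta>) z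
      - convolution (\<lambda>z. \<rho> z * (snd z \<bullet> e)) (ddir (e, 0) \<eta>) z)"

lemma maxwell_defect_cont: "test_function \<eta> \<Longrightarrow> continuous_on A (maxwell_defect \<eta> e)"
  unfolding maxwell_defect_def
  by (intro continuous_intros convolution_continuous rho_locally_integrable test_function_ddir)

lemma convolution_rho_bounds:
  assumes "unit_bump \<tau> \<eta>"
  shows "0 \<le> convolution \<rho> \<eta> z" "convolution \<rho> \<eta> z \<le> C"
proof -
  note \<eta> = unit_bumpD[OF assms]
  have int: "integrable lborel (\<lambda>z'. \<rho> z' * \<eta> (z - z'))"
    by (rule convolution_integrable_test[OF rho_locally_integrable \<eta>(1)])
  show "0 \<le> convolution \<rho> \<eta> z"
    unfolding convolution_def
    by (rule integral_nonneg_AE) (use rho_bounds in eventually_elim, use \<eta>(2) in auto)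
  have "convolution \<rho> \<eta> z \<le> (\<integral>z'. C * \<eta> (z - z') \<partial>lborel)"
    unfolding convolution_def
  proof (rule integral_mono_AE[OF int])
    show "integrable lborel (\<lambda>z'. C * \<eta> (z - z'))"
      using lborel_integral_reflect(2)[OF \<eta>(8)] \<eta>(7) by simp
    show "AE x in lborel. \<rho> x * \<eta> (z - x) \<le> C * \<eta> (z - x)"
      using rho_bounds by eventually_elim (auto intro: mult_right_mono \<eta>(2))
  qed
  also have "\<dots> = C" using lborel_integral_reflect(1)[OF \<eta>(8)] \<eta>(3) by simp
  finally show "convolution \<rho> \<eta> z \<le> C" .
qed

text \<open>
  Only values of the drift at distance at most \<open>\<tau>\<close> are compared.
\<close>

lemma force_commutator_bound:
  assumes k: "unit_bump \<tau> \<eta>"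
    and \<omega>: "\<And>z'. norm (z - z') \<le> \<tau> \<Longrightarrow> \<bar>drift e z - drift e z'\<bar> \<le> \<omega>"
  shows "\<bar>force_commutator \<eta> e z\<bar> \<le> C * \<omega>"
proof -
  note \<eta> = unit_bumpD[OF k]
  have int: "integrable lborel (\<lambda>z'. \<rho> z' * \<eta> (z - z'))" "integrable lborel (\<lambda>z'. \<rho> z' * drift e z' * \<eta> (z - z'))"
    by (intro convolution_integrable_test rho_locally_integrable rho_drift_locally_integrable \<eta>(1))+
  have "force_commutator \<eta> e z = (\<integral>z'. drift e z * (\<rho> z' * \<eta> (z - z')) - \<rho> z' * drift e z' * \<eta> (z - z') \<partial>lborel)"
    unfolding force_commutator_def convolution_def using int by simp
  also have "\<bar>\<dots>\<bar> \<le> (\<integral>z'. \<bar>drift e z * (\<rho> z' * \<eta> (z - z')) - \<rho> z' * drift e z' * \<eta> (z - z')\<bar> \<partial>lborel)"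
    by (rule integral_abs_bound)
  also have "\<dots> \<le> (\<integral>z'. C * \<omega> * \<eta> (z - z') \<partial>lborel)"
  proof (rule integral_mono_AE)
    show "integrable lborel (\<lambda>z'. C * \<omega> * \<eta> (z - z'))"
      using lborel_integral_reflect(2)[OF \<eta>(8)] \<eta>(7) by simp
    show "AE z' in lborel. \<bar>drift e z * (\<rho> z' * \<eta> (z - z')) - \<rho> z' * drift e z' * \<eta> (z - z')\<bar> \<le> C * \<omega> * \<eta> (z - z')"
      using rho_bounds
    proof eventually_elim
      case (elim z')
      have "\<bar>drift e z * (\<rho> z' * \<eta> (z - z')) - \<rho> z' * drift e z' * \<eta> (z - z')\<bar>
          = \<bar>(drift e z - drift e z') * (\<rho> z' * \<eta> (z - z'))\<bar>"
        by (simp add: algebra_simps)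
      also have "\<dots> = \<bar>drift e z - drift e z'\<bar> * (\<rho> z' * \<eta> (z - z'))"
        using elim \<eta>(2)[of "z - z'"] by (simp add: abs_mult)
      also have "\<dots> \<le> \<omega> * (C * \<eta> (z - z'))"
      proof (cases "norm (z - z') \<le> \<tau>")
        case True
        then show ?thesis
          using elim \<eta>(2)[of "z - z'"] \<omega>[OF True] C_pos
          by (intro mult_mono) (auto intro: order_trans[OF abs_ge_zero])
      next
        case False
        then show ?thesis using \<eta>(4)[of "z - z'"] by simp
      qed
      finally show ?case by (simp add: mult_ac)
    qed
  qed (use int in simp)
  also have "\<dots> = C * \<omega>" using lborel_integral_reflect(1)[OF \<eta>(8)] \<eta>(3) by simp
  finally show ?thesis .
qed

text \<open>
  After a change of variables the density is replaced by its bound \<open>C\<close>, and what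
  remains is the integral that is small for a kinetic mollifier.
\<close>

lemma transport_commutator_bound:
  assumes k: "kinetic_mollifier \<tau> \<eta>"
  shows "\<bar>transport_commutator \<eta> z\<bar> \<le> DIM('a) * (C * \<tau>)"
proof -
  have k1: "unit_bump \<tau> \<eta>" using k by (simp add: kinetic_mollifier_def)
  note \<eta> = unit_bumpD[OF k1]
  have "\<bar>(snd z \<bullet> e) * convolution \<rho> (ddir (e, 0) \<eta>) z
      - convolution (\<lambda>z. \<rho> z * (snd z \<bullet> e)) (ddir (e, 0) \<eta>) z\<bar> \<le> C * \<tau>" if e: "e \<in> Basis" for e
  proof -
    let ?D = "ddir (e, 0) \<eta>"
    define f where "f y = \<bar>(snd y \<bullet> e) * ?D y\<bar>" for y
    have cf: "continuous_on UNIV f" unfolding f_def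
      by (intro continuous_intros smooth_continuous smooth_ddir \<eta>(5))
    have fm: "f \<in> borel_measurable borel" by (rule borel_measurable_continuous_onI[OF cf])
    have fi: "integrable lborel f"
      by (rule compact_support_integrable[OF cf, of \<tau>])
        (simp add: f_def ddir_zero_outside[OF smooth_differentiable[OF \<eta>(5)] \<eta>(4)])
    have fi': "integrable lborel (\<lambda>z'. f (z - z'))"
      using lborel_integral_reflect(2)[OF fm, of z] fi by (simp only:)
    have int: "integrable lborel (\<lambda>z'. \<rho> z' * ?D (z - z'))" "integrable lborel (\<lambda>z'. \<rho> z' * (snd z' \<bullet> e) * ?D (z - z'))"
      by (intro convolution_integrable_test rho_locally_integrable rho_momentum_locally_integrable test_function_ddir \<eta>(1))+
    have eq: "(snd z \<bullet> e) * convolution \<rho> ?D z - convolution (\<lambda>z. \<rho> z * (snd z \<bullet> e)) ?D z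
      = (\<integral>z'. (snd z \<bullet> e) * (\<rho> z' * ?D (z - z')) - \<rho> z' * (snd z' \<bullet> e) * ?D (z - z') \<partial>lborel)"
      unfolding convolution_def using int by simp
    have "\<bar>(snd z \<bullet> e) * convolution \<rho> ?D z - convolution (\<lambda>z. \<rho> z * (snd z \<bullet> e)) ?D z\<bar>
      \<le> (\<integral>z'. \<bar>(snd z \<bullet> e) * (\<rho> z' * ?D (z - z')) - \<rho> z' * (snd z' \<bullet> e) * ?D (z - z')\<bar> \<partial>lborel)"
      unfolding eq by (rule integral_abs_bound)
    also have "\<dots> \<le> (\<integral>z'. C * f (z - z') \<partial>lborel)"
    proof (rule integral_mono_AE)
      show "integrable lborel (\<lambda>z'. C * f (z - z'))"
        by (rule integrable_mult_right) (rule fi')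
      show "AE z' in lborel. \<bar>(snd z \<bullet> e) * (\<rho> z' * ?D (z - z')) - \<rho> z' * (snd z' \<bullet> e) * ?D (z - z')\<bar> \<le> C * f (z - z')"
        using rho_bounds
      proof eventually_elim
        case (elim z')
        have "\<bar>(snd z \<bullet> e) * (\<rho> z' * ?D (z - z')) - \<rho> z' * (snd z' \<bullet> e) * ?D (z - z')\<bar>
          = \<bar>\<rho> z' * ((snd (z - z') \<bullet> e) * ?D (z - z'))\<bar>"
          by (rule arg_cong[where f=abs]) (simp add: left_diff_distrib right_diff_distrib inner_diff_left mult_ac)
        also have "\<dots> = \<rho> z' * f (z - z')" using elim unfolding f_def by (simp add: abs_mult)
        also have "\<dots> \<le> C * f (z - z')" using elim by (intro mult_right_mono) (auto simp: f_def)
        finally show ?case .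
      qed
    qed (use int in simp)
    also have "\<dots> = C * (\<integral>y. f y \<partial>lborel)" using lborel_integral_reflect(1)[OF fm, of z] by simp
    also have "\<dots> \<le> C * \<tau>"
      using k e C_pos unfolding kinetic_mollifier_def f_def by (intro mult_left_mono) auto
    finally show ?thesis .
  qed
  then have "\<bar>transport_commutator \<eta> z\<bar> \<le> (\<Sum>e\<in>(Basis::'a set). C * \<tau>)"
    unfolding transport_commutator_def by (intro order_trans[OF sum_abs] sum_mono) auto
  then show ?thesis by simp
qed

section \<open>Entropy dissipation\<close>

text \<open>
  The localised entropy balance. Multiply the equation of the mollified density \<open>u\<close>
  by the entropy multiplier. The Hamiltonian part is a total derivative of the entropy density,
  since the energy is constant along its flow, and the Fokker-Planck part yields the weighted
  integral of the squared Maxwell defect. What is left on the right are the commutators, which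
  are small with the mollifier, and the cutoff error \<open>exp (- R / lam)\<close>. The
  constant on the left depends neither on the level \<open>R\<close> of the cutoff nor on the
  mollifier.
\<close>

lemma dissipation_bound:
  assumes k: "unit_bump \<tau> \<eta>" and s: "s > 0" and R: "R = s\<^sup>2 / 2 - M" and \<omega>: "\<omega> \<ge> 0"
    and force: "\<And>e z. e \<in> Basis \<Longrightarrow> norm z \<le> s \<Longrightarrow> \<bar>force_commutator \<eta> e z\<bar> \<le> \<omega>"
    and trans: "\<And>z. norm z \<le> s \<Longrightarrow> \<bar>transport_commutator \<eta> z\<bar> \<le> \<omega>"
    and e0: "e0 \<in> Basis" and R0: "R0 + lam \<le> R"
  shows "(exp (- R0 / lam) / (exp (- R0 / lam) + C)) ^ 3 / (4 * lam * exp (M / lam))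
      * (\<integral>z. indicator {z. energy z \<le> R0} z * (maxwell_defect \<eta> e0 z)\<^sup>2 \<partial>lborel)
    \<le> measure lborel (cball (0::'a\<times>'a) s)
      * (DIM('a) * (2 * s\<^sup>2 * exp (- R / lam) / lam + 2 * \<omega>\<^sup>2 * exp (R / lam) / lam + 2 * s * \<omega> / lam) + \<omega>)"
proof -
  note \<eta> = unit_bumpD[OF k]
  define u where "u = convolution \<rho> \<eta>"
  define du where "du v = convolution \<rho> (ddir v \<eta>)" for v
  define flux where "flux e z = convolution (\<lambda>z. \<rho> z * drift e z) \<eta> z + lam * du (0, e) z - (b (fst z) \<bullet> e) * u z" for e z
  define dflux where "dflux e z = convolution (\<lambda>z. \<rho> z * drift e z) (ddir (0, e) \<eta>) z
      + lam * convolution \<rho> (ddir (0, e) (ddir (0, e) \<eta>)) z - (b (fst z) \<bullet> e) * du (0, e) z" for e z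
  define P where "P z = cutoff lam R (energy z)" for z
  define y where "y z = exp ((energy z - R) / lam)" for z
  define G where "G z = exp (- energy z / lam)" for z
  define m where "m z = gibbs_ratio lam (energy z) (u z)" for z
  define g where "g z = entropy_multiplier lam R (energy z) (u z)" for z
  define S where "S z = entropy_density lam R (energy z) (u z)" for z
  define dg where "dg e z = 2 * P z * (y z / lam) * (m z)\<^sup>2 * (snd z \<bullet> e)
     + 2 * (P z)\<^sup>2 * m z * (G z / (G z + u z)\<^sup>2) * (u z * (snd z \<bullet> e) / lam + du (0, e) z)" for e z
  define A where "A z = - (2 * P z * (y z / lam) * G z * m z) - (P z)\<^sup>2 * G z * m z / lam + g z * u z / lam" for z
  define K where "K e z = maxwell_defect \<eta> e z" for e z
  have K: "K e z = lam * du (0, e) z + (snd z \<bullet> e) * u z" for e z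
    by (simp add: K_def maxwell_defect_def u_def du_def)
  have u: "0 \<le> u z" "u z \<le> C" for z
    unfolding u_def by (rule convolution_rho_bounds[OF k])+
  have G: "G z > 0" for z by (simp add: G_def)
  have Gu: "G z + u z > 0" for z using G[of z] u(1)[of z] by linarith
  have m_eq: "m z = G z / (G z + u z)" for z by (simp add: m_def gibbs_ratio_def G_def)
  have m: "0 \<le> m z" "m z \<le> 1" for z
    unfolding m_eq using G[of z] u(1)[of z] by (auto simp: divide_le_eq)
  have P: "0 \<le> P z" "P z \<le> 1" for z by (auto simp: P_def cutoff_def)
  have y: "0 < y z" for z by (simp add: y_def)
  have g_eq: "g z = - (P z)\<^sup>2 * (m z)\<^sup>2" for z
    by (simp add: g_def entropy_multiplier_def pos_sq_def P_def cutoff_def m_def)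
  have S_eq: "S z = (P z)\<^sup>2 * G z * m z" for z
    by (simp add: S_def entropy_density_def pos_sq_def P_def cutoff_def m_def G_def)
  have P0: "P z = 0" if "R \<le> energy z" for z
    using that lam_pos by (simp add: P_def cutoff_def)
  have far: "R < energy z" if "s < norm z" for z
  proof -
    have "s\<^sup>2 < (norm z)\<^sup>2" using that s by (intro power_strict_mono) auto
    then show ?thesis using energy_lower[of z] R by linarith
  qed
  have du_line: "((\<lambda>t. u (z + t *\<^sub>R v)) has_real_derivative du v z) (at 0)" for z v
    unfolding u_def du_def by (rule convolution_line_derivative[OF rho_locally_integrable \<eta>(1)])
  have cu: "continuous_on UNIV u" unfolding u_def by (rule convolution_continuous[OF rho_locally_integrable \<eta>(1)])
  have cdu: "continuous_on UNIV (du v)" for v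
    unfolding du_def by (rule convolution_continuous[OF rho_locally_integrable test_function_ddir[OF \<eta>(1)]])
  have cP: "continuous_on UNIV P" unfolding P_def cutoff_def
    by (intro continuous_intros energy_cont) (use lam_pos in auto)
  have cy: "continuous_on UNIV y" unfolding y_def
    by (intro continuous_intros energy_cont) (use lam_pos in auto)
  have cG: "continuous_on UNIV G" unfolding G_def
    by (intro continuous_intros energy_cont) (use lam_pos in auto)
  have cm: "continuous_on UNIV m" unfolding m_eq[abs_def]
    by (intro continuous_intros cG cu) (use Gu less_imp_neq in metis)
  have cg: "continuous_on UNIV g" unfolding g_eq[abs_def] by (intro continuous_intros cP cm)
  have cS: "continuous_on UNIV S" unfolding S_eq[abs_def] by (intro continuous_intros cP cm cG)
  have cA: "continuous_on UNIV A" unfolding A_def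
    by (intro continuous_intros cP cm cG cy cg cu) (use lam_pos in auto)
  have cdg: "continuous_on UNIV (dg e)" for e unfolding dg_def
    by (intro continuous_intros cP cm cG cy cg cu cdu)
      (use lam_pos Gu less_imp_neq in \<open>auto simp: less_imp_neq[symmetric]\<close>)
  have cflux: "continuous_on UNIV (flux e)" for e unfolding flux_def
    by (intro continuous_intros cdu cu b_compose_cont convolution_continuous rho_drift_locally_integrable \<eta>(1))
  have cdflux: "continuous_on UNIV (dflux e)" for e unfolding dflux_def
    by (intro continuous_intros cdu b_compose_cont convolution_continuous rho_locally_integrable rho_drift_locally_integrable test_function_ddir \<eta>(1))
  have z00: "z + (0, 0) = z" for z :: "'a \<times> 'a" by (simp add: prod_eq_iff)
  have dg_line: "((\<lambda>t. g (z + t *\<^sub>R (0, e))) has_real_derivative dg e z) (at 0)" for z e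
  proof -
    note d = entropy_multiplier_has_derivative[OF lam_pos energy_line_derivative[of z "(0, e)"] du_line[of z "(0, e)"], of R]
    show ?thesis unfolding g_def
      by (rule DERIV_cong[OF d]) (use u in \<open>simp_all add: z00 dg_def P_def y_def m_def G_def\<close>)
  qed
  have dS_line: "((\<lambda>t. S (z + t *\<^sub>R v)) has_real_derivative
      A z * (b (fst z) \<bullet> fst v + snd z \<bullet> snd v) + g z * du v z) (at 0)" for z v
  proof -
    note d = entropy_density_has_derivative[OF lam_pos energy_line_derivative[of z v] du_line[of z v], of R]
    show ?thesis unfolding S_def
      by (rule DERIV_cong[OF d]) (use u in \<open>simp_all add: z00 A_def P_def y_def m_def G_def g_def\<close>)
  qed
  have dflux_line: "((\<lambda>t. flux e (z + t *\<^sub>R (0, e))) has_real_derivative dflux e z) (at 0)" for z e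
    unfolding flux_def dflux_def du_def u_def
    using convolution_line_derivative[OF rho_drift_locally_integrable \<eta>(1), of e z "(0, e)"]
      convolution_line_derivative[OF rho_locally_integrable test_function_ddir[OF \<eta>(1)], of "(0, e)" z "(0, e)"]
      convolution_line_derivative[OF rho_locally_integrable \<eta>(1), of z "(0, e)"]
    by (auto intro!: derivative_eq_intros)
  \<comment> \<open>Three families of directional derivatives of compactly supported functions; in the last two, the prefactor is constant along the direction of differentiation.\<close>
  define I1 where "I1 e z = dg e z * flux e z + g z * dflux e z" for e z
  define I2 where "I2 e z = (snd z \<bullet> e) * (A z * (b (fst z) \<bullet> e) + g z * du (e, 0) z)" for e z
  define I3 where "I3 e z = (b (fst z) \<bullet> e) * (A z * (snd z \<bullet> e) + g z * du (0, e) z)" for e z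
  have zeroP: "P z = 0" if "s < norm z" for z using P0 far[OF that] by simp
  have I1: "integrable lborel (I1 e)" "(\<integral>z. I1 e z \<partial>lborel) = 0" for e
  proof -
    have d: "((\<lambda>t. g (z + t *\<^sub>R (0, e)) * flux e (z + t *\<^sub>R (0, e))) has_real_derivative I1 e z) (at 0)" for z
      using DERIV_mult[OF dg_line[where z=z and e=e] dflux_line[where z=z and e=e]] by (simp add: z00 I1_def mult_ac add_ac)
    have c: "continuous_on UNIV (\<lambda>z. g z * flux e z)" "continuous_on UNIV (I1 e)"
      unfolding I1_def by (intro continuous_intros cg cflux cdg cdflux)+
    have z: "g z * flux e z = 0" if "s < norm z" for z using zeroP[OF that] by (simp add: g_eq)
    show "integrable lborel (I1 e)" "(\<integral>z. I1 e z \<partial>lborel) = 0"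
      using integral_line_derivative[OF d c z] by blast+
  qed
  have I2: "integrable lborel (I2 e)" "(\<integral>z. I2 e z \<partial>lborel) = 0" for e
  proof -
    have d: "((\<lambda>t. (snd (z + t *\<^sub>R (e, 0)) \<bullet> e) * S (z + t *\<^sub>R (e, 0))) has_real_derivative I2 e z) (at 0)" for z
      using DERIV_cmult[OF dS_line[of z "(e, 0)"], of "snd z \<bullet> e"] by (simp add: I2_def)
    have c: "continuous_on UNIV (\<lambda>z. (snd z \<bullet> e) * S z)" "continuous_on UNIV (I2 e)"
      unfolding I2_def by (intro continuous_intros cg cS cA cdu b_compose_cont)+
    have z: "(snd z \<bullet> e) * S z = 0" if "s < norm z" for z using zeroP[OF that] by (simp add: S_eq)
    show "integrable lborel (I2 e)" "(\<integral>z. I2 e z \<partial>lborel) = 0"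
      using integral_line_derivative[OF d c z] by blast+
  qed
  have I3: "integrable lborel (I3 e)" "(\<integral>z. I3 e z \<partial>lborel) = 0" for e
  proof -
    have d: "((\<lambda>t. (b (fst (z + t *\<^sub>R (0, e))) \<bullet> e) * S (z + t *\<^sub>R (0, e))) has_real_derivative I3 e z) (at 0)" for z
      using DERIV_cmult[OF dS_line[of z "(0, e)"], of "b (fst z) \<bullet> e"] by (simp add: I3_def)
    have c: "continuous_on UNIV (\<lambda>z. (b (fst z) \<bullet> e) * S z)" "continuous_on UNIV (I3 e)"
      unfolding I3_def by (intro continuous_intros cg cS cA cdu b_compose_cont)+
    have z: "(b (fst z) \<bullet> e) * S z = 0" if "s < norm z" for z using zeroP[OF that] by (simp add: S_eq)
    show "integrable lborel (I3 e)" "(\<integral>z. I3 e z \<partial>lborel) = 0"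
      using integral_line_derivative[OF d c z] by blast+
  qed
  define Div where "Div z = (\<Sum>e\<in>Basis. I1 e z - I2 e z + I3 e z)" for z
  have Div: "integrable lborel Div" "(\<integral>z. Div z \<partial>lborel) = 0"
    unfolding Div_def using I1 I2 I3 by (simp_all add: Bochner_Integration.integral_sum)
  have pde: "(\<Sum>e\<in>Basis. dflux e z - (snd z \<bullet> e) * du (e, 0) z + (b (fst z) \<bullet> e) * du (0, e) z)
      = - transport_commutator \<eta> z" for z
  proof -
    have "(\<Sum>e\<in>Basis. dflux e z - (snd z \<bullet> e) * du (e, 0) z + (b (fst z) \<bullet> e) * du (0, e) z)
       + transport_commutator \<eta> z = 0"
      using stationary_convolution[OF \<eta>(1), of z]
      unfolding transport_commutator_def dflux_def du_def sum.distrib[symmetric]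
      by (simp add: algebra_simps)
    then show ?thesis by linarith
  qed
  \<comment> \<open>The terms with the coefficient \<open>A\<close> cancel in the sum: the Hamiltonian vector field is tangent to the level sets of the energy.\<close>
  have Div_eq: "Div z = (\<Sum>e\<in>Basis. dg e z * flux e z) - g z * transport_commutator \<eta> z" for z
  proof -
    have "Div z = (\<Sum>e\<in>Basis. dg e z * flux e z + g z * (dflux e z - (snd z \<bullet> e) * du (e, 0) z + (b (fst z) \<bullet> e) * du (0, e) z))"
      unfolding Div_def by (rule sum.cong) (simp_all add: I1_def I2_def I3_def algebra_simps)
    also have "\<dots> = (\<Sum>e\<in>Basis. dg e z * flux e z) + g z * (- transport_commutator \<eta> z)"
      unfolding pde[symmetric] sum_distrib_left by (rule sum.distrib)
    finally show ?thesis by simp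
  qed
  have flux_eq: "flux e z = K e z - force_commutator \<eta> e z" for e z
    by (simp add: flux_def K force_commutator_def drift_def u_def inner_add_left algebra_simps)
  \<comment> \<open>The gradient of the multiplier is expressed through the Maxwell defect, since \<open>lam \<nabla>\<^sub>p (u/G) = K / G\<close>.\<close>
  have dg_eq: "dg e z = 2 * P z * (m z)\<^sup>2 * (y z / lam) * (snd z \<bullet> e) + 2 * (P z)\<^sup>2 * m z ^ 3 * K e z / (lam * G z)" for e z
  proof -
    have "G z / (G z + u z)\<^sup>2 = (m z)\<^sup>2 / G z"
      unfolding m_eq using G[of z] by (simp add: power2_eq_square)
    moreover have "u z * (snd z \<bullet> e) / lam + du (0, e) z = K e z / lam"
      unfolding K using lam_pos by (simp add: field_simps)
    ultimately show ?thesis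
      by (simp add: dg_def power2_eq_square power3_eq_cube mult_ac)
  qed
  define E where "E = 2 * s\<^sup>2 * exp (- R / lam) / lam + 2 * \<omega>\<^sup>2 * exp (R / lam) / lam + 2 * s * \<omega> / lam"
  have E: "E \<ge> 0" using lam_pos s \<omega> by (simp add: E_def)
  have lower: "(P z)\<^sup>2 * m z ^ 3 * (K e0 z)\<^sup>2 / (lam * G z) \<le> Div z + indicator (cball 0 s) z * (DIM('a) * E + \<omega>)" for z
  proof (cases "energy z < R")
    case False
    then have "P z = 0" using P0 by simp
    then have "Div z = 0" by (simp add: Div_eq dg_eq g_eq)
    with \<open>P z = 0\<close> show ?thesis using E \<omega> by (simp add: indicator_def)
  next
    case True
    have zs: "norm z \<le> s" using far[of z] True by linarith
    have y1: "y z \<le> 1" using True lam_pos by (simp add: y_def divide_le_0_iff)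
    have each: "(P z)\<^sup>2 * m z ^ 3 * (K e z)\<^sup>2 / (lam * G z) - E \<le> dg e z * flux e z" if e: "e \<in> Basis" for e
    proof -
      let ?F = "force_commutator \<eta> e z" and ?p = "snd z \<bullet> e"
      have p: "\<bar>?p\<bar> \<le> s" using Basis_le_norm[OF e, of "snd z"] norm_snd_le[of "snd z" "fst z"] zs
        by simp
      have F: "\<bar>?F\<bar> \<le> \<omega>" by (rule force[OF e zs])
      have p2: "?p\<^sup>2 \<le> s\<^sup>2" using p by (metis abs_le_square_iff abs_of_pos s)
      have F2: "?F\<^sup>2 \<le> \<omega>\<^sup>2" using F \<omega> by (metis abs_le_square_iff abs_of_nonneg)
      \<comment> \<open>This is where the exponential shape of the cutoff pays off: the bound does not depend on the energy of the point.\<close>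
      have yG: "(y z)\<^sup>2 * G z \<le> exp (- R / lam)"
      proof -
        have "(y z)\<^sup>2 * G z = exp ((energy z - 2 * R) / lam)"
          unfolding y_def G_def exp_double[symmetric] exp_add[symmetric]
          using lam_pos by (simp add: field_simps flip: exp_add)
        also have "\<dots> \<le> exp (- R / lam)"
          unfolding exp_le_cancel_iff using True lam_pos by (intro divide_right_mono) auto
        finally show ?thesis .
      qed
      have "1 / G z = exp (energy z / lam)" by (simp add: G_def exp_minus field_simps)
      also have "\<dots> \<le> exp (R / lam)" using True lam_pos by (simp add: divide_right_mono)
      finally have invG: "1 / G z \<le> exp (R / lam)" .
      have 1: "2 * (y z)\<^sup>2 * ?p\<^sup>2 * G z / lam \<le> 2 * s\<^sup>2 * exp (- R / lam) / lam"
      proof -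
        have "?p\<^sup>2 * ((y z)\<^sup>2 * G z) \<le> s\<^sup>2 * exp (- R / lam)"
          using p2 yG G[of z] by (intro mult_mono) auto
        then show ?thesis using lam_pos by (simp add: divide_right_mono mult_ac)
      qed
      have 2: "2 * ?F\<^sup>2 / (lam * G z) \<le> 2 * \<omega>\<^sup>2 * exp (R / lam) / lam"
      proof -
        have "?F\<^sup>2 * (1 / G z) \<le> \<omega>\<^sup>2 * exp (R / lam)"
          using F2 invG G[of z] by (intro mult_mono) auto
        from divide_right_mono[OF this, of lam] show ?thesis using lam_pos by (simp add: mult_ac)
      qed
      have 3: "2 * \<bar>?p\<bar> * \<bar>?F\<bar> / lam \<le> 2 * s * \<omega> / lam"
      proof -
        have "\<bar>?p\<bar> * \<bar>?F\<bar> \<le> s * \<omega>" using p F s by (intro mult_mono) auto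
        then show ?thesis using lam_pos by (simp add: divide_right_mono)
      qed
      have "(P z)\<^sup>2 * m z ^ 3 * (K e z)\<^sup>2 / (lam * G z) - 2 * (y z)\<^sup>2 * ?p\<^sup>2 * G z / lam - 2 * ?F\<^sup>2 / (lam * G z) - 2 * \<bar>?p\<bar> * \<bar>?F\<bar> / lam
          \<le> dg e z * flux e z"
        unfolding dg_eq flux_eq
        by (rule dissipation_inequality[OF P m G lam_pos less_imp_le[OF y] y1])
      with 1 2 3 show ?thesis unfolding E_def by linarith
    qed
    have "(P z)\<^sup>2 * m z ^ 3 * (K e0 z)\<^sup>2 / (lam * G z) \<le> (\<Sum>e\<in>Basis. (P z)\<^sup>2 * m z ^ 3 * (K e z)\<^sup>2 / (lam * G z))"
      by (rule member_le_sum[OF e0, of "\<lambda>e. (P z)\<^sup>2 * m z ^ 3 * (K e z)\<^sup>2 / (lam * G z)"])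
        (use m[of z] G[of z] lam_pos in auto)
    also have "\<dots> \<le> (\<Sum>e\<in>Basis. dg e z * flux e z + E)"
      using each by (intro sum_mono) (simp add: algebra_simps)
    also have "\<dots> = Div z + DIM('a) * E + g z * transport_commutator \<eta> z"
      unfolding Div_eq by (simp add: sum.distrib)
    also have "g z * transport_commutator \<eta> z \<le> \<omega>"
    proof -
      have "\<bar>g z\<bar> \<le> 1" unfolding g_eq using P[of z] m[of z]
        by (auto simp: abs_mult intro!: mult_le_one power_le_one)
      then have "\<bar>g z\<bar> * \<bar>transport_commutator \<eta> z\<bar> \<le> 1 * \<omega>"
        by (intro mult_mono trans[OF zs]) auto
      then show ?thesis by (simp add: abs_mult[symmetric])
    qed
    finally show ?thesis using zs by simp
  qed
  define m0 where "m0 = exp (- R0 / lam) / (exp (- R0 / lam) + C)"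
  define \<kappa> where "\<kappa> = m0 ^ 3 / (4 * lam * exp (M / lam))"
  have m0: "m0 > 0" using C_pos by (simp add: m0_def add_pos_pos)
  have \<kappa>: "\<kappa> > 0" using m0 lam_pos by (simp add: \<kappa>_def)
  have coercive: "\<kappa> * (indicator {z. energy z \<le> R0} z * (K e0 z)\<^sup>2) \<le> (P z)\<^sup>2 * m z ^ 3 * (K e0 z)\<^sup>2 / (lam * G z)" for z
  proof (cases "energy z \<le> R0")
    case False
    then show ?thesis using m[of z] G[of z] lam_pos by simp
  next
    case True
    have G0: "exp (- R0 / lam) \<le> G z" using True lam_pos by (simp add: G_def divide_right_mono)
    have "- M \<le> energy z" using energy_lower[of z] zero_le_power2[of "norm z"] by linarith
    then have GM: "G z \<le> exp (M / lam)"
      unfolding G_def exp_le_cancel_iff using lam_pos by (intro divide_right_mono) auto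
    have "(energy z - R) / lam \<le> -1" using True R0 lam_pos by (simp add: divide_le_eq)
    then have "y z \<le> exp (-1)" by (simp add: y_def)
    also have "exp (-1) \<le> (1/2::real)"
      using exp_ge_add_one_self[of "1::real"] by (simp add: exp_minus field_simps)
    finally have "1 / 2 \<le> P z" unfolding P_def cutoff_def y_def by linarith
    then have P2: "1 / 4 \<le> (P z)\<^sup>2" using power_mono[of "1/2" "P z" 2] by (simp add: power2_eq_square)
    have "m0 \<le> m z"
    proof -
      have "exp (- R0 / lam) * (G z + u z) \<le> G z * (exp (- R0 / lam) + C)"
        using mult_mono[OF G0 u(2)[of z]] u(1)[of z] G[of z] by (simp add: algebra_simps)
      then show ?thesis
        unfolding m0_def m_eq using Gu[of z] C_pos
        by (simp add: divide_le_eq le_divide_eq add_pos_pos mult_ac)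
    qed
    then have m3: "m0 ^ 3 \<le> m z ^ 3" using m0 by (intro power_mono) auto
    have "\<kappa> = (1 / 4 * m0 ^ 3) / (lam * exp (M / lam))" by (simp add: \<kappa>_def)
    also have "\<dots> \<le> ((P z)\<^sup>2 * m z ^ 3) / (lam * G z)"
      using P2 m3 m0 GM G[of z] lam_pos m[of z] by (intro frac_le mult_mono mult_left_mono) auto
    finally have "\<kappa> * (K e0 z)\<^sup>2 \<le> ((P z)\<^sup>2 * m z ^ 3) / (lam * G z) * (K e0 z)\<^sup>2"
      by (intro mult_right_mono) auto
    then show ?thesis using True by simp
  qed
  have cK: "continuous_on A (K e0)" for A unfolding K_def by (rule maxwell_defect_cont[OF \<eta>(1)])
  have intK: "integrable lborel (\<lambda>z. indicator {z. energy z \<le> R0} z * (K e0 z)\<^sup>2)"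
    using borel_integrable_compact[OF energy_sublevel_compact[of R0], of "\<lambda>z. (K e0 z)\<^sup>2"] by (simp add: cK continuous_on_power)
  have intB: "integrable lborel (\<lambda>z::'a\<times>'a. indicator (cball 0 s) z * (DIM('a) * E + \<omega>))"
    by (intro integrable_mult_left) (auto intro!: emeasure_bounded_finite)
  have "\<kappa> * (\<integral>z. indicator {z. energy z \<le> R0} z * (K e0 z)\<^sup>2 \<partial>lborel)
      = (\<integral>z. \<kappa> * (indicator {z. energy z \<le> R0} z * (K e0 z)\<^sup>2) \<partial>lborel)" by simp
  also have "\<dots> \<le> (\<integral>z. Div z + indicator (cball 0 s) z * (DIM('a) * E + \<omega>) \<partial>lborel)"
  proof (rule integral_mono)
    show "\<kappa> * (indicator {z. energy z \<le> R0} z * (K e0 z)\<^sup>2) \<le> Div z + indicator (cball 0 s) z * (DIM('a) * E + \<omega>)" for z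
      using coercive[of z] lower[of z] by linarith
  qed (use intK Div(1) intB in auto)
  also have "\<dots> = measure lborel (cball (0::'a\<times>'a) s) * (DIM('a) * E + \<omega>)"
    using Div intB by simp
  finally show ?thesis by (simp add: \<kappa>_def m0_def K_def E_def)
qed

lemma drift_uniform:
  assumes "\<omega> > 0"
  obtains d where "d > 0" "\<And>e z z'. e \<in> Basis \<Longrightarrow> norm z \<le> s \<Longrightarrow> norm (z - z') \<le> d \<Longrightarrow>
     \<bar>drift e z - drift e z'\<bar> \<le> \<omega>"
proof -
  define D where "D z = b (fst z) + snd z" for z
  have "uniformly_continuous_on (cball 0 (s + 1)) D"
    unfolding D_def
    by (intro compact_uniformly_continuous continuous_intros b_compose_cont) auto
  then obtain d where d: "d > 0" "\<And>x y. x \<in> cball 0 (s+1) \<Longrightarrow> y \<in> cball 0 (s+1) \<Longrightarrow> dist y x < d \<Longrightarrow> dist (D y) (D x) < \<omega>"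
    unfolding uniformly_continuous_on_def using assms by metis
  have "\<bar>drift e z - drift e z'\<bar> \<le> \<omega>"
    if e: "e \<in> Basis" and z: "norm z \<le> s" "norm (z - z') \<le> min (d/2) 1" for e z z'
  proof -
    have "norm z' \<le> s + 1" using z norm_triangle_ineq2[of z' z] by (simp add: norm_minus_commute)
    then have "dist (D z) (D z') < \<omega>" using d(1) z by (intro d(2)) (auto simp: dist_norm)
    then have "norm (D z - D z') \<le> \<omega>" by (simp add: dist_norm)
    moreover have "drift e z - drift e z' = (D z - D z') \<bullet> e"
      by (simp add: drift_def D_def inner_diff_left)
    ultimately show ?thesis using Basis_le_norm[OF e, of "D z - D z'"] by linarith
  qed
  then show ?thesis using that[of "min (d/2) 1"] d(1) by auto
qed

text \<open>
  In the preceding bound choose the radius \<open>s\<close> first, to make the cutoff error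
  small, and only then the mollifier, to make the commutators small; the constant on the left is
  fixed throughout.
\<close>

lemma maxwell_defect_vanishes:
  assumes e0: "e0 \<in> Basis" and \<epsilon>: "\<epsilon> > 0"
  shows "\<exists>\<tau>0>0. \<forall>\<tau> \<eta>. kinetic_mollifier \<tau> \<eta> \<longrightarrow> \<tau> \<le> \<tau>0 \<longrightarrow>
     (\<integral>z. indicator {z. energy z \<le> R0} z * (maxwell_defect \<eta> e0 z)\<^sup>2 \<partial>lborel) \<le> \<epsilon>"
proof -
  let ?n = "DIM('a \<times> 'a)"
  define vol where "vol s = measure lborel (cball (0::'a\<times>'a) s)" for s
  define \<kappa> where "\<kappa> = (exp (- R0 / lam) / (exp (- R0 / lam) + C)) ^ 3 / (4 * lam * exp (M / lam))"
  have \<kappa>: "\<kappa> > 0" using lam_pos C_pos by (simp add: \<kappa>_def add_pos_pos)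
  define T where "T s = vol s * (DIM('a) * (2 * s\<^sup>2 * exp (- (s\<^sup>2 / 2 - M) / lam) / lam))" for s
  have T_lim: "(T \<longlongrightarrow> 0) at_top"
  proof -
    have "((\<lambda>s. unit_ball_vol ?n * (DIM('a) * (2 * exp (M / lam) / lam)) * (s ^ (?n + 2) * exp (- (s\<^sup>2 / (2 * lam)))))
        \<longlongrightarrow> unit_ball_vol ?n * (DIM('a) * (2 * exp (M / lam) / lam)) * 0) at_top"
      using lam_pos by (intro tendsto_intros power_times_gaussian_tendsto_0) auto
    moreover have "\<forall>\<^sub>F s in at_top. unit_ball_vol ?n * (DIM('a) * (2 * exp (M / lam) / lam)) * (s ^ (?n + 2) * exp (- (s\<^sup>2 / (2 * lam)))) = T s"
      using eventually_ge_at_top[of 0]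
    proof eventually_elim
      case (elim s)
      have "exp (- (s\<^sup>2 / 2 - M) / lam) = exp (M / lam) * exp (- (s\<^sup>2 / (2 * lam)))"
        unfolding exp_add[symmetric] using lam_pos by (intro arg_cong[where f=exp]) (simp add: field_simps)
      then show ?case
        using elim unfolding T_def vol_def content_cball[OF elim] power_add by (simp add: mult_ac)
    qed
    ultimately show ?thesis by (auto intro: Lim_transform_eventually)
  qed
  have "\<forall>\<^sub>F s in at_top. T s < \<kappa> * \<epsilon> / 2"
    using order_tendstoD(2)[OF T_lim, of "\<kappa> * \<epsilon> / 2"] \<kappa> \<epsilon> by simp
  moreover have "\<forall>\<^sub>F s::real in at_top. R0 + lam + M + 1 < s\<^sup>2 / 2"
  proof -
    have "filterlim (\<lambda>s::real. s\<^sup>2 * (1/2)) at_top at_top"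
      by (intro filterlim_at_top_mult_tendsto_pos[OF tendsto_const] filterlim_pow_at_top filterlim_ident) auto
    then show ?thesis unfolding filterlim_at_top_dense by (auto dest: spec[of _ "R0 + lam + M + 1"])
  qed
  ultimately have "\<forall>\<^sub>F s in at_top. s > 0 \<and> T s < \<kappa> * \<epsilon> / 2 \<and> R0 + lam + M + 1 < s\<^sup>2 / 2"
    using eventually_gt_at_top[of "0::real"] by eventually_elim auto
  then obtain s where s: "s > 0" "T s < \<kappa> * \<epsilon> / 2" "R0 + lam + M + 1 < s\<^sup>2 / 2"
    using eventually_happens'[OF trivial_limit_at_top_linorder] by blast
  define R where "R = s\<^sup>2 / 2 - M"
  define U where "U \<omega> = vol s * (DIM('a) * (2 * \<omega>\<^sup>2 * exp (R / lam) / lam + 2 * s * \<omega> / lam) + \<omega>)" for \<omega>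
  have "(U \<longlongrightarrow> U 0) (at_right 0)"
    unfolding U_def using lam_pos by (intro tendsto_intros) auto
  then have "\<forall>\<^sub>F \<omega> in at_right 0. U \<omega> < \<kappa> * \<epsilon> / 2"
    using order_tendstoD(2)[of U "U 0"  "at_right 0" "\<kappa> * \<epsilon> / 2"] \<kappa> \<epsilon> by (simp add: U_def)
  then have "\<forall>\<^sub>F \<omega> in at_right 0. 0 < \<omega> \<and> U \<omega> < \<kappa> * \<epsilon> / 2"
    using eventually_at_right_less[of 0] by eventually_elim auto
  then obtain \<omega> where \<omega>: "\<omega> > 0" "U \<omega> < \<kappa> * \<epsilon> / 2"
    using eventually_happens'[OF trivial_limit_at_right_real] by blast
  have "\<omega> / C > 0" using \<omega> C_pos by simp
  then obtain d where d: "d > 0" "\<And>e z z'. e \<in> Basis \<Longrightarrow> norm z \<le> s \<Longrightarrow> norm (z - z') \<le> d \<Longrightarrow>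
     \<bar>drift e z - drift e z'\<bar> \<le> \<omega> / C"
    using drift_uniform[where s=s] by blast
  define \<tau>0 where "\<tau>0 = min d (\<omega> / (DIM('a) * C))"
  have \<tau>0: "\<tau>0 > 0" using d \<omega> C_pos by (simp add: \<tau>0_def)
  have "(\<integral>z. indicator {z. energy z \<le> R0} z * (maxwell_defect \<eta> e0 z)\<^sup>2 \<partial>lborel) \<le> \<epsilon>"
    if k: "kinetic_mollifier \<tau> \<eta>" and \<tau>: "\<tau> \<le> \<tau>0" for \<tau> \<eta>
  proof -
    have k1: "unit_bump \<tau> \<eta>" using k by (simp add: kinetic_mollifier_def)
    have force: "\<bar>force_commutator \<eta> e z\<bar> \<le> \<omega>" if "e \<in> Basis" "norm z \<le> s" for e z
    proof -
      have "\<bar>force_commutator \<eta> e z\<bar> \<le> C * (\<omega> / C)"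
        by (rule force_commutator_bound[OF k1 d(2)[OF that]]) (use \<tau> in \<open>simp add: \<tau>0_def\<close>)
      then show ?thesis using C_pos by simp
    qed
    have trans: "\<bar>transport_commutator \<eta> z\<bar> \<le> \<omega>" for z
    proof -
      have "\<bar>transport_commutator \<eta> z\<bar> \<le> DIM('a) * (C * \<tau>)" by (rule transport_commutator_bound[OF k])
      also have "\<dots> \<le> DIM('a) * (C * (\<omega> / (DIM('a) * C)))"
        using \<tau> C_pos by (intro mult_left_mono) (auto simp: \<tau>0_def)
      also have "\<dots> = \<omega>" using C_pos by simp
      finally show ?thesis .
    qed
    have "\<kappa> * (\<integral>z. indicator {z. energy z \<le> R0} z * (maxwell_defect \<eta> e0 z)\<^sup>2 \<partial>lborel)
       \<le> vol s * (DIM('a) * (2 * s\<^sup>2 * exp (- R / lam) / lam + 2 * \<omega>\<^sup>2 * exp (R / lam) / lam + 2 * s * \<omega> / lam) + \<omega>)"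
      unfolding \<kappa>_def vol_def
      by (rule dissipation_bound[OF k1 s(1) R_def _ force trans e0]) (use \<omega> s(3) in \<open>auto simp: R_def\<close>)
    also have "\<dots> = T s + U \<omega>" by (simp add: T_def U_def R_def algebra_simps)
    also have "\<dots> \<le> \<kappa> * \<epsilon>" using s(2) \<omega>(2) by linarith
    finally show ?thesis using \<kappa> by simp
  qed
  then show ?thesis using \<tau>0 by blast
qed

text \<open>
  The weak form of \<open>lam \<nabla>\<^sub>p \<rho> + p \<rho> = 0\<close>. For the mollified
  density the left-hand side is the integral of the Maxwell defect against \<open>\<xi>\<close>,
  which tends to zero in \<open>L\<^sup>2\<close> on the support of \<open>\<xi>\<close>.
\<close>

theorem maxwell_identity:
  assumes \<xi>: "Ck 1 \<xi>" and zero: "\<And>z. r < norm z \<Longrightarrow> \<xi> z = 0" and e: "e \<in> Basis"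
  shows "(\<integral>z. \<rho> z * ((snd z \<bullet> e) * \<xi> z - lam * ddir (0, e) \<xi> z) \<partial>lborel) = 0"
proof -
  define f where "f z = (snd z \<bullet> e) * \<xi> z - lam * ddir (0, e) \<xi> z" for z
  have c\<xi>: "continuous_on UNIV \<xi>" using Ck_0[OF \<xi>] .
  have d\<xi>: "\<xi> differentiable (at z)" and cd\<xi>: "continuous_on UNIV (ddir v \<xi>)" for z v
    using \<xi> unfolding One_nat_def Ck.simps by blast+
  have zero': "ddir v \<xi> z = 0" if "r < norm z" for v z by (rule ddir_zero_outside[OF d\<xi> zero that])
  have cf: "continuous_on UNIV f" unfolding f_def by (intro continuous_intros c\<xi> cd\<xi>)
  have zf: "f z = 0" if "r < norm z" for z using that by (simp add: f_def zero zero')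
  have "bounded (energy ` cball 0 r)"
    by (intro compact_imp_bounded compact_continuous_image energy_cont) auto
  then obtain R0 where "\<And>x. x \<in> energy ` cball 0 r \<Longrightarrow> norm x \<le> R0"
    unfolding bounded_iff by blast
  then have "\<bar>energy z\<bar> \<le> R0" if "norm z \<le> r" for z using that by simp
  then have R0: "energy z \<le> R0" if "norm z \<le> r" for z using that abs_le_D1 by blast
  define N where "N = 1 + (\<integral>z. (\<xi> z)\<^sup>2 \<partial>lborel)"
  have N: "N > 0" unfolding N_def by (simp add: add_pos_nonneg)
  have int\<xi>: "integrable lborel (\<lambda>z. (\<xi> z)\<^sup>2)"
    by (rule compact_support_integrable[where r=r]) (auto intro!: continuous_intros c\<xi> simp: zero)
  have small: "\<bar>\<integral>z. \<rho> z * f z \<partial>lborel\<bar> \<le> \<epsilon>" if \<epsilon>: "\<epsilon> > 0" for \<epsilon>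
  proof -
    \<comment> \<open>The weight in \<open>\<bar>K \<xi>\<bar> \<le> a \<xi>\<^sup>2 + K\<^sup>2 / (4 a)\<close>; both parts will be at most \<open>\<epsilon> / 3\<close>.\<close>
    define a where "a = \<epsilon> / (3 * N)"
    have a: "a > 0" using \<epsilon> N by (simp add: a_def)
    have pos: "4 * a * (\<epsilon> / 3) > 0" using a \<epsilon> by simp
    obtain \<tau>1 where \<tau>1: "\<tau>1 > 0" "\<And>k s. unit_bump s k \<Longrightarrow> s \<le> \<tau>1 \<Longrightarrow>
       \<bar>(\<integral>z. convolution \<rho> k z * f z \<partial>lborel) - (\<integral>z. \<rho> z * f z \<partial>lborel)\<bar> \<le> \<epsilon> / 3"
      using convolution_tendsto_weakly[where e="\<epsilon> / 3" and r=r, OF rho_integrable cf zf] \<epsilon> by auto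
    obtain \<tau>2 where \<tau>2: "\<tau>2 > 0" "\<And>\<tau> \<eta>. kinetic_mollifier \<tau> \<eta> \<Longrightarrow> \<tau> \<le> \<tau>2 \<Longrightarrow>
       (\<integral>z. indicator {z. energy z \<le> R0} z * (maxwell_defect \<eta> e z)\<^sup>2 \<partial>lborel) \<le> 4 * a * (\<epsilon> / 3)"
      using maxwell_defect_vanishes[OF e pos, of R0] by blast
    obtain \<eta> :: "'a \<times> 'a \<Rightarrow> real" where k: "kinetic_mollifier (min \<tau>1 \<tau>2) \<eta>"
      using kinetic_mollifier_exists[of "min \<tau>1 \<tau>2"] \<tau>1 \<tau>2 by auto
    then have k1: "unit_bump (min \<tau>1 \<tau>2) \<eta>" by (simp add: kinetic_mollifier_def)
    note \<eta> = unit_bumpD[OF k1]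
    let ?K = "maxwell_defect \<eta> e" and ?u = "convolution \<rho> \<eta>"
    have C1: "Ck 1 (\<lambda>z. ?u z * \<xi> z)" by (intro Ck_mult Ck_convolution rho_locally_integrable \<eta>(1) \<xi>)
    have ddir_u\<xi>: "ddir (0, e) (\<lambda>z. ?u z * \<xi> z) z = ?u z * ddir (0, e) \<xi> z + convolution \<rho> (ddir (0, e) \<eta>) z * \<xi> z" for z
    proof -
      have "((\<lambda>z. ?u z * \<xi> z) has_derivative (\<lambda>v. ?u z * ddir v \<xi> z + convolution \<rho> (ddir v \<eta>) z * \<xi> z)) (at z)" for z
        by (intro has_derivative_mult convolution_has_derivative rho_locally_integrable \<eta>(1))
          (use d\<xi> in \<open>simp add: frechet_derivative_works\<close>)
      from fun_cong[OF ddir_eqI[OF this]] show ?thesis .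
    qed
    have ibp: "(\<integral>z. ?u z * ddir (0, e) \<xi> z + convolution \<rho> (ddir (0, e) \<eta>) z * \<xi> z \<partial>lborel) = 0"
      using integral_ddir_compact_support[OF C1, of r "(0, e)"] zero ddir_u\<xi> by simp
    have int1: "integrable lborel (\<lambda>z. ?u z * ddir (0, e) \<xi> z + convolution \<rho> (ddir (0, e) \<eta>) z * \<xi> z)"
      by (rule compact_support_integrable[where r=r])
         (auto intro!: continuous_intros c\<xi> cd\<xi> convolution_continuous rho_locally_integrable \<eta>(1) test_function_ddir simp: zero zero')
    have int2: "integrable lborel (\<lambda>z. ?K z * \<xi> z)"
      by (rule compact_support_integrable[where r=r])
         (auto intro!: continuous_intros c\<xi> maxwell_defect_cont \<eta>(1) simp: zero)
    have intK: "integrable lborel (\<lambda>z. indicator {z. energy z \<le> R0} z * (?K z)\<^sup>2)"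
      using borel_integrable_compact[OF energy_sublevel_compact[of R0], of "\<lambda>z. (?K z)\<^sup>2"]
      by (simp add: maxwell_defect_cont[OF \<eta>(1)] continuous_on_power)
    have "?u z * f z = ?K z * \<xi> z - lam * (?u z * ddir (0, e) \<xi> z + convolution \<rho> (ddir (0, e) \<eta>) z * \<xi> z)" for z
      by (simp add: f_def maxwell_defect_def algebra_simps)
    then have "(\<integral>z. ?u z * f z \<partial>lborel) = (\<integral>z. ?K z * \<xi> z \<partial>lborel)"
      using int1 int2 ibp by simp
    also have "\<bar>\<dots>\<bar> \<le> (\<integral>z. \<bar>?K z * \<xi> z\<bar> \<partial>lborel)" by (rule integral_abs_bound)
    also have "\<dots> \<le> (\<integral>z. a * (\<xi> z)\<^sup>2 + 1 / (4 * a) * (indicator {z. energy z \<le> R0} z * (?K z)\<^sup>2) \<partial>lborel)"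
    proof (rule integral_mono)
      show "integrable lborel (\<lambda>z. \<bar>?K z * \<xi> z\<bar>)" using int2 by simp
      show "integrable lborel (\<lambda>z. a * (\<xi> z)\<^sup>2 + 1 / (4 * a) * (indicator {z. energy z \<le> R0} z * (?K z)\<^sup>2))"
        using int\<xi> intK by (intro Bochner_Integration.integrable_add integrable_mult_right) auto
      show "\<bar>?K z * \<xi> z\<bar> \<le> a * (\<xi> z)\<^sup>2 + 1 / (4 * a) * (indicator {z. energy z \<le> R0} z * (?K z)\<^sup>2)" for z
      proof (cases "norm z \<le> r")
        case True
        have "0 \<le> (2 * a * \<bar>\<xi> z\<bar> - \<bar>?K z\<bar>)\<^sup>2 / (4 * a)" using a by simp
        also have "\<dots> = a * (\<xi> z)\<^sup>2 + 1 / (4 * a) * (?K z)\<^sup>2 - \<bar>?K z * \<xi> z\<bar>"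
          using a by (simp add: power2_diff power_mult_distrib abs_mult field_simps power2_eq_square)
        finally show ?thesis using R0[OF True] by simp
      next
        case False
        then show ?thesis using a zero[of z] by simp
      qed
    qed
    also have "\<dots> \<le> a * N + 1 / (4 * a) * (4 * a * (\<epsilon> / 3))"
    proof -
      have "(\<integral>z. a * (\<xi> z)\<^sup>2 + 1 / (4 * a) * (indicator {z. energy z \<le> R0} z * (?K z)\<^sup>2) \<partial>lborel)
        = a * (\<integral>z. (\<xi> z)\<^sup>2 \<partial>lborel) + 1 / (4 * a) * (\<integral>z. indicator {z. energy z \<le> R0} z * (?K z)\<^sup>2 \<partial>lborel)"
        using int\<xi> intK by simp
      moreover have "a * (\<integral>z. (\<xi> z)\<^sup>2 \<partial>lborel) \<le> a * N" using a by (simp add: N_def)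
      moreover have "1 / (4 * a) * (\<integral>z. indicator {z. energy z \<le> R0} z * (?K z)\<^sup>2 \<partial>lborel) \<le> 1 / (4 * a) * (4 * a * (\<epsilon> / 3))"
        using a \<tau>2(2)[OF k] by (intro mult_left_mono) auto
      ultimately show ?thesis by linarith
    qed
    also have "\<dots> = 2 * \<epsilon> / 3" using a N by (simp add: a_def)
    finally have "\<bar>\<integral>z. ?u z * f z \<partial>lborel\<bar> \<le> 2 * \<epsilon> / 3" .
    moreover have "\<bar>(\<integral>z. ?u z * f z \<partial>lborel) - (\<integral>z. \<rho> z * f z \<partial>lborel)\<bar> \<le> \<epsilon> / 3"
      by (rule \<tau>1(2)[OF k1]) simp
    ultimately show ?thesis by linarith
  qed
  have "\<bar>\<integral>z. \<rho> z * f z \<partial>lborel\<bar> \<le> 0"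
    by (rule field_le_epsilon) (use small in auto)
  then show ?thesis by (simp add: f_def)
qed

lemma rho_times_compact_integrable:
  assumes "continuous_on UNIV f" "\<And>z. r < norm z \<Longrightarrow> f z = 0"
  shows "integrable lborel (\<lambda>z. \<rho> z * f z)"
proof -
  obtain B where B: "\<And>x. \<bar>f x\<bar> \<le> B" using compact_support_bounded[OF assms] by blast
  show ?thesis
    by (rule integrable_locally_integrable_mult[OF rho_locally_integrable borel_measurable_continuous_onI[OF assms(1)] B assms(2)])
qed

section \<open>From the Maxwell identity to the diffusion\<close>

text \<open>
  By the Maxwell identity for the momentum gradient of \<open>f\<close>, friction and noise
  cancel in the stationary equation, and the Hamiltonian transport vanishes separately.
\<close>

lemma transport_identity:
  assumes f: "test_function f"
  shows "(\<integral>z. \<rho> z * (ddir (snd z, 0) f z - ddir (0, b (fst z)) f z) \<partial>lborel) = 0"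
proof -
  note sf = test_function_smooth[OF f]
  obtain r where r: "r > 0" "\<And>z. r < norm z \<Longrightarrow> f z = 0" using test_function_zero_outside[OF f] by blast
  have z1: "ddir v f z = 0" and z2: "ddir v (ddir w f) z = 0" if "r < norm z" for v w z
    using ddir_zero_outside[OF smooth_differentiable[OF sf] r(2)] that
      ddir_zero_outside[OF smooth_differentiable[OF smooth_ddir[OF sf]], of r w] by blast+
  define k where "k z = (\<Sum>e\<in>Basis. (snd z \<bullet> e) * ddir (0, e) f z - lam * ddir (0, e) (ddir (0, e) f) z)" for z
  define t where "t z = ddir (snd z, 0) f z - ddir (0, b (fst z)) f z" for z
  have c1: "continuous_on UNIV (ddir v f)" and c2: "continuous_on UNIV (ddir v (ddir w f))" for v w
    by (intro smooth_continuous smooth_ddir sf)+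
  have kz: "\<And>z. r < norm z \<Longrightarrow> k z = 0" by (simp add: k_def z1 z2)
  have tz: "\<And>z. r < norm z \<Longrightarrow> t z = 0" by (simp add: t_def z1)
  have ck: "continuous_on UNIV k" unfolding k_def by (intro continuous_intros c1 c2)
  have ct: "continuous_on UNIV t"
    unfolding t_def ddir_product_basis_sum(1)[OF sf, where x="snd _"] ddir_product_basis_sum(2)[OF sf, where x="b _"]
    by (intro continuous_intros c1 b_compose_cont)
  have intk: "integrable lborel (\<lambda>z. \<rho> z * k z)" by (rule rho_times_compact_integrable[OF ck kz])
  have intt: "integrable lborel (\<lambda>z. \<rho> z * t z)" by (rule rho_times_compact_integrable[OF ct tz])
  have inte: "integrable lborel (\<lambda>z. \<rho> z * ((snd z \<bullet> e) * ddir (0, e) f z - lam * ddir (0, e) (ddir (0, e) f) z))" for e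
    by (rule rho_times_compact_integrable[where r=r]) (auto intro!: continuous_intros c1 c2 simp: z1 z2)
  have "(\<integral>z. \<rho> z * k z \<partial>lborel)
     = (\<Sum>e\<in>Basis. \<integral>z. \<rho> z * ((snd z \<bullet> e) * ddir (0, e) f z - lam * ddir (0, e) (ddir (0, e) f) z) \<partial>lborel)"
    unfolding k_def sum_distrib_left by (rule Bochner_Integration.integral_sum) (rule inte)
  also have "\<dots> = 0"
    by (rule sum.neutral) (use maxwell_identity[OF smooth_Ck[OF smooth_ddir[OF sf]] z1] in blast)
  finally have k0: "(\<integral>z. \<rho> z * k z \<partial>lborel) = 0" .
  have "\<rho> z * (ddir (snd z, 0) f z - ddir (0, b (fst z) + snd z) f z
         + lam * (\<Sum>e\<in>Basis. ddir (0, e) (ddir (0, e) f) z)) = \<rho> z * t z - \<rho> z * k z" for z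
  proof -
    have "ddir (0, b (fst z) + snd z) f z = ddir (0, b (fst z)) f z + (\<Sum>e\<in>Basis. (snd z \<bullet> e) * ddir (0, e) f z)"
      using ddir_product_basis_sum(2)[OF sf, where x="b (fst z) + snd z" and z=z]
        ddir_product_basis_sum(2)[OF sf, where x="b (fst z)" and z=z]
      by (simp add: inner_add_left distrib_right sum.distrib)
    then show ?thesis by (simp add: t_def k_def sum_subtractf sum_distrib_left algebra_simps)
  qed
  with stationary[OF f] have "(\<integral>z. \<rho> z * t z - \<rho> z * k z \<partial>lborel) = 0" by simp
  then show ?thesis using k0 intk intt by (simp add: t_def)
qed

text \<open>
  Formally, test the transport with \<open>p \<cdot> \<nabla>\<phi>(q)\<close>: this gives
  \<open>\<integral> \<rho> (p \<cdot> D\<^sup>2\<phi> p - b \<cdot> \<nabla>\<phi>) = 0\<close>,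
  and the Maxwell identity replaces the quadratic form by \<open>lam \<Delta>\<phi>\<close>.
  With a truncation at momentum scale \<open>n\<close> the quadratic terms cancel before the
  limit is taken, and all remaining terms are \<open>\<rho>\<close> times bounded functions, so
  that a multiple of \<open>\<rho>\<close> dominates them.
\<close>

theorem diffusion_identity:
  assumes \<phi>: "test_function \<phi>"
  shows "(\<integral>z. \<rho> z * (lam * (\<Sum>e\<in>Basis. ddir e (ddir e \<phi>) (fst z)) - ddir (b (fst z)) \<phi> (fst z)) \<partial>lborel) = 0"
proof -
  note s\<phi> = test_function_smooth[OF \<phi>]
  obtain r where r: "r > 0" "\<And>x. r < norm x \<Longrightarrow> \<phi> x = 0" using test_function_zero_outside[OF \<phi>] by blast
  have z1: "ddir v \<phi> x = 0" and z2: "ddir v (ddir w \<phi>) x = 0" if "r < norm x" for v w x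
    using ddir_zero_outside[OF smooth_differentiable[OF s\<phi>] r(2)] that
      ddir_zero_outside[OF smooth_differentiable[OF smooth_ddir[OF s\<phi>]], of r w] by blast+
  have c1: "continuous_on UNIV (ddir v \<phi>)" and c2: "continuous_on UNIV (ddir v (ddir w \<phi>))" for v w
    by (intro smooth_continuous smooth_ddir s\<phi>)+
  obtain \<theta> :: "'a \<Rightarrow> real" where \<theta>: "test_function \<theta>" "\<theta> 0 > 0" "\<And>x. 1 < norm x \<Longrightarrow> \<theta> x = 0"
    using bump_function_exists[of 1] by (metis zero_less_one)
  note s\<theta> = test_function_smooth[OF \<theta>(1)]
  \<comment> \<open>The limit integrand, up to the factors \<open>\<rho>\<close> and \<open>\<theta> 0\<close>, and the coefficients of the error terms, which vanish at \<open>x = 0\<close> because of the factor \<open>x \<bullet> i\<close> in \<open>B\<close>.\<close>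
  define A0 where "A0 q = lam * (\<Sum>e\<in>Basis. ddir e (ddir e \<phi>) q) - ddir (b q) \<phi> q" for q
  define A where "A e i q = lam * ddir i (ddir e \<phi>) q - (b q \<bullet> e) * ddir i \<phi> q" for e i q
  define B where "B e i x = (x \<bullet> i) * ddir e \<theta> x" for e i x
  define I where "I x z = \<rho> z * (A0 (fst z) * \<theta> x + (\<Sum>e\<in>Basis. \<Sum>i\<in>Basis. A e i (fst z) * B e i x))" for x z
  have cA0: "continuous_on UNIV A0"
    unfolding A0_def ddir_basis_sum[OF smooth_differentiable[OF s\<phi>], where v="b _"]
    by (intro continuous_intros c1 c2 b_cont)
  have zA0: "\<And>q. r < norm q \<Longrightarrow> A0 q = 0" by (simp add: A0_def z1 z2)
  have cA: "continuous_on UNIV (A e i)" for e i unfolding A_def by (intro continuous_intros c1 c2 b_cont)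
  have zA: "\<And>q. r < norm q \<Longrightarrow> A e i q = 0" for e i by (simp add: A_def z1 z2)
  have cB: "continuous_on UNIV (B e i)" for e i unfolding B_def
    by (intro continuous_intros smooth_continuous smooth_ddir s\<theta>)
  have zB: "\<And>q. 1 < norm q \<Longrightarrow> B e i q = 0" for e i
    by (simp add: B_def ddir_zero_outside[OF smooth_differentiable[OF s\<theta>] \<theta>(3)])
  have c\<theta>: "continuous_on UNIV \<theta>" by (rule smooth_continuous[OF s\<theta>])
  obtain K0 where K0: "\<And>q. \<bar>A0 q\<bar> \<le> K0" using compact_support_bounded[OF cA0 zA0] by blast
  obtain K\<theta> where K\<theta>: "\<And>q. \<bar>\<theta> q\<bar> \<le> K\<theta>" using compact_support_bounded[OF c\<theta> \<theta>(3)] by blast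
  have "\<forall>e i. \<exists>k. \<forall>q. \<bar>A e i q\<bar> \<le> k" using compact_support_bounded[OF cA zA] by metis
  then obtain KA where KA: "\<And>e i q. \<bar>A e i q\<bar> \<le> KA e i" by metis
  have "\<forall>e i. \<exists>k. \<forall>q. \<bar>B e i q\<bar> \<le> k" using compact_support_bounded[OF cB zB] by metis
  then obtain KB where KB: "\<And>e i q. \<bar>B e i q\<bar> \<le> KB e i" by metis
  have zero: "(\<integral>z. I (c *\<^sub>R snd z) z \<partial>lborel) = 0" if c: "c > 0" for c
  proof -
    define F where "F h z = (\<Sum>i\<in>Basis. (snd z \<bullet> i) * (ddir i h (fst z) * \<theta> (c *\<^sub>R snd z)))" for h z
    have F: "test_function (F h)" if "test_function h" for h
      unfolding F_def[abs_def] by (rule momentum_truncation(1)[OF that \<theta>(1) c])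
    have dF: "ddir v (F h) z = (\<Sum>i\<in>Basis. (snd v \<bullet> i) * (ddir i h (fst z) * \<theta> (c *\<^sub>R snd z))
       + (snd z \<bullet> i) * (ddir (fst v) (ddir i h) (fst z) * \<theta> (c *\<^sub>R snd z)
           + ddir i h (fst z) * (c * ddir (snd v) \<theta> (c *\<^sub>R snd z))))" if "test_function h" for h v z
      unfolding F_def[abs_def] by (rule momentum_truncation(2)[OF that \<theta>(1) c])
    define \<xi> where "\<xi> e = F (ddir e \<phi>)" for e
    have \<xi>: "test_function (\<xi> e)" for e unfolding \<xi>_def by (rule F[OF test_function_ddir[OF \<phi>]])
    define k where "k e z = (snd z \<bullet> e) * \<xi> e z - lam * ddir (0, e) (\<xi> e) z" for e z
    have k: "integrable lborel (\<lambda>z. \<rho> z * k e z)" "(e \<in> Basis \<Longrightarrow> (\<integral>z. \<rho> z * k e z \<partial>lborel) = 0)" for e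
    proof -
      obtain s where s: "\<And>z. s < norm z \<Longrightarrow> \<xi> e z = 0" using test_function_zero_outside[OF \<xi>] by blast
      note s\<xi> = test_function_smooth[OF \<xi>, of e]
      show "(\<integral>z. \<rho> z * k e z \<partial>lborel) = 0" if "e \<in> Basis"
        unfolding k_def by (rule maxwell_identity[OF smooth_Ck[OF s\<xi>] s that])
      have "continuous_on UNIV (k e)"
        unfolding k_def by (intro continuous_intros smooth_continuous[OF s\<xi>] smooth_continuous[OF smooth_ddir[OF s\<xi>]])
      then show "integrable lborel (\<lambda>z. \<rho> z * k e z)"
        by (rule rho_times_compact_integrable[where r=s])
          (simp add: k_def s ddir_zero_outside[OF smooth_differentiable[OF s\<xi>] s])
    qed
    define t where "t z = ddir (snd z, 0) (F \<phi>) z - ddir (0, b (fst z)) (F \<phi>) z" for z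
    have t0: "(\<integral>z. \<rho> z * t z \<partial>lborel) = 0" unfolding t_def by (rule transport_identity[OF F[OF \<phi>]])
    have intt: "integrable lborel (\<lambda>z. \<rho> z * t z)"
    proof -
      obtain s where s: "\<And>z. s < norm z \<Longrightarrow> F \<phi> z = 0" using test_function_zero_outside[OF F[OF \<phi>]] by blast
      note sF = test_function_smooth[OF F[OF \<phi>]]
      have ct: "continuous_on UNIV t"
        unfolding t_def ddir_product_basis_sum(1)[OF sF, where x="snd _"] ddir_product_basis_sum(2)[OF sF, where x="b _"]
        by (intro continuous_intros smooth_continuous smooth_ddir sF b_compose_cont)
      show ?thesis
        by (rule rho_times_compact_integrable[OF ct, of s])
          (simp add: t_def ddir_zero_outside[OF smooth_differentiable[OF sF] s])
    qed
    have "I (c *\<^sub>R snd z) z = \<rho> z * t z - (\<Sum>e\<in>Basis. \<rho> z * k e z)" for z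
    proof -
      let ?q = "fst z" and ?p = "snd z" and ?x = "c *\<^sub>R snd z"
      have 1: "ddir (?p, 0) (F \<phi>) z = (\<Sum>e\<in>Basis. (?p \<bullet> e) * \<xi> e z)"
      proof -
        have "ddir (?p, 0) (F \<phi>) z = (\<Sum>i\<in>Basis. (?p \<bullet> i) * (ddir ?p (ddir i \<phi>) ?q * \<theta> ?x))"
          unfolding dF[OF \<phi>] using linear_0[OF linear_ddir[OF s\<theta>]] by simp
        also have "\<dots> = (\<Sum>e\<in>Basis. (?p \<bullet> e) * \<xi> e z)"
          unfolding \<xi>_def F_def ddir_basis_sum[OF smooth_differentiable[OF smooth_ddir[OF s\<phi>]], where v="?p"]
          by (simp add: sum_distrib_right mult.assoc)
        finally show ?thesis .
      qed
      have 2: "ddir (0, b ?q) (F \<phi>) z = ddir (b ?q) \<phi> ?q * \<theta> ?x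
           + (\<Sum>e\<in>Basis. \<Sum>i\<in>Basis. (b ?q \<bullet> e) * ddir i \<phi> ?q * B e i ?x)"
      proof -
        have "ddir (0, b ?q) (F \<phi>) z = (\<Sum>i\<in>Basis. (b ?q \<bullet> i) * ddir i \<phi> ?q) * \<theta> ?x
           + (\<Sum>i\<in>Basis. (?x \<bullet> i) * (ddir i \<phi> ?q * ddir (b ?q) \<theta> ?x))"
          unfolding dF[OF \<phi>] using linear_0[OF linear_ddir[OF smooth_ddir[OF s\<phi>]]]
          by (simp add: sum.distrib sum_distrib_left sum_distrib_right mult_ac)
        also have "(\<Sum>i\<in>Basis. (b ?q \<bullet> i) * ddir i \<phi> ?q) = ddir (b ?q) \<phi> ?q"
          by (rule ddir_basis_sum[OF smooth_differentiable[OF s\<phi>], symmetric])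
        also have "(\<Sum>i\<in>Basis. (?x \<bullet> i) * (ddir i \<phi> ?q * ddir (b ?q) \<theta> ?x))
            = (\<Sum>i\<in>Basis. \<Sum>e\<in>Basis. (b ?q \<bullet> e) * ddir i \<phi> ?q * B e i ?x)"
          unfolding ddir_basis_sum[OF smooth_differentiable[OF s\<theta>], where v="b ?q"] B_def
          by (simp add: sum_distrib_left mult_ac)
        also have "\<dots> = (\<Sum>e\<in>Basis. \<Sum>i\<in>Basis. (b ?q \<bullet> e) * ddir i \<phi> ?q * B e i ?x)"
          by (rule sum.swap)
        finally show ?thesis .
      qed
      have 3: "ddir (0, e) (\<xi> e) z = ddir e (ddir e \<phi>) ?q * \<theta> ?x + (\<Sum>i\<in>Basis. ddir i (ddir e \<phi>) ?q * B e i ?x)"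
        if e: "e \<in> Basis" for e
      proof -
        have "ddir (0, e) (\<xi> e) z = (\<Sum>i\<in>Basis. (e \<bullet> i) * ddir i (ddir e \<phi>) ?q) * \<theta> ?x
           + (\<Sum>i\<in>Basis. (?x \<bullet> i) * (ddir i (ddir e \<phi>) ?q * ddir e \<theta> ?x))"
          unfolding \<xi>_def dF[OF test_function_ddir[OF \<phi>]]
          using linear_0[OF linear_ddir[OF smooth_ddir[OF smooth_ddir[OF s\<phi>]]]]
          by (simp add: sum.distrib sum_distrib_left sum_distrib_right mult_ac)
        also have "(\<Sum>i\<in>Basis. (e \<bullet> i) * ddir i (ddir e \<phi>) ?q) = ddir e (ddir e \<phi>) ?q"
          by (rule ddir_basis_sum[OF smooth_differentiable[OF smooth_ddir[OF s\<phi>]], symmetric])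
        finally show ?thesis by (simp add: B_def mult_ac)
      qed
      have "t z - (\<Sum>e\<in>Basis. k e z) = lam * (\<Sum>e\<in>Basis. ddir (0, e) (\<xi> e) z) - ddir (0, b ?q) (F \<phi>) z"
        unfolding t_def k_def 1 by (simp add: sum_subtractf sum_distrib_left)
      also have "(\<Sum>e\<in>Basis. ddir (0, e) (\<xi> e) z)
          = (\<Sum>e\<in>Basis. ddir e (ddir e \<phi>) ?q) * \<theta> ?x + (\<Sum>e\<in>Basis. \<Sum>i\<in>Basis. ddir i (ddir e \<phi>) ?q * B e i ?x)"
        by (simp add: 3 sum.distrib sum_distrib_right)
      finally have "t z - (\<Sum>e\<in>Basis. k e z) = A0 ?q * \<theta> ?x + (\<Sum>e\<in>Basis. \<Sum>i\<in>Basis. A e i ?q * B e i ?x)"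
        unfolding 2 by (simp add: A0_def A_def left_diff_distrib sum_subtractf sum_distrib_left distrib_left mult.assoc)
      then show ?thesis
        by (simp add: I_def right_diff_distrib sum_distrib_left[symmetric] flip: right_diff_distrib)
    qed
    then show ?thesis using t0 intt k by (simp add: Bochner_Integration.integral_sum)
  qed
  have "(\<lambda>n. \<integral>z. I ((1 / real (Suc n)) *\<^sub>R snd z) z \<partial>lborel) \<longlonglongrightarrow> (\<integral>z. I 0 z \<partial>lborel)"
  proof (rule integral_dominated_convergence)
    have [measurable]: "\<rho> \<in> borel_measurable borel" using rho_integrable by auto
    have meas: "(\<lambda>z. I (c *\<^sub>R snd z) z) \<in> borel_measurable lborel" for c
    proof -
      have "continuous_on UNIV (\<lambda>z. A0 (fst z) * \<theta> (c *\<^sub>R snd z)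
          + (\<Sum>e\<in>Basis. \<Sum>i\<in>Basis. A e i (fst z) * B e i (c *\<^sub>R snd z)))"
        by (intro continuous_intros continuous_on_compose2[OF cA0] continuous_on_compose2[OF cA]
            continuous_on_compose2[OF cB] continuous_on_compose2[OF c\<theta>]) auto
      from borel_measurable_continuous_onI[OF this] show ?thesis
        unfolding I_def by simp
    qed
    show "I 0 \<in> borel_measurable lborel" using meas[of 0] by simp
    show "(\<lambda>z. I ((1 / real (Suc n)) *\<^sub>R snd z) z) \<in> borel_measurable lborel" for n by (rule meas)
    show "integrable lborel (\<lambda>z. \<bar>\<rho> z\<bar> * (K0 * K\<theta> + (\<Sum>e\<in>(Basis::'a set). \<Sum>i\<in>(Basis::'a set). KA e i * KB e i)))"
      using rho_integrable by simp
    show "AE z in lborel. (\<lambda>n. I ((1 / real (Suc n)) *\<^sub>R snd z) z) \<longlonglongrightarrow> I 0 z"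
    proof (rule AE_I2)
      fix z :: "'a \<times> 'a"
      have "(\<lambda>n. 1 / real (Suc n)) \<longlonglongrightarrow> 0"
        using LIMSEQ_inverse_real_of_nat by (simp add: inverse_eq_divide)
      from tendsto_scaleR[OF this tendsto_const[of "snd z"]]
      have x: "(\<lambda>n. (1 / real (Suc n)) *\<^sub>R snd z) \<longlonglongrightarrow> 0" by simp
      have *: "(\<lambda>n. f ((1 / real (Suc n)) *\<^sub>R snd z)) \<longlonglongrightarrow> f 0" if "continuous_on UNIV f" for f :: "'a \<Rightarrow> real"
        using continuous_on_tendsto_compose[OF that x] by simp
      show "(\<lambda>n. I ((1 / real (Suc n)) *\<^sub>R snd z) z) \<longlonglongrightarrow> I 0 z"
        unfolding I_def by (intro tendsto_intros *[OF c\<theta>] *[OF cB])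
    qed
    show "AE z in lborel. norm (I ((1 / real (Suc n)) *\<^sub>R snd z) z)
        \<le> \<bar>\<rho> z\<bar> * (K0 * K\<theta> + (\<Sum>e\<in>(Basis::'a set). \<Sum>i\<in>(Basis::'a set). KA e i * KB e i))" for n
    proof (rule AE_I2)
      fix z :: "'a \<times> 'a"
      let ?x = "(1 / real (Suc n)) *\<^sub>R snd z"
      have "\<bar>A0 (fst z) * \<theta> ?x\<bar> \<le> K0 * K\<theta>"
        unfolding abs_mult by (intro mult_mono K0 K\<theta>) (auto intro: order_trans[OF abs_ge_zero K0])
      moreover have "\<bar>\<Sum>e\<in>Basis. \<Sum>i\<in>Basis. A e i (fst z) * B e i ?x\<bar> \<le> (\<Sum>e\<in>(Basis::'a set). \<Sum>i\<in>(Basis::'a set). KA e i * KB e i)"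
      proof (intro order_trans[OF sum_abs] sum_mono)
        fix e i show "\<bar>A e i (fst z) * B e i ?x\<bar> \<le> KA e i * KB e i"
          unfolding abs_mult by (intro mult_mono KA KB) (auto intro: order_trans[OF abs_ge_zero KA])
      qed
      ultimately have "\<bar>A0 (fst z) * \<theta> ?x + (\<Sum>e\<in>Basis. \<Sum>i\<in>Basis. A e i (fst z) * B e i ?x)\<bar>
          \<le> K0 * K\<theta> + (\<Sum>e\<in>(Basis::'a set). \<Sum>i\<in>(Basis::'a set). KA e i * KB e i)" by linarith
      then show "norm (I ?x z) \<le> \<bar>\<rho> z\<bar> * (K0 * K\<theta> + (\<Sum>e\<in>(Basis::'a set). \<Sum>i\<in>(Basis::'a set). KA e i * KB e i))"
        unfolding I_def real_norm_def abs_mult by (intro mult_left_mono) auto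
    qed
  qed
  moreover have "(\<integral>z. I ((1 / real (Suc n)) *\<^sub>R snd z) z \<partial>lborel) = 0" for n by (rule zero) simp
  ultimately have "(\<integral>z. I 0 z \<partial>lborel) = 0"
    by (simp add: LIMSEQ_const_iff del: of_nat_Suc)
  moreover have "I 0 z = \<theta> 0 * (\<rho> z * A0 (fst z))" for z by (simp add: I_def B_def)
  ultimately show ?thesis using \<theta>(2) by (simp add: A0_def)
qed

end

section \<open>Gradients and Laplacians in coordinates\<close>

lemma grad_eqI:
  assumes "(f has_derivative (\<lambda>v. v \<bullet> D)) (at x)"
  shows "grad f x = D"
  unfolding grad_def gderiv_def
proof (rule the_equality)
  fix D' assume "(f has_derivative (\<lambda>v. v \<bullet> D')) (at x)"
  then have "(\<lambda>v. v \<bullet> D') = (\<lambda>v. v \<bullet> D)" using has_derivative_unique assms by blast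
  then have "v \<bullet> D' = v \<bullet> D" for v by (rule fun_cong)
  then show "D' = D" using vector_eq_ldot by blast
qed (rule assms)

lemma grad_has_derivative:
  fixes f :: "'a::euclidean_space \<Rightarrow> real"
  assumes "f differentiable (at x)"
  shows "(f has_derivative (\<lambda>v. v \<bullet> grad f x)) (at x)"
    and "grad f x = (\<Sum>e\<in>Basis. ddir e f x *\<^sub>R e)"
    and "ddir v f x = v \<bullet> grad f x"
proof -
  let ?D = "\<Sum>e\<in>Basis. ddir e f x *\<^sub>R e"
  have eq: "ddir v f x = v \<bullet> ?D" for v
    using ddir_basis_sum[OF assms, of v] by (simp add: inner_sum_right mult.commute)
  then have "frechet_derivative f (at x) = (\<lambda>v. v \<bullet> ?D)" by (rule ext)
  then have d: "(f has_derivative (\<lambda>v. v \<bullet> ?D)) (at x)"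
    using assms by (metis frechet_derivative_works)
  show g: "grad f x = ?D" by (rule grad_eqI[OF d])
  show "(f has_derivative (\<lambda>v. v \<bullet> grad f x)) (at x)" unfolding g by (rule d)
  show "ddir v f x = v \<bullet> grad f x" unfolding g by (rule eq)
qed

lemma sum_Basis_axis: "(\<Sum>e\<in>(Basis::(real^'d) set). f e) = (\<Sum>i\<in>UNIV. f (axis i 1))"
  by (simp add: Basis_vec_def UNION_singleton_eq_range sum.reindex axis_eq_axis inj_on_def)

lemma laplacian_eq:
  fixes f :: "real^'d \<Rightarrow> real"
  assumes "smooth f"
  shows "laplacian f x = (\<Sum>e\<in>Basis. ddir e (ddir e f) x)"
proof -
  define D where "D v = (\<Sum>e\<in>Basis. ddir v (ddir e f) x *\<^sub>R e)" for v
  have "grad f = (\<lambda>x. \<Sum>e\<in>Basis. ddir e f x *\<^sub>R e)"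
    by (rule ext) (rule grad_has_derivative(2)[OF smooth_differentiable[OF assms]])
  moreover have "((\<lambda>x. \<Sum>e\<in>Basis. ddir e f x *\<^sub>R e) has_derivative D) (at x)"
    unfolding D_def
    by (intro has_derivative_sum has_derivative_scaleR_left smooth_has_derivative smooth_ddir assms)
  ultimately have "(grad f has_derivative D) (at x)" by simp
  then have "frechet_derivative (grad f) (at x) = D" by (rule frechet_derivative_at[symmetric])
  then have "laplacian f x = (\<Sum>i\<in>UNIV. D (axis i 1) $ i)"
    by (simp add: laplacian_def hessian_def trace_def jacobian_def matrix_def)
  also have "\<dots> = (\<Sum>e\<in>Basis. D e \<bullet> e)"
    by (simp add: sum_Basis_axis cart_eq_inner_axis)
  also have "\<dots> = (\<Sum>e\<in>Basis. ddir e (ddir e f) x)"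
    by (rule sum.cong) (simp_all add: D_def)
  finally show ?thesis .
qed

lemma ddir_slice:
  fixes f :: "'a::euclidean_space \<times> 'b::euclidean_space \<Rightarrow> real"
  assumes "smooth f"
  shows "ddir v (\<lambda>q. f (q, p)) = (\<lambda>q. ddir (v, 0) f (q, p))"
    and "ddir w (\<lambda>p. f (q, p)) = (\<lambda>p. ddir (0, w) f (q, p))"
proof -
  show "ddir v (\<lambda>q. f (q, p)) = (\<lambda>q. ddir (v, 0) f (q, p))"
  proof (rule ddir_eqI[where f'="\<lambda>q v. ddir (v, 0) f (q, p)"])
    show "((\<lambda>q. f (q, p)) has_derivative (\<lambda>v. ddir (v, 0) f (q, p))) (at q)" for q
      by (rule has_derivative_compose[where f="\<lambda>q. (q, p)" and f'="\<lambda>v. (v, 0)" and g=f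
            and g'="frechet_derivative f (at (q, p))"])
         (auto intro!: derivative_eq_intros smooth_has_derivative assms)
  qed
  show "ddir w (\<lambda>p. f (q, p)) = (\<lambda>p. ddir (0, w) f (q, p))"
  proof (rule ddir_eqI[where f'="\<lambda>p v. ddir (0, v) f (q, p)"])
    show "((\<lambda>p. f (q, p)) has_derivative (\<lambda>v. ddir (0, v) f (q, p))) (at p)" for p
      by (rule has_derivative_compose[where f="\<lambda>p. (q, p)" and f'="\<lambda>v. (0, v)" and g=f
            and g'="frechet_derivative f (at (q, p))"])
         (auto intro!: derivative_eq_intros smooth_has_derivative assms)
  qed
qed

lemma smooth_slice:
  fixes f :: "'a::euclidean_space \<times> 'b::euclidean_space \<Rightarrow> real"
  assumes "smooth f"
  shows "smooth (\<lambda>q. f (q, p))" and "smooth (\<lambda>p. f (q, p))"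
proof -
  have "bounded_linear (\<lambda>q::'a. (q, 0::'b))" "bounded_linear (\<lambda>p::'b. (0::'a, p))"
    by (auto intro!: bounded_linear_Pair bounded_linear_ident bounded_linear_zero)
  from smooth_compose_affine[OF this(1) assms, of "(0, p)"] smooth_compose_affine[OF this(2) assms, of "(q, 0)"]
  show "smooth (\<lambda>q. f (q, p))" and "smooth (\<lambda>p. f (q, p))" by simp_all
qed

lemma phase_space_operators:
  fixes f :: "(real^'d) \<times> (real^'d) \<Rightarrow> real"
  assumes f: "smooth f"
  shows "v \<bullet> grad_q f z = ddir (v, 0) f z" and "v \<bullet> grad_p f z = ddir (0, v) f z"
    and "laplacian_p f z = (\<Sum>e\<in>Basis. ddir (0, e) (ddir (0, e) f) z)"
proof -
  obtain q p where z: "z = (q, p)" by (cases z)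
  note s = smooth_slice[OF f]
  show "v \<bullet> grad_q f z = ddir (v, 0) f z"
    using grad_has_derivative(3)[OF smooth_differentiable[OF s(1)], where v=v] fun_cong[OF ddir_slice(1)[OF f]]
    by (simp add: z grad_q_def)
  show "v \<bullet> grad_p f z = ddir (0, v) f z"
    using grad_has_derivative(3)[OF smooth_differentiable[OF s(2)], where v=v] fun_cong[OF ddir_slice(2)[OF f]]
    by (simp add: z grad_p_def)
  show "laplacian_p f z = (\<Sum>e\<in>Basis. ddir (0, e) (ddir (0, e) f) z)"
    unfolding z laplacian_p_def prod.case laplacian_eq[OF s(2)] ddir_slice(2)[OF f]
      fun_cong[OF ddir_slice(2)[OF smooth_ddir[OF f]]] by (rule refl)
qed

section \<open>The mean field\<close>

text \<open>
  For an even polynomial the second summand drops out, which exhibits \<open>\<psi>\<close> as a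
  polynomial in \<open>x \<bullet> x\<close> and so as differentiable at the origin.
\<close>

lemma poly_even_odd: "\<exists>A B::real poly. \<forall>r. poly p r = poly A (r\<^sup>2) + r * poly B (r\<^sup>2)"
proof (induction p)
  case 0
  show ?case by (rule exI[of _ 0], rule exI[of _ 0]) simp
next
  case (pCons a p)
  then obtain A B where AB: "\<And>r. poly p r = poly A (r\<^sup>2) + r * poly B (r\<^sup>2)" by blast
  have "poly (pCons a p) r = poly (pCons a B) (r\<^sup>2) + r * poly A (r\<^sup>2)" for r
    by (simp add: AB algebra_simps power2_eq_square)
  then show ?case by blast
qed

lemma poly_bound: "\<exists>B\<ge>0. \<forall>r. \<bar>poly (p::real poly) r\<bar> \<le> B * (1 + \<bar>r\<bar>) ^ degree p"
proof (intro exI[of _ "\<Sum>i\<le>degree p. \<bar>coeff p i\<bar>"] conjI allI)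
  show "0 \<le> (\<Sum>i\<le>degree p. \<bar>coeff p i\<bar>)" by (simp add: sum_nonneg)
  fix r :: real
  have "\<bar>poly p r\<bar> \<le> (\<Sum>i\<le>degree p. \<bar>coeff p i * r ^ i\<bar>)" by (simp add: poly_altdef)
  also have "\<dots> \<le> (\<Sum>i\<le>degree p. \<bar>coeff p i\<bar> * (1 + \<bar>r\<bar>) ^ degree p)"
  proof (rule sum_mono)
    fix i assume "i \<in> {..degree p}"
    then have "\<bar>r\<bar> ^ i \<le> (1 + \<bar>r\<bar>) ^ degree p"
      by (intro order_trans[OF power_mono[of "\<bar>r\<bar>" "1 + \<bar>r\<bar>"] power_increasing]) auto
    then show "\<bar>coeff p i * r ^ i\<bar> \<le> \<bar>coeff p i\<bar> * (1 + \<bar>r\<bar>) ^ degree p"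
      by (simp add: abs_mult power_abs mult_left_mono)
  qed
  finally show "\<bar>poly p r\<bar> \<le> (\<Sum>i\<le>degree p. \<bar>coeff p i\<bar>) * (1 + \<bar>r\<bar>) ^ degree p"
    by (simp add: sum_distrib_right)
qed

text \<open>
  The leading coefficient is positive; compare with a multiple of \<open>p\<close> whose leading
  coefficient exceeds that of \<open>(1 + r)\<^sup>k\<close>.
\<close>

lemma nonneg_poly_dominates:
  fixes p :: "real poly"
  assumes nn: "\<And>r. 0 \<le> poly p r" and deg: "degree p = k" "k \<ge> 1"
  shows "\<exists>K>0. \<forall>r\<ge>0. (1 + r) ^ k \<le> K * (1 + poly p r)"
proof -
  have p0: "p \<noteq> 0" using deg by auto
  have lc: "lead_coeff p > 0"
  proof (rule ccontr)
    assume "\<not> ?thesis"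
    then have "lead_coeff (- p) > 0" using p0 by (simp add: le_neq_trans)
    then obtain n where "\<And>x. x \<ge> n \<Longrightarrow> poly (- p) x \<ge> lead_coeff (- p)"
      using poly_pinfty_gt_lc by blast
    from this[of n] nn[of n] \<open>lead_coeff (- p) > 0\<close> show False by simp
  qed
  define c where "c = 2 / lead_coeff p"
  have c: "c > 0" using lc by (simp add: c_def)
  define s where "s = smult c p - [:1, 1:] ^ k"
  have "coeff s k = 1"
    using lc deg coeff_linear_power[of "1::real" k] by (simp add: s_def c_def)
  moreover have "degree s \<le> k"
    unfolding s_def using deg by (intro degree_diff_le) (auto simp: degree_linear_power)
  ultimately have "lead_coeff s = 1"
    by (metis le_antisym le_degree zero_neq_one)
  then obtain n where n: "\<And>x. x \<ge> n \<Longrightarrow> poly s x \<ge> 1"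
    using poly_pinfty_gt_lc[of s] by auto
  define K where "K = max c ((1 + \<bar>n\<bar>) ^ k)"
  have "(1 + r) ^ k \<le> K * (1 + poly p r)" if r: "r \<ge> 0" for r
  proof (cases "r \<ge> n")
    case True
    have "(1 + r) ^ k \<le> c * poly p r" using n[OF True] by (simp add: s_def poly_power add.commute)
    also have "\<dots> \<le> K * poly p r" using nn by (intro mult_right_mono) (auto simp: K_def)
    finally show ?thesis using c by (simp add: K_def algebra_simps)
  next
    case False
    then have "(1 + r) ^ k \<le> (1 + \<bar>n\<bar>) ^ k" using r by (intro power_mono) auto
    also have "\<dots> \<le> K * 1" by (simp add: K_def)
    also have "\<dots> \<le> K * (1 + poly p r)" using nn[of r] c by (intro mult_left_mono) (auto simp: K_def)
    finally show ?thesis .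
  qed
  moreover have "K > 0" using c by (simp add: K_def)
  ultimately show ?thesis by blast
qed

text \<open>
  The last bound is what makes the mean field differentiable: the force is controlled by the
  potential itself, so that integrability of \<open>\<psi>\<close> against the density, at the
  single point zero, dominates the force locally uniformly.
\<close>

lemma interaction_potential_properties:
  fixes \<psi> :: "real^'d \<Rightarrow> real"
  assumes "interaction_potential \<psi>"
  shows "0 \<le> \<psi> x" and "(\<psi> has_derivative (\<lambda>v. v \<bullet> grad \<psi> x)) (at x)"
    and "continuous_on UNIV (grad \<psi>)"
    and "\<exists>K\<ge>0. \<exists>k. \<forall>x y. norm (grad \<psi> (x - y)) \<le> K * (1 + norm x) ^ k * (1 + \<psi> (- y))"
proof -
  from assms obtain G n where \<psi>: "\<And>x. \<psi> x = poly G (norm x)" and even: "\<And>r. poly G (- r) = poly G r"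
    and n: "n \<ge> 1" and deg: "degree G = 2 * n" and conv: "convex_on UNIV (poly G)" and G0: "poly G 0 = 0"
    unfolding interaction_potential_def by blast
  have G_nonneg: "0 \<le> poly G r" for r
    using convex_onD[OF conv, of "1/2" r "- r"] even[of r] G0 by simp
  obtain A B where AB: "\<And>r. poly G r = poly A (r\<^sup>2) + r * poly B (r\<^sup>2)" using poly_even_odd by blast
  have "r * poly B (r\<^sup>2) = 0" for r using even[of r] AB[of r] AB[of "- r"] by simp
  then have A: "poly G r = poly A (r\<^sup>2)" for r using AB by simp
  define g where "g x = (2 * poly (pderiv A) (x \<bullet> x)) *\<^sub>R x" for x :: "real^'d"
  have \<psi>A: "\<psi> = (\<lambda>x. poly A (x \<bullet> x))" by (rule ext) (simp add: \<psi> A power2_norm_eq_inner)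
  have der: "(\<psi> has_derivative (\<lambda>v. v \<bullet> g x)) (at x)" for x
  proof -
    have "((\<lambda>x. x \<bullet> x) has_derivative (\<lambda>v. 2 * (x \<bullet> v))) (at x)"
      by (auto intro!: derivative_eq_intros simp: inner_commute)
    moreover have "(poly A has_derivative (\<lambda>t. poly (pderiv A) (x \<bullet> x) * t)) (at (x \<bullet> x))"
      using poly_DERIV[of A "x \<bullet> x"] by (simp add: has_field_derivative_def)
    ultimately have "((\<lambda>x. poly A (x \<bullet> x)) has_derivative (\<lambda>v. poly (pderiv A) (x \<bullet> x) * (2 * (x \<bullet> v)))) (at x)"
      by (rule has_derivative_compose)
    then show ?thesis by (simp add: \<psi>A g_def inner_commute mult_ac)
  qed
  then have grad: "grad \<psi> = g" by (intro ext grad_eqI)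
  have "poly (pderiv G) r = 2 * r * poly (pderiv A) (r\<^sup>2)" for r
  proof -
    have "((\<lambda>r. r\<^sup>2) has_real_derivative 2 * r) (at r)" by (auto intro!: derivative_eq_intros)
    from DERIV_chain2[OF poly_DERIV this, of A]
    have "(poly G has_real_derivative poly (pderiv A) (r\<^sup>2) * (2 * r)) (at r)"
      using A by (simp add: ext[of "poly G" "\<lambda>r. poly A (r\<^sup>2)"])
    from DERIV_unique[OF poly_DERIV this] show ?thesis by simp
  qed
  then have norm_g: "norm (g x) = \<bar>poly (pderiv G) (norm x)\<bar>" for x
    by (simp add: g_def power2_norm_eq_inner abs_mult)
  let ?k = "degree (pderiv G)"
  obtain B1 where B1: "B1 \<ge> 0" "\<And>r. \<bar>poly (pderiv G) r\<bar> \<le> B1 * (1 + \<bar>r\<bar>) ^ ?k"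
    using poly_bound by blast
  obtain K where K: "K > 0" "\<And>r. r \<ge> 0 \<Longrightarrow> (1 + r) ^ (2 * n) \<le> K * (1 + poly G r)"
    using nonneg_poly_dominates[OF G_nonneg deg] n by auto
  have "norm (g (x - y)) \<le> B1 * K * (1 + norm x) ^ ?k * (1 + \<psi> (- y))" for x y
  proof -
    have "norm (g (x - y)) \<le> B1 * (1 + norm (x - y)) ^ ?k"
      using B1(2)[of "norm (x - y)"] by (simp add: norm_g)
    also have "\<dots> \<le> B1 * ((1 + norm x) ^ ?k * (1 + norm y) ^ ?k)"
    proof (intro mult_left_mono B1(1))
      have "1 + norm (x - y) \<le> (1 + norm x) * (1 + norm y)"
      proof -
        have "0 \<le> norm x * norm y" by simp
        moreover have "(1 + norm x) * (1 + norm y) = 1 + norm x + norm y + norm x * norm y"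
          by (simp add: distrib_left distrib_right)
        ultimately show ?thesis using norm_triangle_ineq4[of x y] by linarith
      qed
      then have "(1 + norm (x - y)) ^ ?k \<le> ((1 + norm x) * (1 + norm y)) ^ ?k" by (intro power_mono) auto
      then show "(1 + norm (x - y)) ^ ?k \<le> (1 + norm x) ^ ?k * (1 + norm y) ^ ?k" by (simp add: power_mult_distrib)
    qed
    also have "\<dots> \<le> B1 * ((1 + norm x) ^ ?k * (K * (1 + \<psi> (- y))))"
    proof (intro mult_left_mono B1(1))
      have "(1 + norm y) ^ ?k \<le> (1 + norm y) ^ (2 * n)"
        by (intro power_increasing) (auto simp: degree_pderiv deg)
      also have "\<dots> \<le> K * (1 + \<psi> (- y))" using K(2)[of "norm y"] by (simp add: \<psi>)
      finally show "(1 + norm y) ^ ?k \<le> K * (1 + \<psi> (- y))" .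
    qed simp
    finally show ?thesis by (simp add: mult_ac)
  qed
  moreover have "0 \<le> B1 * K" using B1(1) K(1) by simp
  ultimately show "\<exists>K\<ge>0. \<exists>k. \<forall>x y. norm (grad \<psi> (x - y)) \<le> K * (1 + norm x) ^ k * (1 + \<psi> (- y))"
    unfolding grad by blast
  show "continuous_on UNIV (grad \<psi>)" unfolding grad g_def by (intro continuous_intros)
  show "0 \<le> \<psi> x" by (simp add: \<psi> G_nonneg)
  show "(\<psi> has_derivative (\<lambda>v. v \<bullet> grad \<psi> x)) (at x)" unfolding grad by (rule der)
qed

lemma mean_field_potential:
  fixes \<psi> :: "real^'d \<Rightarrow> real"
  assumes \<psi>: "interaction_potential \<psi>" and \<rho>: "integrable lborel \<rho>"
    and c1: "conv_density_defined \<psi> \<rho>" and c2: "conv_density_defined (grad \<psi>) \<rho>"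
  shows "(conv_density \<psi> \<rho> has_derivative (\<lambda>v. v \<bullet> conv_density (grad \<psi>) \<rho> q)) (at q)"
    and "continuous_on UNIV (conv_density (grad \<psi>) \<rho>)"
proof -
  note nn = interaction_potential_properties(1)[OF \<psi>]
    and der = interaction_potential_properties(2)[OF \<psi>]
    and cg = interaction_potential_properties(3)[OF \<psi>]
  obtain k K where K: "K \<ge> 0"
    and bound: "\<And>x y. norm (grad \<psi> (x - y)) \<le> K * (1 + norm x) ^ k * (1 + \<psi> (- y))"
    using interaction_potential_properties(4)[OF \<psi>] by blast
  have int1: "integrable lborel (\<lambda>z. \<rho> z * \<psi> (x - fst z))" for x
    using c1 by (simp add: conv_density_defined_def)
  have int2: "integrable lborel (\<lambda>z. \<rho> z *\<^sub>R grad \<psi> (x - fst z))" for x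
    using c2 by (simp add: conv_density_defined_def)
  \<comment> \<open>The constant \<open>2\<close> accommodates all points of the unit ball around \<open>q\<close>.\<close>
  define w where "w q z = K * (2 + norm q) ^ k * (\<bar>\<rho> z\<bar> + \<bar>\<rho> z * \<psi> (0 - fst z)\<bar>)" for q :: "real^'d" and z :: "(real^'d) \<times> (real^'d)"
  have w: "integrable lborel (w q)" for q
    unfolding w_def using int1[of 0] \<rho> by (intro integrable_mult_right Bochner_Integration.integrable_add integrable_abs)
  have dom: "norm (\<rho> z *\<^sub>R grad \<psi> (x - fst z)) \<le> w q z" if "x \<in> ball q 1" for x q z
  proof -
    have "norm x \<le> 1 + norm q" using that norm_triangle_ineq2[of x q] by (simp add: dist_norm norm_minus_commute)
    then have "(1 + norm x) ^ k \<le> (2 + norm q) ^ k" by (intro power_mono) auto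
    then have "norm (grad \<psi> (x - fst z)) \<le> K * (2 + norm q) ^ k * (1 + \<psi> (- fst z))"
      by (intro order_trans[OF bound] mult_right_mono mult_left_mono K) (simp_all add: nn add_nonneg_nonneg)
    from mult_left_mono[OF this, of "\<bar>\<rho> z\<bar>"] show ?thesis
      by (simp add: w_def abs_mult nn algebra_simps)
  qed
  show "(conv_density \<psi> \<rho> has_derivative (\<lambda>v. v \<bullet> conv_density (grad \<psi>) \<rho> q)) (at q)"
  proof -
    have "((\<lambda>q. \<integral>z. \<rho> z * \<psi> (q - fst z) \<partial>lborel) has_derivative
        (\<lambda>v. \<integral>z. v \<bullet> (\<rho> z *\<^sub>R grad \<psi> (q - fst z)) \<partial>lborel)) (at q)"
    proof (rule has_derivative_integral_dominated[where f'="\<lambda>x z v. v \<bullet> (\<rho> z *\<^sub>R grad \<psi> (x - fst z))" and w="w q"])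
      fix x and z :: "(real^'d) \<times> (real^'d)"
      have "((\<lambda>x. \<psi> (x - fst z)) has_derivative (\<lambda>v. v \<bullet> grad \<psi> (x - fst z))) (at x)"
        by (rule has_derivative_compose[where f="\<lambda>x. x - fst z" and f'="\<lambda>v. v" and g=\<psi>
            and g'="\<lambda>v. v \<bullet> grad \<psi> (x - fst z)"]) (auto intro!: derivative_eq_intros der)
      from has_derivative_mult_right[OF this, of "\<rho> z"]
      show "((\<lambda>x. \<rho> z * \<psi> (x - fst z)) has_derivative (\<lambda>v. v \<bullet> (\<rho> z *\<^sub>R grad \<psi> (x - fst z)))) (at x)"
        by simp
    next
      fix x z v assume "x \<in> ball q 1"
      have "\<bar>v \<bullet> (\<rho> z *\<^sub>R grad \<psi> (x - fst z))\<bar> \<le> norm v * norm (\<rho> z *\<^sub>R grad \<psi> (x - fst z))"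
        by (rule Cauchy_Schwarz_ineq2)
      also have "\<dots> \<le> norm v * w q z" by (intro mult_left_mono dom \<open>x \<in> ball q 1\<close>) simp
      finally show "\<bar>v \<bullet> (\<rho> z *\<^sub>R grad \<psi> (x - fst z))\<bar> \<le> w q z * norm v" by (simp add: mult.commute)
    next
      show "(\<lambda>z. v \<bullet> (\<rho> z *\<^sub>R grad \<psi> (q - fst z))) \<in> borel_measurable lborel" for v
        using int2[of q] by (intro borel_measurable_inner) auto
    qed (use int1 w in auto)
    moreover have "(\<integral>z. v \<bullet> (\<rho> z *\<^sub>R grad \<psi> (q - fst z)) \<partial>lborel) = v \<bullet> conv_density (grad \<psi>) \<rho> q" for v
      unfolding conv_density_def by (rule integral_inner_right) (rule int2)
    ultimately show ?thesis by (simp add: conv_density_def[abs_def])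
  qed
  show "continuous_on UNIV (conv_density (grad \<psi>) \<rho>)"
  proof (rule continuous_at_imp_continuous_on, rule ballI)
    fix q
    show "isCont (conv_density (grad \<psi>) \<rho>) q"
      unfolding conv_density_def
    proof (rule isCont_integral_dominated[OF _ _ dom w])
      fix z
      have "continuous_on UNIV (\<lambda>x. \<rho> z *\<^sub>R grad \<psi> (x - fst z))"
        by (intro continuous_intros continuous_on_compose2[OF cg]) auto
      then show "isCont (\<lambda>x. \<rho> z *\<^sub>R grad \<psi> (x - fst z)) q"
        by (simp add: continuous_on_eq_continuous_at)
    next
      show "(\<lambda>z. \<rho> z *\<^sub>R grad \<psi> (x - fst z)) \<in> borel_measurable lborel" for x
        using int2[of x] by auto
    qed
  qed
qed

section \<open>The first marginal\<close>

lemma first_marginal_properties: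
  fixes \<rho> :: "(real^'d) \<times> (real^'d) \<Rightarrow> real"
  assumes \<rho>: "integrable lborel \<rho>" and nn: "AE z in lborel. 0 \<le> \<rho> z"
  shows "sets (first_marginal \<rho>) = sets borel"
    and "(\<integral>z. \<rho> z \<partial>lborel) = 1 \<Longrightarrow> prob_space (first_marginal \<rho>)"
    and "\<And>f :: real^'d \<Rightarrow> 'b::{banach, second_countable_topology}. f \<in> borel_measurable borel \<Longrightarrow>
      integrable lborel (\<lambda>z. \<rho> z *\<^sub>R f (fst z)) \<Longrightarrow>
      integrable (first_marginal \<rho>) f \<and> (\<integral>q. f q \<partial>first_marginal \<rho>) = (\<integral>z. \<rho> z *\<^sub>R f (fst z) \<partial>lborel)"
proof -
  define r where "r q = (\<integral>p. \<rho> (q, p) \<partial>lborel)" for q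
  have fm: "first_marginal \<rho> = density lborel (\<lambda>q. ennreal (r q))"
    by (simp add: first_marginal_def r_def)
  have \<rho>p: "integrable (lborel \<Otimes>\<^sub>M lborel) \<rho>" using \<rho> by (simp add: lborel_prod)
  have rint: "integrable lborel r" unfolding r_def by (rule lborel_pair.integrable_fst'[OF \<rho>p])
  then have rm[measurable]: "r \<in> borel_measurable lborel" by simp
  have "AE z in lborel \<Otimes>\<^sub>M lborel. 0 \<le> \<rho> z" unfolding lborel_prod by (rule nn)
  then have "AE q in lborel. AE p in lborel. 0 \<le> \<rho> (q, p)" by (rule lborel_pair.AE_pair)
  then have rnn: "AE q in lborel. 0 \<le> r q"
    by eventually_elim (simp add: r_def integral_nonneg_AE)
  show "sets (first_marginal \<rho>) = sets borel" by (simp add: fm)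
  show "prob_space (first_marginal \<rho>)" if one: "(\<integral>z. \<rho> z \<partial>lborel) = 1"
  proof
    have "emeasure (first_marginal \<rho>) (space (first_marginal \<rho>)) = (\<integral>\<^sup>+q. ennreal (r q) \<partial>lborel)"
      by (simp add: fm emeasure_density)
    also have "\<dots> = ennreal (\<integral>q. r q \<partial>lborel)" by (rule nn_integral_eq_integral[OF rint rnn])
    also have "(\<integral>q. r q \<partial>lborel) = (\<integral>z. \<rho> z \<partial>lborel)"
      unfolding r_def using lborel_pair.integral_fst'[OF \<rho>p] by (simp add: lborel_prod)
    finally show "emeasure (first_marginal \<rho>) (space (first_marginal \<rho>)) = 1" using one by simp
  qed
  fix f :: "real^'d \<Rightarrow> 'b"
  assume f: "f \<in> borel_measurable borel" and int: "integrable lborel (\<lambda>z. \<rho> z *\<^sub>R f (fst z))"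
  have intp: "integrable (lborel \<Otimes>\<^sub>M lborel) (\<lambda>z. \<rho> z *\<^sub>R f (fst z))" using int by (simp add: lborel_prod)
  have ae: "AE q in lborel. (\<integral>p. \<rho> (q, p) *\<^sub>R f (fst (q, p)) \<partial>lborel) = r q *\<^sub>R f q"
    using lborel_pair.AE_integrable_fst'[OF \<rho>p] by eventually_elim (simp add: r_def)
  have fl: "f \<in> borel_measurable lborel" using f by simp
  have m2: "(\<lambda>q. r q *\<^sub>R f q) \<in> borel_measurable lborel" using fl by simp
  have m1: "(\<lambda>q. \<integral>p. \<rho> (q, p) *\<^sub>R f (fst (q, p)) \<partial>lborel) \<in> borel_measurable lborel"
    using lborel_pair.integrable_fst'[OF intp] by (rule borel_measurable_integrable)
  have "integrable lborel (\<lambda>q. r q *\<^sub>R f q)"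
    using lborel_pair.integrable_fst'[OF intp] integrable_cong_AE[OF m1 m2 ae] by blast
  then have 1: "integrable (first_marginal \<rho>) f"
    unfolding fm using integrable_density[OF fl rm rnn] by blast
  have "(\<integral>q. f q \<partial>first_marginal \<rho>) = (\<integral>q. r q *\<^sub>R f q \<partial>lborel)"
    unfolding fm by (rule integral_density[OF fl rm rnn])
  also have "\<dots> = (\<integral>q. \<integral>p. \<rho> (q, p) *\<^sub>R f (fst (q, p)) \<partial>lborel \<partial>lborel)"
    by (rule integral_cong_AE[OF m1 m2 ae, symmetric])
  also have "\<dots> = (\<integral>z. \<rho> z *\<^sub>R f (fst z) \<partial>lborel)"
    using lborel_pair.integral_fst'[OF intp] by (simp add: lborel_prod)
  finally show "integrable (first_marginal \<rho>) f \<and> (\<integral>q. f q \<partial>first_marginal \<rho>) = (\<integral>z. \<rho> z *\<^sub>R f (fst z) \<partial>lborel)"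
    using 1 by blast
qed

theorem theorem1:
  fixes V \<psi> :: "real^'d \<Rightarrow> real"
    and lam :: real
    and \<rho> :: "(real^'d) \<times> (real^'d) \<Rightarrow> real"
  assumes "lam > 0"
    and "confining_potential V"
    and "interaction_potential \<psi>"
    and "vfp_invariant_probability lam V \<psi> \<rho>"
  shows "diffusion_invariant_probability lam V \<psi> (first_marginal \<rho>)"
proof -
  have \<rho>: "integrable lborel \<rho>" and nn: "AE z in lborel. 0 \<le> \<rho> z" and one: "(\<integral>z. \<rho> z \<partial>lborel) = 1"
    and c1: "conv_density_defined \<psi> \<rho>" and c2: "conv_density_defined (grad \<psi>) \<rho>"
    and stat: "vfp_stationary lam V \<psi> \<rho>"
    using assms(4) by (auto simp: vfp_invariant_probability_def)
  obtain C0 where C0: "AE z in lborel. \<bar>\<rho> z\<bar> \<le> C0"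
    using assms(4) by (auto simp: vfp_invariant_probability_def)
  have V: "smooth V" using assms(2) by (simp add: confining_potential_def assm_V1_def)
  obtain C2 C4 where C: "C2 > 0" "C4 > 0" and V3: "\<And>x. V x \<ge> C4 * norm x ^ 4 - C2 * (norm x)\<^sup>2"
    using assms(2) by (auto simp: confining_potential_def assm_V3_def)
  note \<psi>_nonneg = interaction_potential_properties(1)[OF assms(3)]
    and cg = interaction_potential_properties(3)[OF assms(3)]
  define W where "W q = V q + conv_density \<psi> \<rho> q" for q
  define b where "b q = grad V q + conv_density (grad \<psi>) \<rho> q" for q
  have cV: "continuous_on UNIV (grad V)"
  proof -
    have "grad V = (\<lambda>x. \<Sum>e\<in>Basis. ddir e V x *\<^sub>R e)"
      by (rule ext) (rule grad_has_derivative(2)[OF smooth_differentiable[OF V]])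
    moreover have "continuous_on UNIV (\<lambda>x. \<Sum>e\<in>Basis. ddir e V x *\<^sub>R e)"
      by (intro continuous_intros smooth_continuous smooth_ddir V)
    ultimately show ?thesis by simp
  qed
  have b_cont: "continuous_on UNIV b"
    unfolding b_def by (intro continuous_on_add cV mean_field_potential(2)[OF assms(3) \<rho> c1 c2])
  interpret kinetic_equilibrium lam W b \<rho> "(C2 + 1)\<^sup>2 / (4 * C4)" "max 1 C0"
  proof
    show "0 < lam" by (rule assms(1))
    show "continuous_on UNIV b" by (rule b_cont)
    show "integrable lborel \<rho>" by (rule \<rho>)
    show "0 < max 1 C0" by simp
    show "AE z in lborel. 0 \<le> \<rho> z \<and> \<rho> z \<le> max 1 C0"
      using nn C0 by eventually_elim auto
    show "(W has_derivative (\<lambda>v. b q \<bullet> v)) (at q)" for q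
    proof -
      have "(W has_derivative (\<lambda>v. v \<bullet> grad V q + v \<bullet> conv_density (grad \<psi>) \<rho> q)) (at q)"
        unfolding W_def
        by (intro has_derivative_add grad_has_derivative(1)[OF smooth_differentiable[OF V]]
            mean_field_potential(1)[OF assms(3) \<rho> c1 c2])
      then show ?thesis by (simp add: b_def inner_add_right[symmetric] inner_commute)
    qed
    show "(norm q)\<^sup>2 - (C2 + 1)\<^sup>2 / (4 * C4) \<le> W q" for q
    proof -
      \<comment> \<open>The constant comes from completing the square in \<open>C4 t\<^sup>2 - (C2 + 1) t\<close> with \<open>t = \<bar>q\<bar>\<^sup>2\<close>.\<close>
      have "0 \<le> (2 * C4 * (norm q)\<^sup>2 - (C2 + 1))\<^sup>2 / (4 * C4)" using C by simp
      also have "\<dots> = C4 * norm q ^ 4 - (C2 + 1) * (norm q)\<^sup>2 + (C2 + 1)\<^sup>2 / (4 * C4)"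
        using C by (simp add: field_simps power2_eq_square power4_eq_xxxx)
      finally have "(norm q)\<^sup>2 - (C2 + 1)\<^sup>2 / (4 * C4) \<le> C4 * norm q ^ 4 - C2 * (norm q)\<^sup>2"
        by (simp add: algebra_simps)
      moreover have "0 \<le> conv_density \<psi> \<rho> q"
        unfolding conv_density_def
        by (rule integral_nonneg_AE) (use nn in eventually_elim, simp add: \<psi>_nonneg)
      ultimately show ?thesis using V3[of q] by (simp add: W_def)
    qed
    fix \<phi> :: "(real^'d) \<times> (real^'d) \<Rightarrow> real"
    assume \<phi>: "test_function \<phi>"
    have "(\<integral>z. \<rho> z * (snd z \<bullet> grad_q \<phi> z - (b (fst z) + snd z) \<bullet> grad_p \<phi> z + lam * laplacian_p \<phi> z) \<partial>lborel) = 0"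
      using stat \<phi> unfolding vfp_stationary_def
      by (auto dest!: spec[of _ \<phi>] has_bochner_integral_integral_eq simp: case_prod_unfold b_def)
    then show "(\<integral>z. \<rho> z * (ddir (snd z, 0) \<phi> z - ddir (0, b (fst z) + snd z) \<phi> z
         + lam * (\<Sum>e\<in>Basis. ddir (0, e) (ddir (0, e) \<phi>) z)) \<partial>lborel) = 0"
      by (simp only: phase_space_operators[OF test_function_smooth[OF \<phi>]])
  qed
  note marginal = first_marginal_properties[OF \<rho> nn]
  have conv: "integrable (first_marginal \<rho>) (\<lambda>y. grad \<psi> (x - y))"
    "conv_measure (grad \<psi>) (first_marginal \<rho>) x = conv_density (grad \<psi>) \<rho> x" for x
  proof -
    have "continuous_on UNIV (\<lambda>y. grad \<psi> (x - y))"
      by (intro continuous_on_compose2[OF cg] continuous_intros) auto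
    then have m: "(\<lambda>y. grad \<psi> (x - y)) \<in> borel_measurable borel" by (rule borel_measurable_continuous_onI)
    have "integrable lborel (\<lambda>z. \<rho> z *\<^sub>R grad \<psi> (x - fst z))"
      using c2 by (simp add: conv_density_defined_def)
    from marginal(3)[OF m this] show "integrable (first_marginal \<rho>) (\<lambda>y. grad \<psi> (x - y))"
      "conv_measure (grad \<psi>) (first_marginal \<rho>) x = conv_density (grad \<psi>) \<rho> x"
      by (simp_all add: conv_measure_def conv_density_def)
  qed
  have gen: "integrable (first_marginal \<rho>) (\<lambda>x. lam * laplacian \<phi> x - (grad V x + conv_density (grad \<psi>) \<rho> x) \<bullet> grad \<phi> x)
    \<and> (\<integral>x. lam * laplacian \<phi> x - (grad V x + conv_density (grad \<psi>) \<rho> x) \<bullet> grad \<phi> x \<partial>first_marginal \<rho>) = 0"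
    if \<phi>: "test_function \<phi>" for \<phi>
  proof -
    note s = test_function_smooth[OF \<phi>]
    define L where "L q = lam * (\<Sum>e\<in>Basis. ddir e (ddir e \<phi>) q) - ddir (b q) \<phi> q" for q
    have L: "lam * laplacian \<phi> q - (grad V q + conv_density (grad \<psi>) \<rho> q) \<bullet> grad \<phi> q = L q" for q
      unfolding L_def laplacian_eq[OF s] grad_has_derivative(3)[OF smooth_differentiable[OF s]] b_def by (rule refl)
    obtain r where r: "\<And>x. r < norm x \<Longrightarrow> \<phi> x = 0" using test_function_zero_outside[OF \<phi>] by blast
    have zL: "L x = 0" if "r < norm x" for x
      using that ddir_zero_outside[OF smooth_differentiable[OF s] r]
        ddir_zero_outside[OF smooth_differentiable[OF smooth_ddir[OF s]], of r] by (simp add: L_def)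
    have cL: "continuous_on UNIV L"
      unfolding L_def ddir_basis_sum[OF smooth_differentiable[OF s], where v="b _"]
      by (intro continuous_intros smooth_continuous smooth_ddir s b_cont)
    obtain B where B: "\<And>x. \<bar>L x\<bar> \<le> B" using compact_support_bounded[OF cL zL] by blast
    have "continuous_on UNIV (\<lambda>z::(real^'d)\<times>(real^'d). L (fst z))"
      by (intro continuous_on_compose2[OF cL] continuous_intros) auto
    then have mf: "(\<lambda>z::(real^'d)\<times>(real^'d). L (fst z)) \<in> borel_measurable borel" by (rule borel_measurable_continuous_onI)
    have "integrable lborel (\<lambda>z. \<rho> z *\<^sub>R L (fst z))"
    proof (rule Bochner_Integration.integrable_bound[of _ "\<lambda>z. B * \<rho> z"])
      show "AE z in lborel. norm (\<rho> z *\<^sub>R L (fst z)) \<le> norm (B * \<rho> z)"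
      proof (rule AE_I2)
        fix z show "norm (\<rho> z *\<^sub>R L (fst z)) \<le> norm (B * \<rho> z)"
          using mult_right_mono[OF order_trans[OF B[of "fst z"] abs_ge_self], of "\<bar>\<rho> z\<bar>"]
          by (simp add: abs_mult mult.commute)
      qed
    qed (use \<rho> mf in auto)
    moreover have "(\<integral>z. \<rho> z * L (fst z) \<partial>lborel) = 0"
      unfolding L_def by (rule diffusion_identity[OF \<phi>])
    ultimately have "integrable (first_marginal \<rho>) L \<and> (\<integral>q. L q \<partial>first_marginal \<rho>) = 0"
      using marginal(3)[OF borel_measurable_continuous_onI[OF cL]] by simp
    then show ?thesis unfolding L by simp
  qed
  show ?thesis
    unfolding diffusion_invariant_probability_def forward_kolmogorov_solution_def conv_measure_defined_def Let_def conv(2)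
    using marginal(1) marginal(2)[OF one] conv(1) gen by auto
qed

end
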